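(* Let $p$ be an odd prime with $p\not\equiv 7\pmod 8$, let $\delta_p$ be an integer with $8\delta_p\equiv 1\pmod{p^2}$, and let $k,n\in\mathbb Z$ with $\left(\frac{k}{p}\right)=1$. Then $$N_A(p^2n+(pk+1)\delta_p)\equiv 0\pmod 4.$$
   Context: Let $(a;q)_n=\prod_{j=0}^{n-1}(1-aq^j)$. Define $N_A(n)$ by $A(q)=\sum_{n\ge0}N_A(n)q^n=\sum_{n\ge 0}\frac{q^{n+1}(-q^2;q^2)_n}{(q;q^2)_{n+1}}$, with $N_A(m)=0$ for $m<0$. $\left(\frac{\cdot}{\cdot}\right)$ is the Kronecker symbol. *)

theory Defs
  imports
    "HOL-Computational_Algebra.Formal_Power_Series"
    "HOL-Number_Theory.Number_Theory"
begin

definition qpoch :: "'a::comm_ring_1 \<Rightarrow> 'a \<Rightarrow> nat \<Rightarrow> 'a" where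
  "qpoch a q n = (\<Prod>j<n. 1 - a * q ^ j)"

text \<open>
  All series have integer coefficients, so we work with formal power series over the integers,
  with \<^const>\<open>fps_X\<close> in the role of \<open>q\<close>.  The class operation \<^const>\<open>inverse\<close> is not
  available over the integers; the reciprocal of an integer series \<open>f\<close> with constant term 1 is
  \<open>fps_right_inverse f 1\<close>, the series \<open>g\<close> with constant term 1 such that \<open>f * g = 1\<close>
  (see \<open>mock_A_term_reciprocal\<close>).
\<close>

definition mock_A_term :: "nat \<Rightarrow> int fps" where
  "mock_A_term n =
     fps_X ^ (n + 1) * qpoch (- (fps_X ^ 2)) (fps_X ^ 2) n *
     fps_right_inverse (qpoch fps_X (fps_X ^ 2) (n + 1)) 1"

text \<open>The infinite sum is taken in the \<open>q\<close>-adic topology; it converges by \<open>summable_mock_A_term\<close>.\<close>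

definition mock_A :: "int fps" where
  "mock_A = (\<Sum>n. mock_A_term n)"

definition N_A :: "int \<Rightarrow> int" where
  "N_A m = (if m < 0 then 0 else fps_nth mock_A (nat m))"

lemma mock_A_term_reciprocal:
  "qpoch fps_X (fps_X ^ 2) n * fps_right_inverse (qpoch fps_X (fps_X ^ 2) n) 1 = (1 :: int fps)"
  by (rule fps_right_inverse) (induction n, simp_all add: qpoch_def)

lemma mock_A_term_nth_eq_0:
  assumes "i \<le> n"
  shows "fps_nth (mock_A_term n) i = 0"
  using assms by (simp add: mock_A_term_def mult.assoc fps_X_power_mult_nth del: power_Suc)

lemma summable_mock_A_term: "summable mock_A_term"
proof -
  have "mock_A_term sums Abs_fps (\<lambda>i. \<Sum>n<i. fps_nth (mock_A_term n) i)"
    unfolding sums_def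
  proof (rule tendsto_fpsI)
    fix i
    have "fps_nth (\<Sum>n<N. mock_A_term n) i = (\<Sum>n<i. fps_nth (mock_A_term n) i)" if "N \<ge> i" for N
      unfolding fps_sum_nth
      by (rule sum.mono_neutral_right) (use that in \<open>auto simp: mock_A_term_nth_eq_0\<close>)
    then show "\<forall>\<^sub>F N in sequentially. fps_nth (\<Sum>n<N. mock_A_term n) i =
        fps_nth (Abs_fps (\<lambda>i. \<Sum>n<i. fps_nth (mock_A_term n) i)) i"
      by (auto simp: eventually_sequentially)
  qed
  then show ?thesis by (rule sums_summable)
qed

end

theory Submission
  imports Defs "HOL-Computational_Algebra.Nth_Powers"
begin

text \<open>
  Write \<open>q\<close> for the variable and \<open>Q = q\<^sup>2\<close>.  In the notation of Fine, \<open>A\<close> is \<open>q F(-1, q)\<close> with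
  \<open>F(\<alpha>, t) = \<Sum>n. (\<alpha>Q; Q)\<^sub>n t\<^sup>n / (t; Q)\<^sub>n\<^sub>+\<^sub>1\<close>.  The Rogers-Fine identity only involves the squares
  \<open>(1 - \<alpha>Q\<^sup>k)\<^sup>2\<close>, \<open>(1 - tQ\<^sup>k)\<^sup>2\<close> and the product \<open>\<alpha>t\<close>, so modulo 4 one may replace \<open>(-1, q)\<close> by
  \<open>(1, -q)\<close>.  The resulting series is, up to signs, the generating function of the class numbers
  \<open>H(8m - 1)\<close>, where a class of forms of discriminant \<open>-N\<close> is counted by its unique representative
  \<open>2Ax\<^sup>2 + vxy + 2Cy\<^sup>2\<close> with \<open>\<bar>v\<bar> < 4A\<close> and \<open>\<bar>v\<bar> < 4C\<close> under \<open>\<Gamma>(2)\<close>.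

  For the given arguments \<open>N = 8m - 1\<close> is \<open>pr\<close> with \<open>r\<close> a nonzero square modulo \<open>p\<close>, and \<open>r\<close> is
  not a perfect square since \<open>p\<close> is not 7 modulo 8.  The genus character at \<open>p\<close> splits the classes
  into two parts.  They are exchanged by multiplication with an ideal of prime norm \<open>l\<close>, where \<open>l\<close> is a
  nonresidue of \<open>p\<close> and \<open>-N\<close> is a square modulo \<open>l\<close>; without such an \<open>l\<close> the convolution of the two
  characters belonging to \<open>N = pr\<close> would be nonnegative with too large partial sums.  Finally, one
  part has even size: an involution leaves the ambiguous classes, which correspond to divisors \<open>c\<close> of
  \<open>r\<close>, and here \<open>c \<mapsto> r / c\<close> preserves the genus character and has no fixed point.
\<close>


section \<open>Fine's series modulo 4\<close>

definition fps_recip :: "'a::comm_ring_1 fps \<Rightarrow> 'a fps" where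
  "fps_recip f = fps_right_inverse f 1"

lemma fps_recip: "fps_nth f 0 = 1 \<Longrightarrow> f * fps_recip f = 1"
  unfolding fps_recip_def by (rule fps_right_inverse) simp

lemma fps_recip_mult:
  assumes "fps_nth f 0 = 1" "fps_nth g 0 = 1"
  shows "f * fps_recip (f * g) = fps_recip g"
proof -
  have "fps_recip g = (f * g) * fps_recip (f * g) * fps_recip g"
    using assms fps_recip [of "f * g"] by (simp add: fps_mult_nth_0)
  also have "\<dots> = f * fps_recip (f * g) * (g * fps_recip g)"
    by (simp only: mult_ac)
  also have "\<dots> = f * fps_recip (f * g)"
    using fps_recip [OF assms(2)] by simp
  finally show ?thesis ..
qed

lemma fps_recip_unique:
  assumes "f * g = 1" "fps_nth f 0 = 1"
  shows "fps_recip f = g"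
proof -
  have "fps_recip f = (f * g) * fps_recip f" using assms(1) by simp
  also have "\<dots> = (f * fps_recip f) * g" by (simp only: mult_ac)
  finally show ?thesis using fps_recip [OF assms(2)] by simp
qed

lemma fps_power_mult_nth_eq_0:
  fixes t g :: "'a::comm_ring_1 fps"
  assumes "fps_nth t 0 = 0" "i < n"
  shows "fps_nth (t ^ n * g) i = 0"
  using assms by (auto simp: fps_mult_nth startsby_zero_power_prefix intro!: sum.neutral)

lemma qpoch_Suc: "qpoch a q (Suc n) = qpoch a q n * (1 - a * q ^ n)"
  by (simp add: qpoch_def)

lemma qpoch_0 [simp]: "qpoch a q 0 = 1"
  by (simp add: qpoch_def)

lemma qpoch_Suc_shift: "qpoch a q (Suc n) = (1 - a) * qpoch (a * q) q n"
  unfolding qpoch_def by (subst prod.lessThan_Suc_shift) (simp add: mult_ac)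

lemma qpoch_nth_0:
  assumes "fps_nth a 0 = 0"
  shows "fps_nth (qpoch a q n) 0 = 1"
  by (induction n) (simp_all add: qpoch_Suc assms)

section \<open>Sums that converge q-adically\<close>

definition fps_small :: "(nat \<Rightarrow> 'a::comm_ring_1 fps) \<Rightarrow> bool" where
  "fps_small f \<longleftrightarrow> (\<forall>n i. i < n \<longrightarrow> fps_nth (f n) i = 0)"

text \<open>
  The sum of a series whose \<open>n\<close>-th term is a multiple of \<open>q\<^sup>n\<close>, as expressed by \<^const>\<open>fps_small\<close>;
  for other series the value is meaningless.
\<close>

definition fsum :: "(nat \<Rightarrow> 'a::comm_ring_1 fps) \<Rightarrow> 'a fps" where
  "fsum f = Abs_fps (\<lambda>i. \<Sum>n\<le>i. fps_nth (f n) i)"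

lemma fsum_nth:
  assumes "fps_small f" "i \<le> M"
  shows "fps_nth (fsum f) i = (\<Sum>n\<le>M. fps_nth (f n) i)"
  unfolding fsum_def fps_nth_Abs_fps
  by (rule sum.mono_neutral_left) (use assms in \<open>auto simp: fps_small_def\<close>)

lemma fps_small_mult: "fps_small f \<Longrightarrow> fps_small (\<lambda>n. c n * f n)"
  unfolding fps_small_def by (auto simp: fps_mult_nth intro!: sum.neutral)

lemma fps_small_Suc: "fps_small f \<Longrightarrow> fps_small (\<lambda>n. f (Suc n))"
  unfolding fps_small_def by auto

lemma fps_small_power: "fps_nth t 0 = 0 \<Longrightarrow> fps_small (\<lambda>n. t ^ n * g n)"
  unfolding fps_small_def by (auto intro: fps_power_mult_nth_eq_0)

lemma fps_small_diff: "fps_small f \<Longrightarrow> fps_small g \<Longrightarrow> fps_small (\<lambda>n. f n - g n)"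
  unfolding fps_small_def by auto

lemma fsum_diff: "fsum (\<lambda>n. f n - g n) = fsum f - fsum g"
  by (simp add: fsum_def fps_eq_iff sum_subtractf)

lemma fsum_cmult:
  assumes "fps_small f"
  shows "fsum (\<lambda>n. c * f n) = c * fsum f"
proof (rule fps_ext)
  fix i
  have "fps_nth (fsum (\<lambda>n. c * f n)) i = (\<Sum>n\<le>i. \<Sum>j=0..i. fps_nth c j * fps_nth (f n) (i - j))"
    by (simp add: fsum_def fps_mult_nth)
  also have "\<dots> = (\<Sum>j=0..i. fps_nth c j * (\<Sum>n\<le>i. fps_nth (f n) (i - j)))"
    by (subst sum.swap) (simp add: sum_distrib_left)
  also have "\<dots> = (\<Sum>j=0..i. fps_nth c j * fps_nth (fsum f) (i - j))"
    by (rule sum.cong) (simp_all add: fsum_nth [OF assms, symmetric])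
  finally show "fps_nth (fsum (\<lambda>n. c * f n)) i = fps_nth (c * fsum f) i"
    by (simp add: fps_mult_nth)
qed

lemma fsum_Suc:
  assumes "fps_small f"
  shows "fsum f = f 0 + fsum (\<lambda>n. f (Suc n))"
proof (rule fps_ext)
  fix i
  have "fps_nth (fsum f) i = (\<Sum>n\<le>Suc i. fps_nth (f n) i)"
    by (rule fsum_nth [OF assms]) simp
  also have "\<dots> = fps_nth (f 0) i + (\<Sum>n\<le>i. fps_nth (f (Suc n)) i)"
    by (rule sum.atMost_Suc_shift)
  finally show "fps_nth (fsum f) i = fps_nth (f 0 + fsum (\<lambda>n. f (Suc n))) i"
    by (simp add: fsum_def)
qed

text \<open>The hypothesis makes \<open>c\<close> the q-adic limit of \<open>g\<close>, with a rate:
  the partial sum that determines degree \<open>i\<close> ends at \<open>g (Suc i)\<close>, which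
  already agrees with \<open>c\<close> there.\<close>

lemma fsum_telescope:
  assumes "\<And>i n. i < n \<Longrightarrow> fps_nth (g n) i = fps_nth c i"
  shows "fsum (\<lambda>n. g (Suc n) - g n) = c - g 0"
proof (rule fps_ext)
  fix i
  have "fps_nth (fsum (\<lambda>n. g (Suc n) - g n)) i = (\<Sum>n<Suc i. fps_nth (g (Suc n)) i - fps_nth (g n) i)"
    by (simp add: fsum_def lessThan_Suc_atMost)
  also have "\<dots> = fps_nth (g (Suc i)) i - fps_nth (g 0) i"
    by (rule sum_lessThan_telescope)
  finally show "fps_nth (fsum (\<lambda>n. g (Suc n) - g n)) i = fps_nth (c - g 0) i"
    using assms [of i "Suc i"] by simp
qed

lemma fsum_cong: "(\<And>n. f n = g n) \<Longrightarrow> fsum f = fsum g"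
  by presburger

section \<open>Fine's function and its iteration\<close>

definition qq :: "int fps" where "qq = fps_X ^ 2"

lemma qq_nth_0 [simp]: "fps_nth qq 0 = 0"
  by (simp add: qq_def)

text \<open>Fine's \<open>F(\<alpha>, t)\<close> to the base \<open>q\<^sup>2\<close>, with the parameters \<open>b\<close> and \<open>t\<close> of the general series equal.\<close>

definition fine_term :: "int fps \<Rightarrow> int fps \<Rightarrow> nat \<Rightarrow> int fps" where
  "fine_term \<alpha> t n = t ^ n * (qpoch (\<alpha> * qq) qq n * fps_recip (qpoch t qq (Suc n)))"

lemma fps_small_fine_term: "fps_nth t 0 = 0 \<Longrightarrow> fps_small (fine_term \<alpha> t)"
  unfolding fine_term_def by (rule fps_small_power)

lemma fine_term_Suc:
  assumes "fps_nth t 0 = 0"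
  shows "fine_term \<alpha> t (Suc n) * (1 - t * qq ^ Suc n) = fine_term \<alpha> t n * t * (1 - \<alpha> * qq ^ Suc n)"
proof -
  have "(1 - t * qq ^ Suc n) * fps_recip ((1 - t * qq ^ Suc n) * qpoch t qq (Suc n)) = fps_recip (qpoch t qq (Suc n))"
    by (rule fps_recip_mult) (simp_all add: assms qpoch_nth_0)
  then have *: "fps_recip (qpoch t qq (Suc (Suc n))) * (1 - t * qq ^ Suc n) = fps_recip (qpoch t qq (Suc n))"
    by (metis qpoch_Suc mult.commute)
  have "fine_term \<alpha> t (Suc n) * (1 - t * qq ^ Suc n) = t ^ Suc n * qpoch (\<alpha> * qq) qq (Suc n) *
     (fps_recip (qpoch t qq (Suc (Suc n))) * (1 - t * qq ^ Suc n))"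
    by (simp add: fine_term_def mult_ac)
  also have "\<dots> = fine_term \<alpha> t n * t * (1 - \<alpha> * qq ^ Suc n)"
    unfolding * by (simp add: fine_term_def qpoch_Suc mult_ac)
  finally show ?thesis .
qed

text \<open>Pulling the first factor out of each Pochhammer product expresses the terms with shifted
  parameters as the original terms weighted by \<open>qq ^ n\<close>.\<close>

lemma fine_term_shift:
  assumes "fps_nth t 0 = 0"
  shows "(1 - \<alpha> * qq) * t * fine_term (\<alpha> * qq) (t * qq) n = (1 - t) * (qq ^ n * fine_term \<alpha> t (Suc n))"
proof -
  have "(1 - t) * fps_recip ((1 - t) * qpoch (t * qq) qq (Suc n)) = fps_recip (qpoch (t * qq) qq (Suc n))"
    by (rule fps_recip_mult) (simp_all add: assms qpoch_nth_0)
  then have *: "fps_recip (qpoch (t * qq) qq (Suc n)) = (1 - t) * fps_recip (qpoch t qq (Suc (Suc n)))"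
    by (metis qpoch_Suc_shift)
  show ?thesis
    unfolding fine_term_def * qpoch_Suc_shift [of "\<alpha> * qq"] by (simp add: power_mult_distrib mult_ac)
qed

definition fine :: "int fps \<Rightarrow> int fps \<Rightarrow> int fps" where
  "fine \<alpha> t = fsum (fine_term \<alpha> t)"

text \<open>One step of the iteration that yields the Rogers-Fine identity.\<close>

lemma fine_rec:
  assumes t: "fps_nth t 0 = 0"
  shows "(1 - t)\<^sup>2 * fine \<alpha> t = (1 - \<alpha> * t * qq) + (1 - \<alpha> * qq)\<^sup>2 * t\<^sup>2 * qq * fine (\<alpha> * qq) (t * qq)"
proof -
  let ?T = "fine_term \<alpha> t"
  \<comment> \<open>The weighted sum \<open>W\<close> is an auxiliary unknown. Summing
    \<open>fine_term_Suc\<close> relates it to \<open>fine \<alpha> t\<close> (\<open>e1\<close>),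
    and \<open>fine_term_shift\<close> relates it to the shifted series (\<open>e2\<close>);
    eliminating \<open>W\<close> gives the recursion.\<close>
  define W where "W = fsum (\<lambda>n. qq ^ n * ?T n)"
  note small = fps_small_fine_term [OF t, of \<alpha>]
  have T0: "?T 0 * (1 - t) = 1"
    using fps_recip [of "1 - t"] t by (simp add: fine_term_def qpoch_Suc mult_ac)
  have sW: "fsum (\<lambda>n. qq ^ Suc n * ?T (Suc n)) = W - ?T 0"
    unfolding W_def by (subst fsum_Suc [OF fps_small_mult [OF small]]) simp
  have sT: "fsum (\<lambda>n. ?T (Suc n)) = fine \<alpha> t - ?T 0"
    unfolding fine_def by (subst fsum_Suc [OF small]) simp
  have "fsum (\<lambda>n. ?T (Suc n) - t * (qq ^ Suc n * ?T (Suc n))) = fsum (\<lambda>n. t * ?T n - (\<alpha> * t * qq) * (qq ^ n * ?T n))"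
    by (rule fsum_cong) (use fine_term_Suc [OF t, of \<alpha>] in \<open>simp add: algebra_simps\<close>)
  then have "(fine \<alpha> t - ?T 0) - t * (W - ?T 0) = t * fine \<alpha> t - \<alpha> * t * qq * W"
    by (simp only: fsum_diff sT sW fsum_cmult [OF small] fine_def [symmetric] W_def [symmetric]
        fsum_cmult [OF fps_small_mult [OF small]] fsum_cmult [OF fps_small_Suc [OF fps_small_mult [OF small]]])
  then have e1: "(1 - t) * fine \<alpha> t = 1 + t * (1 - \<alpha> * qq) * W"
  proof -
    have "(1 - t) * fine \<alpha> t = ?T 0 * (1 - t) + t * (1 - \<alpha> * qq) * W"
      using \<open>(fine \<alpha> t - ?T 0) - t * (W - ?T 0) = t * fine \<alpha> t - \<alpha> * t * qq * W\<close>
      by (simp add: algebra_simps)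
    then show ?thesis unfolding T0 .
  qed
  have "(1 - \<alpha> * qq) * t * fine (\<alpha> * qq) (t * qq) = fsum (\<lambda>n. (1 - \<alpha> * qq) * t * fine_term (\<alpha> * qq) (t * qq) n)"
    unfolding fine_def by (rule fsum_cmult [symmetric]) (simp add: fps_small_fine_term t)
  also have "\<dots> = (1 - t) * fsum (\<lambda>n. qq ^ n * ?T (Suc n))"
    unfolding fine_term_shift [OF t] by (rule fsum_cmult) (intro fps_small_mult fps_small_Suc small)
  finally have "(1 - \<alpha> * qq) * t * fine (\<alpha> * qq) (t * qq) * qq = (1 - t) * (qq * fsum (\<lambda>n. qq ^ n * ?T (Suc n)))"
    by (simp only: mult_ac)
  also have "qq * fsum (\<lambda>n. qq ^ n * ?T (Suc n)) = W - ?T 0"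
    unfolding sW [symmetric]
    by (subst fsum_cmult [symmetric]) (intro fps_small_mult fps_small_Suc small, simp add: mult_ac)
  finally have e2: "(1 - \<alpha> * qq) * t * fine (\<alpha> * qq) (t * qq) * qq = (1 - t) * (W - ?T 0)" .
  have "(1 - t)\<^sup>2 * fine \<alpha> t = (1 - t) * ((1 - t) * fine \<alpha> t)"
    by (simp add: power2_eq_square mult_ac)
  also have "\<dots> = (1 - t) + t * (1 - \<alpha> * qq) * ((1 - t) * (W - ?T 0) + ?T 0 * (1 - t))"
    unfolding e1 by (simp add: algebra_simps)
  also have "\<dots> = (1 - t) + t * (1 - \<alpha> * qq) * ((1 - \<alpha> * qq) * t * fine (\<alpha> * qq) (t * qq) * qq + 1)"
    unfolding e2 T0 ..
  also have "\<dots> = (1 - \<alpha> * t * qq) + (1 - \<alpha> * qq)\<^sup>2 * t\<^sup>2 * qq * fine (\<alpha> * qq) (t * qq)"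
    by (simp add: algebra_simps power2_eq_square)
  finally show ?thesis .
qed

section \<open>The change of parameters modulo 4\<close>

definition fps_dvd_upto :: "int \<Rightarrow> nat \<Rightarrow> int fps \<Rightarrow> bool" where
  "fps_dvd_upto c n f \<longleftrightarrow> (\<forall>j<n. c dvd fps_nth f j)"

lemma fps_dvd_upto_mult: "fps_dvd_upto c n f \<Longrightarrow> fps_dvd_upto c n (g * f)"
  unfolding fps_dvd_upto_def by (auto simp: fps_mult_nth intro!: dvd_sum dvd_mult)

lemma fps_dvd_upto_X: "fps_dvd_upto c n f \<Longrightarrow> fps_dvd_upto c (Suc n) (fps_X * f)"
  unfolding fps_dvd_upto_def by (auto simp: less_Suc_eq_0_disj)

lemma fps_dvd_upto_add: "fps_dvd_upto c n f \<Longrightarrow> fps_dvd_upto c n g \<Longrightarrow> fps_dvd_upto c n (f + g)"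
  unfolding fps_dvd_upto_def by auto

lemma fps_dvd_upto_const: "fps_dvd_upto c n (fps_const c * f)"
  unfolding fps_dvd_upto_def by auto

text \<open>Both series satisfy \<open>fine_rec\<close> with the same product
  \<open>\<alpha> * t\<close>, and the squares in it differ by multiples of 4. The remaining
  difference is the one for \<open>Suc k\<close>, with a factor \<open>qq\<close> that gains
  precision; hence the induction on \<open>n\<close> for arbitrary \<open>k\<close>.\<close>

lemma fine_cong_mod_4:
  "fps_dvd_upto 4 n (fine (- (qq ^ k)) (fps_X * qq ^ k) - fine (qq ^ k) (- fps_X * qq ^ k))"
proof (induction n arbitrary: k)
  case 0
  show ?case by (simp add: fps_dvd_upto_def)
next
  case (Suc n)
  define s u where "s = fps_X * qq ^ k" and "u = qq ^ Suc k"
  define A B A' B' where "A = fine (- (qq ^ k)) s" and "B = fine (qq ^ k) (- s)"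
    and "A' = fine (- u) (s * qq)" and "B' = fine u (- (s * qq))"
  have s0: "fps_nth s 0 = 0" by (simp add: s_def)
  have four: "fps_const 4 = (4 :: int fps)"
    by (simp add: fps_numeral_fps_const)
  have eA: "(1 - s)\<^sup>2 * A = (1 + qq ^ k * s * qq) + (1 + u)\<^sup>2 * s\<^sup>2 * qq * A'"
    using fine_rec [OF s0, of "- (qq ^ k)"] by (simp add: A_def A'_def u_def mult_ac)
  have eB: "(1 + s)\<^sup>2 * B = (1 + qq ^ k * s * qq) + (1 - u)\<^sup>2 * s\<^sup>2 * qq * B'"
    using fine_rec [of "- s" "qq ^ k"] s0 by (simp add: B_def B'_def u_def mult_ac)
  have "(1 - s)\<^sup>2 * (A - B) = (1 + u)\<^sup>2 * s\<^sup>2 * qq * (A' - B') + 4 * (s * B + u * s\<^sup>2 * qq * B')"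
  proof -
    have "(1 - s)\<^sup>2 * (A - B) = (1 - s)\<^sup>2 * A - (1 + s)\<^sup>2 * B + 4 * (s * B)"
      by (simp add: algebra_simps power2_eq_square)
    moreover have "(1 - u)\<^sup>2 = (1 + u)\<^sup>2 - 4 * u"
      by (simp add: algebra_simps power2_eq_square)
    ultimately show ?thesis
      unfolding eA eB by (simp add: algebra_simps)
  qed
  moreover have "fps_dvd_upto 4 (Suc n) ((1 + u)\<^sup>2 * s\<^sup>2 * qq * (A' - B'))"
  proof -
    have "fps_dvd_upto 4 n (A' - B')"
      using Suc.IH [of "Suc k"] by (simp add: A'_def B'_def s_def u_def mult_ac)
    then have "fps_dvd_upto 4 (Suc n) ((1 + u)\<^sup>2 * s\<^sup>2 * fps_X * (fps_X * (A' - B')))"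
      by (intro fps_dvd_upto_mult fps_dvd_upto_X)
    then show ?thesis by (simp add: qq_def power2_eq_square mult_ac)
  qed
  ultimately have "fps_dvd_upto 4 (Suc n) ((1 - s)\<^sup>2 * (A - B))"
    using fps_dvd_upto_const [of 4 "Suc n" "s * B + u * s\<^sup>2 * qq * B'"]
    by (simp add: fps_dvd_upto_add four)
  then have "fps_dvd_upto 4 (Suc n) (fps_recip ((1 - s)\<^sup>2) * ((1 - s)\<^sup>2 * (A - B)))"
    by (rule fps_dvd_upto_mult)
  moreover have "(1 - s)\<^sup>2 * fps_recip ((1 - s)\<^sup>2) = 1"
    by (rule fps_recip) (simp add: s0 power2_eq_square)
  ultimately show ?case
    by (simp add: mult.assoc [symmetric] A_def B_def s_def) (simp add: mult_ac)
qed

section \<open>A triple sum for Fine's series\<close>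

abbreviation qfac :: "nat \<Rightarrow> int fps" where "qfac n \<equiv> qpoch qq qq n"
abbreviation qfac_inv :: "nat \<Rightarrow> int fps" where "qfac_inv n \<equiv> fps_recip (qpoch qq qq n)"

lemma qfac_qfac_inv: "qfac n * qfac_inv n = 1"
  by (intro fps_recip qpoch_nth_0) simp

lemma qfac_inv_Suc: "(1 - qq ^ Suc n) * qfac_inv (Suc n) = qfac_inv n"
proof -
  have "qfac (Suc n) = (1 - qq ^ Suc n) * qfac n"
    by (simp add: qpoch_Suc mult_ac)
  then show ?thesis
    using fps_recip_mult [of "1 - qq ^ Suc n" "qfac n"] by (simp add: qpoch_nth_0)
qed

lemma qfac_Suc: "qfac (Suc n) = qfac n * (1 - qq ^ Suc n)"
  by (simp add: qpoch_Suc mult_ac)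

text \<open>The Rogers-Szego polynomial at the square root of the base factors.\<close>

lemma sum_qfac_inv:
  fixes y :: "int fps"
  assumes y: "y\<^sup>2 = qq" "fps_nth y 0 = 0"
  shows "(\<Sum>k\<le>n. y ^ k * (qfac_inv k * qfac_inv (n - k))) = fps_recip (qpoch y y n)"
proof -
  define E where "E n = (\<Sum>k\<le>n. y ^ k * (qfac_inv k * qfac_inv (n - k)))" for n
  have Qy: "qq ^ k = y ^ (2 * k)" for k
    by (simp add: y(1) [symmetric] power_mult [symmetric])
  \<comment> \<open>Writing \<open>1 - qq ^ ?N\<close> as
    \<open>qq ^ (?N - k) * (1 - qq ^ k) + (1 - qq ^ (?N - k))\<close> lets each part lower one
    index. The parts sum to \<open>y ^ ?N * E n\<close> (after reflecting \<open>k\<close>) and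
    \<open>E n\<close>, and the factor \<open>1 + y ^ ?N\<close> cancels.\<close>
  have rec: "(1 - y ^ Suc n) * E (Suc n) = E n" for n
  proof -
    let ?N = "Suc n"
    have split: "(1 - qq ^ ?N) * (y ^ k * (qfac_inv k * qfac_inv (?N - k))) =
        y ^ k * qq ^ (?N - k) * ((1 - qq ^ k) * qfac_inv k) * qfac_inv (?N - k) +
        y ^ k * qfac_inv k * ((1 - qq ^ (?N - k)) * qfac_inv (?N - k))" if "k \<le> ?N" for k
    proof -
      have "qq ^ ?N = qq ^ (?N - k) * qq ^ k"
        using that by (simp only: power_add [symmetric]) simp
      then show ?thesis by (simp add: algebra_simps del: power_Suc)
    qed
    have "(\<Sum>k\<le>?N. y ^ k * qq ^ (?N - k) * ((1 - qq ^ k) * qfac_inv k) * qfac_inv (?N - k)) =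
        (\<Sum>k\<le>n. y ^ Suc k * qq ^ (n - k) * qfac_inv k * qfac_inv (n - k))"
      by (subst sum.atMost_Suc_shift) (simp only: qfac_inv_Suc diff_Suc_Suc, simp)
    also have "\<dots> = (\<Sum>k\<le>n. y ^ Suc (n - k) * qq ^ k * qfac_inv (n - k) * qfac_inv k)"
      by (rule sum.reindex_bij_witness [of _ "\<lambda>k. n - k" "\<lambda>k. n - k"]) auto
    also have "\<dots> = (\<Sum>k\<le>n. y ^ Suc n * (y ^ k * (qfac_inv k * qfac_inv (n - k))))"
    proof (rule sum.cong [OF refl])
      fix k assume "k \<in> {..n}"
      then have "Suc (n - k) + 2 * k = Suc n + k" by simp
      then have "y ^ Suc (n - k) * qq ^ k = y ^ Suc n * y ^ k"
        unfolding Qy power_add [symmetric] by (rule arg_cong)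
      moreover have "y ^ Suc (n - k) * qq ^ k * qfac_inv (n - k) * qfac_inv k = (y ^ Suc (n - k) * qq ^ k) * (qfac_inv k * qfac_inv (n - k))"
        by (simp only: mult_ac)
      ultimately show "y ^ Suc (n - k) * qq ^ k * qfac_inv (n - k) * qfac_inv k = y ^ Suc n * (y ^ k * (qfac_inv k * qfac_inv (n - k)))"
        by (simp only: mult.assoc)
    qed
    also have "\<dots> = y ^ Suc n * E n"
      unfolding E_def by (rule sum_distrib_left [symmetric])
    finally have s1: "(\<Sum>k\<le>?N. y ^ k * qq ^ (?N - k) * ((1 - qq ^ k) * qfac_inv k) * qfac_inv (?N - k)) = y ^ Suc n * E n" .
    have "(\<Sum>k\<le>?N. y ^ k * qfac_inv k * ((1 - qq ^ (?N - k)) * qfac_inv (?N - k))) =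
       (\<Sum>k\<le>n. y ^ k * qfac_inv k * ((1 - qq ^ (?N - k)) * qfac_inv (?N - k)))"
      by (simp only: sum.atMost_Suc diff_self_eq_0 power_0 diff_self mult_zero_left mult_zero_right add_0_right)
    also have "\<dots> = E n"
      unfolding E_def
      by (rule sum.cong [OF refl]) (simp only: atMost_iff Suc_diff_le qfac_inv_Suc mult.assoc)
    finally have s2: "(\<Sum>k\<le>?N. y ^ k * qfac_inv k * ((1 - qq ^ (?N - k)) * qfac_inv (?N - k))) = E n" .
    have "(1 - qq ^ ?N) * E ?N = (\<Sum>k\<le>?N. (1 - qq ^ ?N) * (y ^ k * (qfac_inv k * qfac_inv (?N - k))))"
      unfolding E_def by (rule sum_distrib_left)
    also have "\<dots> = (\<Sum>k\<le>?N. y ^ k * qq ^ (?N - k) * ((1 - qq ^ k) * qfac_inv k) * qfac_inv (?N - k) +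
        y ^ k * qfac_inv k * ((1 - qq ^ (?N - k)) * qfac_inv (?N - k)))"
      by (rule sum.cong [OF refl]) (simp only: atMost_iff split)
    also have "\<dots> = (1 + y ^ ?N) * E n"
      unfolding sum.distrib s1 s2 by (simp add: algebra_simps)
    finally have "(1 - qq ^ ?N) * E ?N = (1 + y ^ ?N) * E n" .
    moreover have "1 - qq ^ ?N = (1 + y ^ ?N) * (1 - y ^ ?N)"
      unfolding Qy mult_2 power_add by (simp only: algebra_simps mult_1 mult_1_right)
    moreover have "1 + y ^ ?N \<noteq> 0"
    proof
      assume "1 + y ^ ?N = 0"
      then have "fps_nth (1 + y ^ ?N) 0 = 0" by simp
      then show False by (simp add: y)
    qed
    ultimately have "(1 + y ^ ?N) * ((1 - y ^ ?N) * E ?N) = (1 + y ^ ?N) * E n"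
      by (simp only: mult.assoc)
    with \<open>1 + y ^ ?N \<noteq> 0\<close> show ?thesis
      by (simp only: mult_cancel_left) simp
  qed
  have "qpoch y y n * E n = 1"
  proof (induction n)
    case 0
    show ?case using qfac_qfac_inv [of 0] by (simp add: E_def)
  next
    case (Suc n)
    then show ?case
      using rec [of n] by (simp add: qpoch_Suc mult.assoc)
  qed
  then show ?thesis
    using fps_recip_unique [of "qpoch y y n" "E n"] qpoch_nth_0 [OF y(2)] by (simp add: E_def)
qed

text \<open>The factor in the expansion of \<open>y * fine_term 1 y\<close> that involves
  \<open>y\<close> only through its square \<open>qq\<close>.\<close>

definition rr_term :: "nat \<Rightarrow> nat \<Rightarrow> int fps" where
  "rr_term i n = qq ^ n * ((qfac (n + i))\<^sup>2 * (qfac_inv n * qfac_inv (n + 2 * i + 1)))"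

lemma qpoch_odd_even:
  fixes y :: "int fps"
  assumes "y\<^sup>2 = qq"
  shows "qpoch y y (2 * n + 1) = qpoch y qq (Suc n) * qfac n"
proof (induction n)
  case (Suc n)
  have "y ^ (2 * n + 2) = qq ^ Suc n"
    unfolding assms [symmetric] power_mult [symmetric] by simp
  then have "y * y ^ (2 * n + 1) = qq * qq ^ n" "y * y ^ (2 * n + 2) = y * qq ^ Suc n"
    by simp_all
  moreover have "qpoch y y (2 * Suc n + 1) =
      qpoch y y (2 * n + 1) * (1 - y * y ^ (2 * n + 1)) * (1 - y * y ^ (2 * n + 2))"
    using qpoch_Suc [of y y "2 * n + 1"] qpoch_Suc [of y y "Suc (2 * n + 1)"] by simp
  ultimately show ?case
    unfolding Suc by (simp only: qpoch_Suc [of _ _ "Suc n"] qpoch_Suc [of qq]) (simp only: mult_ac)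
qed (simp add: qpoch_Suc)

text \<open>Multiplying by \<open>qfac n\<close> completes the denominator to
  \<open>qpoch y y (2 * n + 1)\<close>, which \<open>sum_qfac_inv\<close> expands. The indices
  \<open>k\<close> and \<open>2 * n + 1 - k\<close> carry the same reciprocals and are paired, with
  \<open>i = n - k\<close>.\<close>

lemma fine_term_expand:
  fixes y :: "int fps"
  assumes y: "y\<^sup>2 = qq" "fps_nth y 0 = 0"
  shows "y * fine_term 1 y n = (\<Sum>i\<le>n. (y ^ (i + 1) + y ^ (3 * i + 2)) * rr_term i (n - i))"
proof -
  have Qy: "qq ^ k = y ^ (2 * k)" for k
    by (simp add: y(1) [symmetric] power_mult [symmetric])
  have "qfac n * fps_recip (qfac n * qpoch y qq (Suc n)) = fps_recip (qpoch y qq (Suc n))"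
    by (rule fps_recip_mult) (simp_all add: qpoch_nth_0 y)
  then have *: "fps_recip (qpoch y qq (Suc n)) = qfac n * fps_recip (qpoch y y (2 * n + 1))"
    using qpoch_odd_even [OF y(1), of n] by (simp add: mult_ac)
  let ?t = "\<lambda>k. y ^ k * (qfac_inv k * qfac_inv (2 * n + 1 - k))"
  have "(\<Sum>k\<le>2 * n + 1. ?t k) = (\<Sum>k\<in>{..n} \<union> {n+1..2*n+1}. ?t k)"
    by (rule sum.cong) auto
  also have "\<dots> = (\<Sum>k\<le>n. ?t k) + (\<Sum>k\<in>{n+1..2*n+1}. ?t k)"
    by (rule sum.union_disjoint) auto
  also have "(\<Sum>k\<le>n. ?t k) = (\<Sum>k\<le>n. y ^ k * (qfac_inv k * qfac_inv (n + (n - k) + 1)))"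
  proof (rule sum.cong [OF refl])
    fix k assume "k \<in> {..n}"
    then have "2 * n + 1 - k = n + (n - k) + 1" by simp
    then show "?t k = y ^ k * (qfac_inv k * qfac_inv (n + (n - k) + 1))" by (simp only:)
  qed
  also have "\<dots> = (\<Sum>i\<le>n. y ^ (n - i) * (qfac_inv (n - i) * qfac_inv (n + i + 1)))"
    by (rule sum.reindex_bij_witness [of _ "\<lambda>k. n - k" "\<lambda>k. n - k"]) auto
  also have "(\<Sum>k\<in>{n+1..2*n+1}. ?t k) = (\<Sum>i\<le>n. y ^ (n + i + 1) * (qfac_inv (n + i + 1) * qfac_inv (n - i)))"
    by (rule sum.reindex_bij_witness [of _ "\<lambda>i. n + i + 1" "\<lambda>k. k - (n + 1)"]) (auto simp: mult_2)
  finally have E: "fps_recip (qpoch y y (2 * n + 1)) =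
      (\<Sum>i\<le>n. (y ^ (n - i) + y ^ (n + i + 1)) * (qfac_inv (n - i) * qfac_inv (n + i + 1)))"
    unfolding sum_qfac_inv [OF y] sum.distrib [symmetric] by (simp add: algebra_simps)
  have "y * fine_term 1 y n = y ^ Suc n * (qfac n)\<^sup>2 * fps_recip (qpoch y y (2 * n + 1))"
    unfolding fine_term_def * by (simp add: power2_eq_square mult_ac)
  also have "\<dots> = (\<Sum>i\<le>n. (y ^ (i + 1) + y ^ (3 * i + 2)) * rr_term i (n - i))"
    unfolding E sum_distrib_left
  proof (rule sum.cong [OF refl])
    fix i assume "i \<in> {..n}"
    then have i: "n - i + i = n" "n - i + 2 * i + 1 = n + i + 1"
      and a: "Suc n + (n - i) = i + 1 + 2 * (n - i)" "Suc n + (n + i + 1) = 3 * i + 2 + 2 * (n - i)" by auto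
    have "y ^ Suc n * y ^ (n - i) = y ^ (i + 1) * qq ^ (n - i)"
         "y ^ Suc n * y ^ (n + i + 1) = y ^ (3 * i + 2) * qq ^ (n - i)"
      unfolding Qy power_add [symmetric] a by simp_all
    then have "y ^ Suc n * (y ^ (n - i) + y ^ (n + i + 1)) = (y ^ (i + 1) + y ^ (3 * i + 2)) * qq ^ (n - i)"
      by (simp only: distrib_left distrib_right)
    moreover have "y ^ Suc n * (qfac n)\<^sup>2 * ((y ^ (n - i) + y ^ (n + i + 1)) * (qfac_inv (n - i) * qfac_inv (n + i + 1))) =
        (y ^ Suc n * (y ^ (n - i) + y ^ (n + i + 1))) * ((qfac n)\<^sup>2 * (qfac_inv (n - i) * qfac_inv (n + i + 1)))"
      by (simp only: mult_ac)
    ultimately show "y ^ Suc n * (qfac n)\<^sup>2 * ((y ^ (n - i) + y ^ (n + i + 1)) * (qfac_inv (n - i) * qfac_inv (n + i + 1))) =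
        (y ^ (i + 1) + y ^ (3 * i + 2)) * rr_term i (n - i)"
      unfolding rr_term_def i by (simp only: mult.assoc)
  qed
  finally show ?thesis .
qed

lemma fsum_triangle:
  assumes "\<And>i j m. m < i + j \<Longrightarrow> fps_nth (f i j) m = 0"
  shows "fsum (\<lambda>n. \<Sum>i\<le>n. f i (n - i)) = fsum (\<lambda>i. fsum (f i))"
proof (rule fps_ext)
  fix m
  have "fps_nth (fsum (\<lambda>n. \<Sum>i\<le>n. f i (n - i))) m = (\<Sum>n\<le>m. \<Sum>i\<le>n. fps_nth (f i (n - i)) m)"
    by (simp add: fsum_def fps_sum_nth)
  also have "\<dots> = (\<Sum>(i, j)\<in>{(i, j). i + j \<le> m}. fps_nth (f i j) m)"
    by (rule sum.triangle_reindex_eq [symmetric])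
  also have "\<dots> = (\<Sum>(i, j)\<in>{..m} \<times> {..m}. fps_nth (f i j) m)"
    by (rule sum.mono_neutral_left) (auto intro: assms)
  finally show "fps_nth (fsum (\<lambda>n. \<Sum>i\<le>n. f i (n - i))) m = fps_nth (fsum (\<lambda>i. fsum (f i))) m"
    by (simp add: fsum_def sum.cartesian_product)
qed

definition rr :: "nat \<Rightarrow> int fps" where "rr i = fsum (rr_term i)"

lemma fps_small_rr_term: "fps_small (rr_term i)"
  unfolding rr_term_def by (rule fps_small_power) simp

lemma fine_expand:
  fixes y :: "int fps"
  assumes y: "y\<^sup>2 = qq" "fps_nth y 0 = 0"
  shows "y * fine 1 y = fsum (\<lambda>i. (y ^ (i + 1) + y ^ (3 * i + 2)) * rr i)"
proof -
  have "y * fine 1 y = fsum (\<lambda>n. y * fine_term 1 y n)"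
    unfolding fine_def by (rule fsum_cmult [symmetric]) (rule fps_small_fine_term [OF y(2)])
  also have "\<dots> = fsum (\<lambda>i. fsum (\<lambda>n. (y ^ (i + 1) + y ^ (3 * i + 2)) * rr_term i n))"
    unfolding fine_term_expand [OF y]
  proof (rule fsum_triangle)
    fix i j m :: nat
    assume m: "m < i + j"
    have "(y ^ (i + 1) + y ^ (3 * i + 2)) * rr_term i j =
      y ^ (i + j) * (y ^ j * (y + y ^ (2 * i + 2)) * ((qfac (j + i))\<^sup>2 * (qfac_inv j * qfac_inv (j + 2 * i + 1))))"
      unfolding rr_term_def by (simp add: y(1) [symmetric] power_mult [symmetric] power_add [symmetric] ring_distribs mult.assoc [symmetric]) (simp add: mult_ac power_add power_mult power2_eq_square power3_eq_cube power_mult_distrib)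
    then show "fps_nth ((y ^ (i + 1) + y ^ (3 * i + 2)) * rr_term i j) m = 0"
      using fps_power_mult_nth_eq_0 [OF y(2) m] by simp
  qed
  also have "\<dots> = fsum (\<lambda>i. (y ^ (i + 1) + y ^ (3 * i + 2)) * rr i)"
    unfolding rr_def by (intro fsum_cong fsum_cmult fps_small_rr_term)
  finally show ?thesis .
qed

section \<open>A recursion for the inner sums\<close>

lemma dvd_mult_minus_one:
  fixes d f g :: "'a::comm_ring_1"
  assumes "d dvd f - 1" "d dvd g - 1"
  shows "d dvd f * g - 1"
proof -
  have "f * g - 1 = f * (g - 1) + (f - 1)"
    by (simp add: algebra_simps)
  then show ?thesis
    using assms by (simp only: dvd_add dvd_mult)
qed

text \<open>The two products differ by factors \<open>1 - qq ^ j\<close> with \<open>j > n\<close>,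
  which are 1 to order \<open>n\<close>. This provides the limit for the telescoping in
  \<open>rr_rec\<close>.\<close>

lemma qfac_qfac_inv_cong:
  assumes "n \<le> m"
  shows "fps_X ^ n dvd qfac m * qfac_inv n - 1" "fps_X ^ n dvd qfac n * qfac_inv m - 1"
proof -
  show 1: "fps_X ^ n dvd qfac m * qfac_inv n - 1"
    using assms
  proof (induction m rule: dec_induct)
    case base
    show ?case by (simp add: qfac_qfac_inv)
  next
    case (step m)
    have "fps_X ^ n dvd qq ^ Suc m"
      unfolding qq_def power_mult [symmetric] by (rule le_imp_power_dvd) (use step in simp)
    then have "fps_X ^ n dvd (1 - qq ^ Suc m) - 1"
      by simp
    from dvd_mult_minus_one [OF step.IH this] show ?case
      by (simp only: qfac_Suc mult_ac)
  qed
  have "qfac n * qfac_inv m - 1 = - (qfac n * qfac_inv m) * (qfac m * qfac_inv n - 1) + (qfac n * qfac_inv n) * (qfac m * qfac_inv m) - 1"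
    by (simp add: algebra_simps)
  also have "\<dots> = - (qfac n * qfac_inv m) * (qfac m * qfac_inv n - 1)"
    by (simp add: qfac_qfac_inv)
  finally show "fps_X ^ n dvd qfac n * qfac_inv m - 1"
    using 1 by simp
qed

lemma X_power_dvd_nth:
  assumes "fps_X ^ n dvd f - (g :: int fps)" "i < n"
  shows "fps_nth f i = fps_nth g i"
proof -
  obtain h where h: "f - g = fps_X ^ n * h"
    using assms(1) by (rule dvdE)
  have "fps_nth (f - g) i = 0"
    unfolding h by (rule fps_power_mult_nth_eq_0) (use assms(2) in simp_all)
  then show ?thesis by simp
qed

text \<open>A telescoping certificate: up to factors not depending on \<open>n\<close>, the terms of
  the difference on the left are \<open>g (Suc n) - g n\<close>, where \<open>g 0 = 0\<close> and
  \<open>g\<close> tends to 1.\<close>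

lemma rr_rec:
  "(1 - qq ^ (i + 1)) * (rr i - qq ^ (2 * i + 3) * rr (i + 1)) = 1 + qq ^ (i + 1)"
proof -
  define I where "I = i + 1"
  define g where "g n = (qfac (n + i))\<^sup>2 * (1 - qq ^ n) * qfac_inv n * qfac_inv (n + 2 * i + 1)" for n
  \<comment> \<open>\<open>S\<close> is \<open>qq * rr_term I\<close> delayed by one index, with
    \<open>S 0 = 0\<close>. In this alignment \<open>rr_term i n\<close>, \<open>S n\<close>,
    \<open>g n\<close> and \<open>g (Suc n)\<close> all contain the factor
    \<open>P n\<close>.\<close>
  define S where "S n = qq ^ n * ((qfac (n + i))\<^sup>2 * (1 - qq ^ n) * qfac_inv n * qfac_inv (n + 2 * I))" for n
  define P where "P n = (qfac (n + i))\<^sup>2 * (qfac_inv n * qfac_inv (n + 2 * I))" for n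
  have a: "qfac_inv (n + 2 * i + 1) = (1 - qq ^ (n + 2 * I)) * qfac_inv (n + 2 * I)" for n
    using qfac_inv_Suc [of "n + 2 * i + 1"] by (simp add: I_def)
  have g: "g n = P n * ((1 - qq ^ n) * (1 - qq ^ (n + 2 * I)))" for n
    unfolding g_def P_def a by (simp only: mult_ac)
  have g': "g (Suc n) = P n * (1 - qq ^ (n + I))\<^sup>2" for n
  proof -
    have e: "Suc n + i = Suc (n + i)" "Suc n + 2 * i + 1 = n + 2 * I" "Suc (n + i) = n + I"
      by (simp_all add: I_def)
    have q: "qfac (Suc (n + i)) = qfac (n + i) * (1 - qq ^ (n + I))"
      using qfac_Suc [of "n + i"] by (simp only: e(3))
    have "g (Suc n) = (qfac (n + i) * (1 - qq ^ (n + I)))\<^sup>2 * ((1 - qq ^ Suc n) * qfac_inv (Suc n)) * qfac_inv (n + 2 * I)"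
      unfolding g_def e(1,2) q by (simp only: mult_ac)
    also have "\<dots> = P n * (1 - qq ^ (n + I))\<^sup>2"
      unfolding qfac_inv_Suc P_def power_mult_distrib by (simp only: mult_ac)
    finally show ?thesis .
  qed
  have d: "rr_term i n - qq ^ (2 * I) * S n = P n * (qq ^ n * (1 - qq ^ (2 * I)))" for n
    unfolding rr_term_def a S_def P_def by (simp add: algebra_simps power_add)
  have tele: "(1 - qq ^ I)\<^sup>2 * (rr_term i n - qq ^ (2 * I) * S n) = (1 - qq ^ (2 * I)) * (g (Suc n) - g n)" for n
  proof -
    have "(1 - qq ^ (n + I))\<^sup>2 - (1 - qq ^ n) * (1 - qq ^ (n + 2 * I)) = qq ^ n * (1 - qq ^ I)\<^sup>2"
    proof -
      have "(1 - a * b)\<^sup>2 - (1 - a) * (1 - a * (b * b)) = a * (1 - b)\<^sup>2" for a b :: "int fps"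
        by (simp add: power2_eq_square algebra_simps)
      from this [of "qq ^ n" "qq ^ I"] show ?thesis
        by (simp only: power_add mult_2)
    qed
    then have "g (Suc n) - g n = P n * (qq ^ n * (1 - qq ^ I)\<^sup>2)"
      using right_diff_distrib [of "P n" "(1 - qq ^ (n + I))\<^sup>2" "(1 - qq ^ n) * (1 - qq ^ (n + 2 * I))"]
      by (simp only: g [of n] g' [of n])
    then show ?thesis
      unfolding d by (simp only: mult_ac)
  qed
  have smallS: "fps_small S"
    unfolding fps_small_def S_def by (simp add: fps_power_mult_nth_eq_0)
  have small: "fps_small (\<lambda>n. rr_term i n - qq ^ (2 * I) * S n)"
    by (intro fps_small_diff fps_small_mult smallS fps_small_rr_term)
  have "fsum S = S 0 + fsum (\<lambda>n. S (Suc n))"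
    by (rule fsum_Suc [OF smallS])
  also have "S 0 = 0" by (simp add: S_def)
  also have "(\<lambda>n. S (Suc n)) = (\<lambda>n. qq * rr_term I n)"
  proof
    fix n
    have e: "Suc n + i = n + I" "Suc n + 2 * I = n + 2 * I + 1" by (simp_all add: I_def)
    have "S (Suc n) = qq ^ Suc n * ((qfac (n + I))\<^sup>2 * ((1 - qq ^ Suc n) * qfac_inv (Suc n)) * qfac_inv (n + 2 * I + 1))"
      unfolding S_def e by (simp only: mult_ac)
    then show "S (Suc n) = qq * rr_term I n"
      unfolding qfac_inv_Suc rr_term_def by (simp only: power_Suc mult_ac)
  qed
  finally have sumS: "fsum S = qq * rr I"
    unfolding rr_def using fsum_cmult [OF fps_small_rr_term] by simp
  have lim: "fps_nth (g n) j = fps_nth 1 j" if "j < n" for n j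
  proof (rule X_power_dvd_nth [OF _ that])
    have *: "fps_X ^ n dvd qfac (n + i) * qfac_inv n - 1" "fps_X ^ n dvd qfac (n + i) * qfac_inv (n + 2 * i + 1) - 1"
    proof -
      show "fps_X ^ n dvd qfac (n + i) * qfac_inv n - 1"
        by (rule qfac_qfac_inv_cong) simp
      have "fps_X ^ (n + i) dvd qfac (n + i) * qfac_inv (n + 2 * i + 1) - 1"
        by (rule qfac_qfac_inv_cong) simp
      then show "fps_X ^ n dvd qfac (n + i) * qfac_inv (n + 2 * i + 1) - 1"
        by (rule power_le_dvd) simp
    qed
    have "fps_X ^ n dvd (1 - qq ^ n) - 1"
      by (simp add: qq_def power_mult [symmetric] le_imp_power_dvd)
    from dvd_mult_minus_one [OF dvd_mult_minus_one [OF * ] this]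
    show "fps_X ^ n dvd g n - 1"
      unfolding g_def power2_eq_square by (simp only: mult_ac)
  qed
  have "(1 - qq ^ I)\<^sup>2 * (rr i - qq ^ (2 * I) * (qq * rr I)) =
      fsum (\<lambda>n. (1 - qq ^ I)\<^sup>2 * (rr_term i n - qq ^ (2 * I) * S n))"
    using fsum_cmult [OF small, of "(1 - qq ^ I)\<^sup>2"] fsum_diff [of "rr_term i" "\<lambda>n. qq ^ (2 * I) * S n"]
      fsum_cmult [OF smallS, of "qq ^ (2 * I)"]
    by (simp only: sumS rr_def)
  also have "\<dots> = (1 - qq ^ (2 * I)) * fsum (\<lambda>n. g (Suc n) - g n)"
    unfolding tele
  proof (rule fsum_cmult)
    show "fps_small (\<lambda>n. g (Suc n) - g n)"
      unfolding fps_small_def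
    proof (intro allI impI)
      fix n j :: nat assume "j < n"
      then show "fps_nth (g (Suc n) - g n) j = 0"
        using lim [of j n] lim [of j "Suc n"] by simp
    qed
  qed
  also have "\<dots> = 1 - qq ^ (2 * I)"
  proof -
    have "g 0 = 0" by (simp add: g_def)
    then show ?thesis
      using fsum_telescope [of g 1, OF lim] by simp
  qed
  also have "\<dots> = (1 - qq ^ I) * (1 + qq ^ I)"
    unfolding mult_2 power_add by (simp add: algebra_simps)
  finally have "(1 - qq ^ I) * ((1 - qq ^ I) * (rr i - qq ^ (2 * I) * (qq * rr I))) = (1 - qq ^ I) * (1 + qq ^ I)"
    by (simp only: power2_eq_square mult.assoc)
  moreover have "1 - qq ^ I \<noteq> 0"
  proof
    assume "1 - qq ^ I = 0"
    then have "fps_nth (1 - qq ^ I) 0 = 0" by simp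
    then show False by (simp add: I_def)
  qed
  ultimately have "(1 - qq ^ I) * (rr i - qq ^ (2 * I) * (qq * rr I)) = 1 + qq ^ I"
    by (simp only: mult_cancel_left) simp
  moreover have "qq ^ (2 * I) * (qq * rr I) = qq ^ (2 * i + 3) * rr I"
  proof -
    have "2 * i + 3 = Suc (2 * I)" by (simp add: I_def)
    then show ?thesis by (simp only: power_Suc mult_ac)
  qed
  ultimately show ?thesis by (simp only: I_def)
qed

text \<open>
  The recursion just proved has a unique solution, and the number of representations of \<open>e/2\<close> by
  \<open>(i + 1)(u + c) + uc\<close> is one: \<open>(u + 1, c + 1)\<close> for \<open>i\<close> corresponds to \<open>(u, c)\<close> for \<open>i + 1\<close>, and the
  pairs with \<open>u = 0\<close> or \<open>c = 0\<close> contribute the right hand side.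
\<close>

definition quad_set :: "nat \<Rightarrow> nat \<Rightarrow> (nat \<times> nat) set" where
  "quad_set i e = {(u, c). 2 * ((i + 1) * (u + c) + u * c) = e}"

lemma finite_quad_set: "finite (quad_set i e)"
proof (rule finite_subset)
  show "quad_set i e \<subseteq> {..e} \<times> {..e}"
    unfolding quad_set_def by (auto simp: algebra_simps)
qed simp

definition quad_fps :: "nat \<Rightarrow> int fps" where
  "quad_fps i = Abs_fps (\<lambda>e. int (card (quad_set i e)))"

lemma qq_power_mult_nth: "fps_nth (qq ^ k * f) e = (if e < 2 * k then 0 else fps_nth f (e - 2 * k))"
  unfolding qq_def power_mult [symmetric] by (rule fps_X_power_mult_nth)

lemma card_quad_set:
  "int (card (quad_set i e)) =
     fps_nth (qq ^ (2 * i + 3) * quad_fps (i + 1)) e +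
     (if e = 0 then 1 else if 2 * (i + 1) dvd e then 2 else 0)"
proof -
  define B where "B = {(u, c) \<in> quad_set i e. u = 0 \<or> c = 0}"
  define C where "C = {(u, c) \<in> quad_set i e. u \<noteq> 0 \<and> c \<noteq> 0}"
  have fin: "finite B" "finite C"
    by (auto simp: B_def C_def intro: finite_subset [OF _ finite_quad_set [of i e]])
  have "quad_set i e = C \<union> B" "C \<inter> B = {}"
    by (auto simp: B_def C_def)
  then have card: "card (quad_set i e) = card C + card B"
    using card_Un_disjoint [OF fin(2,1)] by simp
  have "int (card C) = fps_nth (qq ^ (2 * i + 3) * quad_fps (i + 1)) e"
  proof (cases "e < 2 * (2 * i + 3)")
    case True
    have "C = {}"
    proof (rule ccontr)
      assume "C \<noteq> {}"
      then obtain u c where uc: "(u, c) \<in> C" by auto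
      then obtain u' c' where "u = Suc u'" "c = Suc c'"
        by (cases u; cases c) (auto simp: C_def)
      with uc True show False by (simp add: C_def quad_set_def algebra_simps)
    qed
    then show ?thesis using True by (simp add: qq_power_mult_nth)
  next
    case False
    have "bij_betw (\<lambda>(u, c). (Suc u, Suc c)) (quad_set (i + 1) (e - 2 * (2 * i + 3))) C"
    proof (rule bij_betw_byWitness [where f' = "\<lambda>(u, c). (u - 1, c - 1)"])
      show "(\<lambda>(u, c). (Suc u, Suc c)) ` quad_set (i + 1) (e - 2 * (2 * i + 3)) \<subseteq> C"
        using False by (auto simp: C_def quad_set_def algebra_simps)
      show "(\<lambda>(u, c). (u - 1, c - 1)) ` C \<subseteq> quad_set (i + 1) (e - 2 * (2 * i + 3))"
      proof clarify
        fix u c assume uc: "(u, c) \<in> C"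
        then obtain u' c' where "u = Suc u'" "c = Suc c'"
          by (cases u; cases c) (auto simp: C_def)
        with uc show "(u - 1, c - 1) \<in> quad_set (i + 1) (e - 2 * (2 * i + 3))"
          by (auto simp: C_def quad_set_def algebra_simps)
      qed
    qed (auto simp: C_def)
    then have "card C = card (quad_set (i + 1) (e - 2 * (2 * i + 3)))"
      by (metis bij_betw_same_card)
    then show ?thesis using False by (simp add: qq_power_mult_nth quad_fps_def)
  qed
  moreover have "card B = (if e = 0 then 1 else if 2 * (i + 1) dvd e then 2 else 0)"
  proof (cases "2 * (i + 1) dvd e")
    case True
    then obtain k where k: "e = 2 * (i + 1) * k" by (rule dvdE)
    define I where "I = i + 1"
    have "I > 0" by (simp add: I_def)
    then have "B = {(0, k), (k, 0)}"
      unfolding B_def quad_set_def k I_def [symmetric] by (auto simp: mult.assoc)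
    then show ?thesis using True k by (cases "k = 0") auto
  next
    case False
    then have "e \<noteq> 0" by (metis dvd_0_right)
    define I where "I = i + 1"
    have "2 * I dvd 2 * (I * (u + c) + u * c)" if "u = 0 \<or> c = 0" for u c :: nat
      using that by auto
    then have "B = {}"
      using False unfolding B_def quad_set_def I_def [symmetric] by blast
    then show ?thesis using False \<open>e \<noteq> 0\<close> by simp
  qed
  ultimately show ?thesis unfolding card by simp
qed

lemma quad_fps_rec:
  "(1 - qq ^ (i + 1)) * (quad_fps i - qq ^ (2 * i + 3) * quad_fps (i + 1)) = 1 + qq ^ (i + 1)"
proof (rule fps_ext)
  fix e
  define d where "d = quad_fps i - qq ^ (2 * i + 3) * quad_fps (i + 1)"
  have d: "fps_nth d e = (if e = 0 then 1 else if 2 * (i + 1) dvd e then 2 else 0)" for e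
    unfolding d_def using card_quad_set [of i e] by (simp add: quad_fps_def)
  have one: "fps_nth (qq ^ (i + 1)) e = (if e = 2 * (i + 1) then 1 else 0)" for e
    unfolding qq_def power_mult [symmetric] by (rule fps_X_power_nth)
  show "fps_nth ((1 - qq ^ (i + 1)) * (quad_fps i - qq ^ (2 * i + 3) * quad_fps (i + 1))) e =
      fps_nth (1 + qq ^ (i + 1)) e"
    unfolding d_def [symmetric] left_diff_distrib fps_sub_nth fps_add_nth qq_power_mult_nth one mult_1 d
    by (auto simp: dvd_minus_self dest: dvd_imp_le simp del: mult_Suc_right)
qed

text \<open>The difference of the two sides for \<open>i\<close> is \<open>qq ^ (2 * i + 3)\<close>
  times the difference for \<open>i + 1\<close>. Iterating this makes its order arbitrarily
  large.\<close>

lemma rr_eq_quad_fps: "rr i = quad_fps i"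
proof -
  have rec: "rr i - quad_fps i = qq ^ (2 * i + 3) * (rr (i + 1) - quad_fps (i + 1))" for i
  proof -
    have "(1 - qq ^ (i + 1)) * (rr i - qq ^ (2 * i + 3) * rr (i + 1)) =
        (1 - qq ^ (i + 1)) * (quad_fps i - qq ^ (2 * i + 3) * quad_fps (i + 1))"
      unfolding rr_rec quad_fps_rec ..
    moreover have "1 - qq ^ (i + 1) \<noteq> 0"
    proof
      assume "1 - qq ^ (i + 1) = 0"
      then have "fps_nth (1 - qq ^ (i + 1)) 0 = 0" by simp
      then show False by simp
    qed
    ultimately have "rr i - qq ^ (2 * i + 3) * rr (i + 1) = quad_fps i - qq ^ (2 * i + 3) * quad_fps (i + 1)"
      by (simp only: mult_cancel_left) simp
    then show ?thesis by (simp add: algebra_simps)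
  qed
  have "\<forall>i. \<forall>j<n. fps_nth (rr i - quad_fps i) j = 0" for n
  proof (induction n)
    case (Suc n)
    show ?case
    proof (intro allI impI)
      fix i j assume "j < Suc n"
      then have "j < 2 * (2 * i + 3) \<or> j - 2 * (2 * i + 3) < n" by auto
      then show "fps_nth (rr i - quad_fps i) j = 0"
        unfolding rec [of i] qq_power_mult_nth using Suc by auto
    qed
  qed simp
  then have "fps_nth (rr i - quad_fps i) j = 0" for j
    by blast
  then show ?thesis by (simp add: fps_eq_iff)
qed

section \<open>Coefficients as numbers of reduced forms\<close>

text \<open>The passage from the topological sum to the coefficientwise \<open>fsum\<close>:
  coefficient \<open>i\<close> of the partial sums is constant as soon as
  \<open>N > i\<close>.\<close>

lemma mock_A_eq_fine: "mock_A = fps_X * fine (- 1) fps_X"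
proof -
  have small: "fps_small (fine_term (- 1) fps_X)"
    by (rule fps_small_fine_term) simp
  have small': "fps_small (\<lambda>n. fps_X * fine_term (- 1) fps_X n)"
    by (rule fps_small_mult [OF small])
  have "mock_A_term n = fps_X * fine_term (- 1) fps_X n" for n
    unfolding mock_A_term_def fine_term_def fps_recip_def qq_def by (simp add: mult_ac)
  then have trm: "mock_A_term = (\<lambda>n. fps_X * fine_term (- 1) fps_X n)"
    by blast
  have "mock_A_term sums fsum mock_A_term"
    unfolding sums_def
  proof (rule tendsto_fpsI)
    fix i
    have "fps_nth (\<Sum>n<N. mock_A_term n) i = fps_nth (fsum mock_A_term) i" if "N > i" for N
      using fsum_nth [OF small', of i "N - 1"] that
      unfolding trm fps_sum_nth by (cases N) (auto simp: lessThan_Suc_atMost)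
    then show "\<forall>\<^sub>F N in sequentially. fps_nth (\<Sum>n<N. mock_A_term n) i = fps_nth (fsum mock_A_term) i"
      by (rule eventually_mono [OF eventually_gt_at_top])
  qed
  then have "mock_A = fsum mock_A_term"
    unfolding mock_A_def by (rule sums_unique [symmetric])
  then show ?thesis
    unfolding trm fine_def fsum_cmult [OF small] .
qed

text \<open>For odd \<open>N\<close>, one half of the reduced forms of discriminant
  \<open>- N\<close>: then \<open>v\<close> is odd, and changing its sign gives the other
  half.\<close>

definition red_set :: "int \<Rightarrow> (int \<times> int \<times> int) set" where
  "red_set N = {(A, v, C). 0 < v \<and> v < 4 * A \<and> v < 4 * C \<and> 16 * A * C = N + v\<^sup>2}"

text \<open>Here \<open>v\<close> is odd, so it is \<open>4 * i + 3\<close> or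
  \<open>4 * i + 1\<close>, and being reduced means \<open>A = i + u + 1\<close>,
  \<open>C = i + c + 1\<close> with \<open>u\<close> and \<open>c\<close> nonnegative. Inserting
  this into the discriminant equation gives that of \<open>quad_set\<close>, with offset
  \<open>i + 1\<close> or \<open>3 * i + 2\<close>, the exponents in
  \<open>fine_expand\<close>.\<close>

lemma card_red_set:
  "card (red_set (8 * int m - 1)) =
     (\<Sum>i\<le>m. card {x. i + 1 \<le> m \<and> x \<in> quad_set i (m - (i + 1))} +
              card {x. 3 * i + 2 \<le> m \<and> x \<in> quad_set i (m - (3 * i + 2))})"
proof -
  define SA where "SA i = {x. i + 1 \<le> m \<and> x \<in> quad_set i (m - (i + 1))}" for i
  define SB where "SB i = {x. 3 * i + 2 \<le> m \<and> x \<in> quad_set i (m - (3 * i + 2))}" for i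
  define F where "F = (\<lambda>(i, u, c). (int (i + u + 1), int (4 * i + 3), int (i + c + 1)))"
  define G where "G = (\<lambda>(i, u, c). (int (i + u + 1), int (4 * i + 1), int (i + c + 1)))"
  have fin: "finite (SA i)" "finite (SB i)" for i
    by (auto simp: SA_def SB_def intro: finite_subset [OF _ finite_quad_set])
  have "red_set (8 * int m - 1) = F ` Sigma {..m} SA \<union> G ` Sigma {..m} SB"
  proof (intro subset_antisym subsetI)
    fix x assume "x \<in> F ` Sigma {..m} SA \<union> G ` Sigma {..m} SB"
    then show "x \<in> red_set (8 * int m - 1)"
    proof
      assume "x \<in> F ` Sigma {..m} SA"
      then obtain i u c where x: "x = F (i, u, c)" and le: "i + 1 \<le> m"
          and q: "2 * ((i + 1) * (u + c) + u * c) = m - (i + 1)"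
        by (auto simp: SA_def quad_set_def)
      have "m = i + 1 + 2 * ((i + 1) * (u + c) + u * c)"
        by (simp only: q le_add_diff_inverse [OF le])
      then have "int m = int (i + 1 + 2 * ((i + 1) * (u + c) + u * c))"
        by (simp only:)
      then show ?thesis
        by (simp add: x F_def red_set_def power2_eq_square algebra_simps)
    next
      assume "x \<in> G ` Sigma {..m} SB"
      then obtain i u c where x: "x = G (i, u, c)" and le: "3 * i + 2 \<le> m"
          and q: "2 * ((i + 1) * (u + c) + u * c) = m - (3 * i + 2)"
        by (auto simp: SB_def quad_set_def)
      have "m = 3 * i + 2 + 2 * ((i + 1) * (u + c) + u * c)"
        by (simp only: q le_add_diff_inverse [OF le])
      then have "int m = int (3 * i + 2 + 2 * ((i + 1) * (u + c) + u * c))"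
        by (simp only:)
      then show ?thesis
        by (simp add: x G_def red_set_def power2_eq_square algebra_simps)
    qed
  next
    fix x assume "x \<in> red_set (8 * int m - 1)"
    then obtain A v C where x: "x = (A, v, C)" and v: "0 < v" "v < 4 * A" "v < 4 * C"
        and eq: "16 * A * C = 8 * int m - 1 + v\<^sup>2"
      by (auto simp: red_set_def)
    have "odd v"
    proof
      assume "even v"
      then have "even (16 * A * C - 8 * int m - v\<^sup>2)" by simp
      then show False unfolding eq by simp
    qed
    then have "v mod 4 = 3 \<or> v mod 4 = 1" by presburger
    define i where "i = nat (v div 4)"
    define u where "u = nat (A - int i - 1)"
    define c where "c = nat (C - int i - 1)"
    have i: "int i = v div 4" using v by (simp add: i_def)
    have AC: "A = int (i + u + 1)" "C = int (i + c + 1)"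
      using v i by (auto simp: u_def c_def)
    from \<open>v mod 4 = 3 \<or> v mod 4 = 1\<close> show "x \<in> F ` Sigma {..m} SA \<union> G ` Sigma {..m} SB"
    proof
      assume "v mod 4 = 3"
      then have v: "v = int (4 * i + 3)" using i by presburger
      have "int m = int (i + 1 + 2 * ((i + 1) * (u + c) + u * c))"
        using eq unfolding AC v by (simp add: power2_eq_square algebra_simps)
      then have "m = i + 1 + 2 * ((i + 1) * (u + c) + u * c)" by (rule of_nat_eq_iff [THEN iffD1])
      then have "(i, u, c) \<in> Sigma {..m} SA"
        by (simp add: SA_def quad_set_def)
      moreover have "x = F (i, u, c)"
        by (simp add: x F_def AC v)
      ultimately show ?thesis by blast
    next
      assume "v mod 4 = 1"
      then have v: "v = int (4 * i + 1)" using i by presburger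
      have "int m = int (3 * i + 2 + 2 * ((i + 1) * (u + c) + u * c))"
        using eq unfolding AC v by (simp add: power2_eq_square algebra_simps)
      then have "m = 3 * i + 2 + 2 * ((i + 1) * (u + c) + u * c)" by (rule of_nat_eq_iff [THEN iffD1])
      then have "(i, u, c) \<in> Sigma {..m} SB"
        by (simp add: SB_def quad_set_def)
      moreover have "x = G (i, u, c)"
        by (simp add: x G_def AC v)
      ultimately show ?thesis by blast
    qed
  qed
  moreover have "F ` Sigma {..m} SA \<inter> G ` Sigma {..m} SB = {}"
    by (auto simp: F_def G_def) presburger
  moreover have "inj_on F (Sigma {..m} SA)" "inj_on G (Sigma {..m} SB)"
    by (auto simp: F_def G_def inj_on_def)
  ultimately have "card (red_set (8 * int m - 1)) = card (Sigma {..m} SA) + card (Sigma {..m} SB)"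
    by (simp add: card_Un_disjoint card_image fin)
  then show ?thesis
    unfolding SA_def [symmetric] SB_def [symmetric] by (simp add: fin sum.distrib)
qed

text \<open>\<open>fine_cong_mod_4\<close> with \<open>k = 0\<close> replaces the parameters
  \<open>(-1, q)\<close> by \<open>(1, -q)\<close>, and \<open>fine_expand\<close> applies with
  \<open>y = -q\<close>. The leading minus sign arises because the prefactor \<open>q\<close> is
  \<open>- y\<close>.\<close>

theorem N_A_cong_card_red_set: "[fps_nth mock_A m = - ((- 1) ^ m) * int (card (red_set (8 * int m - 1)))] (mod 4)"
proof -
  define y :: "int fps" where "y = - fps_X"
  have y: "y\<^sup>2 = qq" "fps_nth y 0 = 0"
    by (simp_all add: y_def qq_def)
  \<comment> \<open>Only even exponents occur in \<open>quad_fps i\<close>, so a nonzero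
    contribution needs \<open>k\<close> of the same parity as \<open>m\<close>, and all signs
    agree.\<close>
  have coeff: "fps_nth (y ^ k * quad_fps i) m =
      (- 1) ^ m * int (card {x. k \<le> m \<and> x \<in> quad_set i (m - k)})" for k i
  proof -
    have "y ^ k = fps_const ((- 1) ^ k) * fps_X ^ k"
      unfolding y_def by (simp add: power_minus [of fps_X] fps_const_power [symmetric] fps_const_neg [symmetric] del: fps_const_neg fps_const_power)
    then have 1: "fps_nth (y ^ k * quad_fps i) m = (- 1) ^ k * (if m < k then 0 else int (card (quad_set i (m - k))))"
      by (simp add: mult.assoc fps_X_power_mult_nth quad_fps_def)
    show ?thesis
    proof (cases "k \<le> m \<and> quad_set i (m - k) \<noteq> {}")
      case True
      then obtain u c where "2 * ((i + 1) * (u + c) + u * c) = m - k"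
        by (auto simp: quad_set_def)
      then have "even (m - k)" by (metis dvd_triv_left)
      then have "(- 1 :: int) ^ (m - k + k) = (- 1) ^ k"
        by (simp add: power_add)
      then have "(- 1 :: int) ^ m = (- 1) ^ k"
        using True by simp
      then show ?thesis using 1 True by simp
    qed (auto simp: 1)
  qed
  have "fps_nth (y * fine 1 y) m = (\<Sum>i\<le>m. fps_nth ((y ^ (i + 1) + y ^ (3 * i + 2)) * quad_fps i) m)"
    unfolding fine_expand [OF y] rr_eq_quad_fps by (simp add: fsum_def)
  also have "\<dots> = (- 1) ^ m * int (card (red_set (8 * int m - 1)))"
    unfolding card_red_set by (simp only: distrib_right fps_add_nth coeff of_nat_sum of_nat_add sum_distrib_left distrib_left)
  finally have yf: "fps_nth (y * fine 1 y) m = (- 1) ^ m * int (card (red_set (8 * int m - 1)))" .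
  have "fps_dvd_upto 4 (Suc m) (fps_X * (fine (- 1) fps_X - fine 1 y))"
    using fine_cong_mod_4 [of "Suc m" 0] by (intro fps_dvd_upto_mult) (simp add: y_def)
  moreover have "fps_X * (fine (- 1) fps_X - fine 1 y) = mock_A + y * fine 1 y"
    by (simp add: mock_A_eq_fine y_def algebra_simps)
  ultimately have "4 dvd fps_nth mock_A m + fps_nth (y * fine 1 y) m"
    by (simp add: fps_dvd_upto_def)
  then show ?thesis
    unfolding yf by (simp add: cong_iff_dvd_diff)
qed

section \<open>Binary quadratic forms of level 4\<close>

text \<open>
  The triple \<open>(A, v, C)\<close> stands for the form \<open>Ax\<^sup>2 + vxy + 4Cy\<^sup>2\<close> under \<open>\<Gamma>\<^sub>0(4)\<close>, or equivalently for
  \<open>2Ax\<^sup>2 + vxy + 2Cy\<^sup>2\<close> under \<open>\<Gamma>(2)\<close>; the matrix with rows \<open>(a, 4b)\<close> and \<open>(c, d)\<close> acts.  The sign of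
  \<open>form_disc\<close> is chosen such that it is positive on definite forms.
\<close>

fun form_act :: "int \<Rightarrow> int \<Rightarrow> int \<Rightarrow> int \<Rightarrow> int \<times> int \<times> int \<Rightarrow> int \<times> int \<times> int" where
  "form_act a b c d (A, v, C) =
     (A * a\<^sup>2 + v * a * c + 4 * C * c\<^sup>2, 8 * A * a * b + v * (a * d + 4 * b * c) + 8 * C * c * d,
      4 * A * b\<^sup>2 + v * b * d + C * d\<^sup>2)"

fun form_val :: "int \<times> int \<times> int \<Rightarrow> int \<Rightarrow> int \<Rightarrow> int" where
  "form_val (A, v, C) x y = A * x\<^sup>2 + v * x * y + 4 * C * y\<^sup>2"

fun form_disc :: "int \<times> int \<times> int \<Rightarrow> int" where
  "form_disc (A, v, C) = 16 * A * C - v\<^sup>2"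

definition form_equiv :: "int \<times> int \<times> int \<Rightarrow> int \<times> int \<times> int \<Rightarrow> bool" where
  "form_equiv f g \<longleftrightarrow> (\<exists>a b c d. a * d - 4 * b * c = 1 \<and> g = form_act a b c d f)"

lemma form_act_act: "form_act a' b' c' d' (form_act a b c d f) =
    form_act (a * a' + 4 * b * c') (a * b' + b * d') (c * a' + d * c') (4 * c * b' + d * d') f"
  by (cases f) (simp add: power2_eq_square, simp add: algebra_simps)

lemma form_val_act: "form_val (form_act a b c d f) x y = form_val f (a * x + 4 * b * y) (c * x + d * y)"
  by (cases f) (simp add: power2_eq_square, simp add: algebra_simps)

lemma form_disc_act: "form_disc (form_act a b c d f) = (a * d - 4 * b * c)\<^sup>2 * form_disc f"
  by (cases f) (simp add: power2_eq_square, simp add: algebra_simps)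

lemma form_act_id: "form_act 1 0 0 1 f = f"
  by (cases f) simp

lemma form_equiv_refl: "form_equiv f f"
  unfolding form_equiv_def by (rule exI [of _ 1], rule exI [of _ 0], rule exI [of _ 0], rule exI [of _ 1]) (simp add: form_act_id)

lemma form_equiv_trans:
  assumes "form_equiv f g" "form_equiv g h"
  shows "form_equiv f h"
proof -
  obtain a b c d where 1: "a * d - 4 * b * c = 1" "g = form_act a b c d f"
    using assms(1) by (auto simp: form_equiv_def)
  obtain a' b' c' d' where 2: "a' * d' - 4 * b' * c' = 1" "h = form_act a' b' c' d' g"
    using assms(2) by (auto simp: form_equiv_def)
  have "(a * a' + 4 * b * c') * (4 * c * b' + d * d') - 4 * (a * b' + b * d') * (c * a' + d * c') =
      (a * d - 4 * b * c) * (a' * d' - 4 * b' * c')"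
    by (simp add: algebra_simps)
  then have "(a * a' + 4 * b * c') * (4 * c * b' + d * d') - 4 * (a * b' + b * d') * (c * a' + d * c') = 1"
    by (simp add: 1 2)
  moreover have "h = form_act (a * a' + 4 * b * c') (a * b' + b * d') (c * a' + d * c') (4 * c * b' + d * d') f"
    by (simp only: 1(2) 2(2) form_act_act)
  ultimately show ?thesis unfolding form_equiv_def by blast
qed

lemma form_equiv_sym:
  assumes "form_equiv f g"
  shows "form_equiv g f"
proof -
  obtain a b c d where 1: "a * d - 4 * b * c = 1" "g = form_act a b c d f"
    using assms(1) by (auto simp: form_equiv_def)
  have "form_act d (- b) (- c) a g = form_act (a * d - 4 * b * c) 0 0 (a * d - 4 * b * c) f"
    unfolding 1(2) form_act_act by (simp add: algebra_simps)
  then have "f = form_act d (- b) (- c) a g"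
    by (simp only: 1(1) form_act_id)
  moreover have "d * a - 4 * (- b) * (- c) = 1"
    using 1(1) by (simp add: algebra_simps)
  ultimately show ?thesis unfolding form_equiv_def by blast
qed

lemma form_equiv_disc: "form_equiv f g \<Longrightarrow> form_disc g = form_disc f"
  by (auto simp: form_equiv_def form_disc_act)

section \<open>Positive definite forms and their reduction\<close>

fun form_pos :: "int \<times> int \<times> int \<Rightarrow> bool" where
  "form_pos (A, v, C) \<longleftrightarrow> A > 0 \<and> C > 0"

lemma form_val_pos:
  assumes "form_pos f" "form_disc f > 0" "x \<noteq> 0 \<or> y \<noteq> 0"
  shows "form_val f x y > 0"
proof -
  obtain A v C where f: "f = (A, v, C)" by (cases f)
  have "4 * A * form_val f x y = (2 * A * x + v * y)\<^sup>2 + form_disc f * y\<^sup>2"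
    by (simp add: f power2_eq_square algebra_simps)
  moreover have "(2 * A * x + v * y)\<^sup>2 + form_disc f * y\<^sup>2 > 0"
  proof (cases "y = 0")
    case True
    with assms show ?thesis by (simp add: f)
  next
    case False
    then show ?thesis using assms(2) by (intro add_nonneg_pos mult_pos_pos) auto
  qed
  ultimately have "4 * A * form_val f x y > 0" by simp
  then show ?thesis using assms(1) by (simp add: f zero_less_mult_iff)
qed

lemma form_equiv_pos:
  assumes "form_equiv f g" "form_pos f" "form_disc f > 0"
  shows "form_pos g"
proof -
  obtain a b c d where 1: "a * d - 4 * b * c = 1" "g = form_act a b c d f"
    using assms(1) by (auto simp: form_equiv_def)
  obtain A v C where g: "g = (A, v, C)" by (cases g)
  have "form_val g 1 0 > 0" "form_val g 0 1 > 0"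
    unfolding 1(2) form_val_act using 1(1) by (auto intro!: form_val_pos assms)
  then show ?thesis by (simp add: g)
qed

text \<open>Strict inequalities are enough because odd \<open>v\<close> never attains a bound. No
  order between \<open>A\<close> and \<open>C\<close> is imposed, since exchanging them in general
  leads to another class.\<close>

fun form_reduced :: "int \<times> int \<times> int \<Rightarrow> bool" where
  "form_reduced (A, v, C) \<longleftrightarrow> \<bar>v\<bar> < 4 * A \<and> \<bar>v\<bar> < 4 * C"

lemma form_reduced_pos: "form_reduced f \<Longrightarrow> form_pos f"
  by (cases f) auto

lemma odd_middle:
  assumes "odd (form_disc (A, v, C))"
  shows "odd v"
  using assms by auto

text \<open>Descent on \<open>\<bar>v\<bar>\<close>: the two unipotent generators change
  \<open>v\<close> by \<open>8 * A\<close> or \<open>8 * C\<close>, which shrinks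
  \<open>\<bar>v\<bar>\<close> once it exceeds \<open>4 * A\<close> or \<open>4 * C\<close>.
  Equality is excluded by parity.\<close>

lemma form_equiv_reduced_exists:
  assumes "form_pos f" "form_disc f > 0" "odd (form_disc f)"
  shows "\<exists>g. form_equiv f g \<and> form_reduced g"
  using assms
proof (induction "nat \<bar>fst (snd f)\<bar>" arbitrary: f rule: less_induct)
  case less
  obtain A v C where f: "f = (A, v, C)" by (cases f)
  have v: "odd v" using less.prems(3) unfolding f by (rule odd_middle)
  have pos: "A > 0" "C > 0" using less.prems(1) by (auto simp: f)
  have step: ?case if g: "form_equiv f g" "\<bar>fst (snd g)\<bar> < \<bar>v\<bar>" for g
  proof -
    have "\<exists>h. form_equiv g h \<and> form_reduced h"
      using g less.prems by (intro less.hyps) (auto simp: f form_equiv_disc intro: form_equiv_pos)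
    then show ?thesis using form_equiv_trans [OF g(1)] by blast
  qed
  show ?case
  proof (cases "form_reduced f")
    case True
    then show ?thesis using form_equiv_refl by blast
  next
    case False
    then consider "\<bar>v\<bar> \<ge> 4 * A" | "\<bar>v\<bar> \<ge> 4 * C" by (auto simp: f)
    then show ?thesis
    proof cases
      case 1
      have "\<bar>v - sgn v * 8 * A\<bar> < \<bar>v\<bar>"
      proof -
        have "\<bar>v\<bar> \<noteq> 4 * A" using v by (metis dvd_abs_iff even_mult_iff even_numeral)
        then show ?thesis using 1 pos by (auto simp: sgn_if abs_if split: if_splits)
      qed
      moreover have "form_equiv f (form_act 1 (- sgn v) 0 1 f)"
        unfolding form_equiv_def by force
      ultimately show ?thesis
        by (intro step [of "form_act 1 (- sgn v) 0 1 f"]) (simp_all add: f algebra_simps)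
    next
      case 2
      have "\<bar>v - sgn v * 8 * C\<bar> < \<bar>v\<bar>"
      proof -
        have "\<bar>v\<bar> \<noteq> 4 * C" using v by (metis dvd_abs_iff even_mult_iff even_numeral)
        then show ?thesis using 2 pos by (auto simp: sgn_if abs_if split: if_splits)
      qed
      moreover have "form_equiv f (form_act 1 0 (- sgn v) 1 f)"
        unfolding form_equiv_def by force
      ultimately show ?thesis
        by (intro step [of "form_act 1 0 (- sgn v) 1 f"]) (simp_all add: f algebra_simps)
    qed
  qed
qed

text \<open>
  For even \<open>y\<close> the value below is \<open>(2Ax\<^sup>2 + vxy + 2Cy\<^sup>2) / 2\<close>.  So \<open>A\<close>, and likewise \<open>C\<close>, is a minimum over a
  residue class modulo 2 which \<open>\<Gamma>(2)\<close> preserves.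
\<close>

lemma form_reduced_min:
  assumes "form_reduced (A, v, C)" "odd x" "even y"
  shows "A \<le> A * x\<^sup>2 + v * x * (y div 2) + C * y\<^sup>2"
proof -
  \<comment> \<open>Being reduced bounds the middle term by \<open>2 * m * X * Y\<close>. What
    remains is \<open>m * (X - Y)\<^sup>2\<close> plus the excess of the larger outer coefficient,
    and \<open>X\<close> differs from \<open>Y\<close> by parity.\<close>
  define m where "m = min A C"
  define X Y where "X = \<bar>x\<bar>" and "Y = \<bar>y\<bar>"
  have m: "\<bar>v\<bar> \<le> 4 * m" "m \<le> A" "m \<le> C" "m \<ge> 0" using assms(1) by (auto simp: m_def)
  have "x \<noteq> 0" using assms(2) by auto
  moreover have "odd X" "even Y" using assms(2,3) by (simp_all add: X_def Y_def)
  then have "X \<noteq> Y" by blast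
  ultimately have XY: "X \<noteq> Y" "X \<ge> 1" "Y \<ge> 0" by (simp_all add: X_def Y_def)
  have y2: "\<bar>y div 2\<bar> * 2 = Y" using assms(3) by (auto simp: Y_def abs_mult elim!: evenE)
  have "\<bar>v * x * (y div 2)\<bar> = \<bar>v\<bar> * (X * \<bar>y div 2\<bar>)"
    by (simp add: abs_mult X_def)
  also have "\<dots> \<le> (4 * m) * (X * \<bar>y div 2\<bar>)"
    using m XY by (intro mult_right_mono) auto
  also have "\<dots> = 2 * m * X * Y" unfolding y2 [symmetric] by simp
  finally have 1: "\<bar>v * x * (y div 2)\<bar> \<le> 2 * m * X * Y" .
  have sq: "x\<^sup>2 = X\<^sup>2" "y\<^sup>2 = Y\<^sup>2" by (simp_all add: X_def Y_def)
  have "0 < (X - Y)\<^sup>2"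
    using XY(1) by simp
  then have "1 \<le> (X - Y)\<^sup>2"
    by linarith
  then have 2: "m * (X - Y)\<^sup>2 \<ge> m" using m(4) mult_left_mono [of 1 "(X - Y)\<^sup>2" m] by simp
  have "A * X\<^sup>2 - 2 * m * X * Y + C * Y\<^sup>2 \<ge> A"
  proof (cases "A \<le> C")
    case True
    then have mA: "m = A" by (simp add: m_def)
    have "A * X\<^sup>2 - 2 * m * X * Y + C * Y\<^sup>2 = m * (X - Y)\<^sup>2 + (C - A) * Y\<^sup>2"
      by (simp add: mA power2_eq_square algebra_simps)
    moreover have "0 \<le> (C - A) * Y\<^sup>2" using True by simp
    ultimately show ?thesis using 2 unfolding mA by linarith
  next
    case False
    then have mC: "m = C" by (simp add: m_def)
    have "A * X\<^sup>2 - 2 * m * X * Y + C * Y\<^sup>2 = m * (X - Y)\<^sup>2 + (A - C) * X\<^sup>2"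
      by (simp add: mC power2_eq_square algebra_simps)
    moreover have "A - C \<le> (A - C) * X\<^sup>2"
      using mult_left_mono [of 1 "X\<^sup>2" "A - C"] False XY(2) by (simp add: one_le_power)
    moreover have "C \<le> m * (X - Y)\<^sup>2" using 2 by (simp add: mC)
    ultimately show ?thesis by linarith
  qed
  then show ?thesis using 1 unfolding sq by linarith
qed

lemma form_equiv_reduced_le:
  assumes "form_equiv (A, v, C) (A', v', C')" "form_reduced (A, v, C)"
  shows "A \<le> A'" "C \<le> C'"
proof -
  obtain a b c d where 1: "a * d - 4 * b * c = 1" and 2: "(A', v', C') = form_act a b c d (A, v, C)"
    using assms(1) by (auto simp: form_equiv_def)
  have odd: "odd a" "odd d"
  proof -
    have "a * d = 1 + 2 * (2 * (b * c))" using 1 by simp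
    then have "odd (a * d)" by simp
    then show "odd a" "odd d" by auto
  qed
  have "A \<le> A * a\<^sup>2 + v * a * ((2 * c) div 2) + C * (2 * c)\<^sup>2"
    by (rule form_reduced_min) (use assms odd in auto)
  then show "A \<le> A'" using 2 by (simp add: power_mult_distrib)
  have "C \<le> C * d\<^sup>2 + v * d * ((2 * b) div 2) + A * (2 * b)\<^sup>2"
    by (rule form_reduced_min) (use assms odd in auto)
  then show "C \<le> C'" using 2 by (simp add: power_mult_distrib algebra_simps)
qed

text \<open>Minimality in both directions fixes the outer coefficients, so the discriminant leaves
  \<open>v' = v\<close> or \<open>v' = - v\<close>. The action preserves \<open>v\<close> modulo 8,
  which excludes \<open>- v\<close> for odd \<open>v\<close>.\<close>

lemma form_equiv_reduced_unique:
  assumes "form_equiv f g" "form_reduced f" "form_reduced g" "odd (form_disc f)"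
  shows "f = g"
proof -
  obtain A v C where f: "f = (A, v, C)" by (cases f)
  obtain A' v' C' where g: "g = (A', v', C')" by (cases g)
  have A: "A = A'" "C = C'"
    using form_equiv_reduced_le [of A v C A' v' C'] form_equiv_reduced_le [of A' v' C' A v C] assms(1,2,3) form_equiv_sym [OF assms(1)]
    unfolding f g by (auto intro: order_antisym)
  have "form_disc g = form_disc f" by (rule form_equiv_disc [OF assms(1)])
  then have "v'\<^sup>2 = v\<^sup>2" unfolding f g A by simp
  then have "v' = v \<or> v' = - v" by (simp add: power2_eq_iff)
  moreover have "v' \<noteq> - v"
  proof
    assume neg: "v' = - v"
    obtain a b c d where 1: "a * d - 4 * b * c = 1" and 2: "g = form_act a b c d f"
      using assms(1) by (auto simp: form_equiv_def)
    have "v' = 8 * A * a * b + v * (a * d + 4 * b * c) + 8 * C * c * d"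
      using 2 by (simp add: f g)
    also have "a * d + 4 * b * c = 1 + 8 * b * c" using 1 by simp
    finally have "2 * v = - 8 * (A * a * b + v * b * c + C * c * d)"
      unfolding neg by (simp add: algebra_simps)
    then have "even v" by presburger
    moreover have "odd v" using assms(4) unfolding f by (rule odd_middle)
    ultimately show False by simp
  qed
  ultimately show ?thesis by (simp add: f g A)
qed

section \<open>The genus character at a ramified prime\<close>

lemma Legendre_cong_mod: "[a = b] (mod p) \<Longrightarrow> Legendre a p = Legendre b p"
proof -
  assume ab: "[a = b] (mod p)"
  have "[a = 0] (mod p) \<longleftrightarrow> [b = 0] (mod p)"
    using ab by (metis cong_sym cong_trans)
  moreover have "QuadRes p a \<longleftrightarrow> QuadRes p b"
    unfolding QuadRes_def using ab by (metis cong_sym cong_trans)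
  ultimately show ?thesis unfolding Legendre_def by simp
qed

lemma Legendre_eq_0_iff: "Legendre a p = 0 \<longleftrightarrow> p dvd a"
  by (simp add: Legendre_def cong_0_iff)

lemma Legendre_values: "Legendre a p \<in> {-1, 0, 1}"
  by (simp add: Legendre_def)

lemma Legendre_square:
  assumes "\<not> p dvd a"  "prime p"
  shows "Legendre (a\<^sup>2) p = 1"
proof -
  have "\<not> p dvd a\<^sup>2" using assms by (simp add: prime_dvd_power_iff)
  moreover have "QuadRes p (a\<^sup>2)" unfolding QuadRes_def by (rule exI [of _ a]) simp
  ultimately show ?thesis by (simp add: Legendre_def cong_0_iff)
qed

text \<open>Euler's criterion gives the equation modulo \<open>p\<close>, and the two sides differ
  by at most 2, which is less than \<open>p\<close>.\<close>

lemma Legendre_mult: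
  assumes "prime (p :: int)" "odd p"
  shows "Legendre (a * b) p = Legendre a p * Legendre b p"
proof -
  have "p > 2" using assms prime_ge_2_int [of p] by (cases "p = 2") auto
  define P where "P = nat p"
  have P: "prime P" "2 < P" "int P = p"
    using assms \<open>p > 2\<close> by (auto simp: P_def prime_nat_iff_prime)
  let ?e = "(P - 1) div 2"
  have e: "[Legendre x p = x ^ ?e] (mod p)" for x
    using euler_criterion [OF P(1,2), of x] by (simp add: P(3))
  have "[Legendre (a * b) p = (a * b) ^ ?e] (mod p)" by (rule e)
  also have "(a * b) ^ ?e = a ^ ?e * b ^ ?e" by (rule power_mult_distrib)
  also have "[\<dots> = Legendre a p * Legendre b p] (mod p)"
    by (intro cong_mult cong_sym [OF e])
  finally have "p dvd Legendre (a * b) p - Legendre a p * Legendre b p"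
    by (simp add: cong_iff_dvd_diff)
  moreover have "\<bar>Legendre (a * b) p - Legendre a p * Legendre b p\<bar> \<le> 2"
    using Legendre_values [of "a * b" p] Legendre_values [of a p] Legendre_values [of b p] by auto
  ultimately show ?thesis
    using \<open>p > 2\<close> zdvd_not_zless [of "\<bar>Legendre (a * b) p - Legendre a p * Legendre b p\<bar>" p] by auto
qed

lemma odd_prime_not_dvd_2:
  assumes "prime (p :: int)" "odd p"
  shows "\<not> p dvd 2"
proof
  assume "p dvd 2"
  then have "p \<le> 2" by (rule zdvd_imp_le) simp
  with assms prime_ge_2_int [of p] show False by (cases "p = 2") auto
qed

text \<open>The genus character at \<open>p\<close> as a predicate. When \<open>p\<close> divides
  the discriminant, all values prime to \<open>p\<close> have the same symbol by
  \<open>Legendre_form_val\<close>, so one value decides.\<close>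

definition form_genus :: "int \<Rightarrow> int \<times> int \<times> int \<Rightarrow> bool" where
  "form_genus p f \<longleftrightarrow> (\<exists>x y. Legendre (form_val f x y) p = 1)"

text \<open>The identity behind genus theory: modulo a divisor of the discriminant, four times the
  product of two values is a square.\<close>

lemma form_val_mult:
  "4 * (form_val f x y * form_val f z w) =
     (2 * fst f * x * z + fst (snd f) * (x * w + z * y) + 8 * snd (snd f) * y * w)\<^sup>2 + form_disc f * (x * w - z * y)\<^sup>2"
  by (cases f) (simp add: power2_eq_square, simp add: algebra_simps)

lemma Legendre_form_val:
  assumes p: "prime p" "odd p" and "p dvd form_disc f"
    and n: "\<not> p dvd form_val f x y" "\<not> p dvd form_val f z w"
  shows "Legendre (form_val f x y) p = Legendre (form_val f z w) p"
proof -
  let ?s = "2 * fst f * x * z + fst (snd f) * (x * w + z * y) + 8 * snd (snd f) * y * w"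
  have "\<not> p dvd 4"
  proof
    assume "p dvd 4"
    then have "p dvd 2 ^ 2" by simp
    then have "p dvd 2" using p(1) prime_dvd_power by blast
    then show False using odd_prime_not_dvd_2 [OF p] by simp
  qed
  then have nd: "\<not> p dvd 4 * (form_val f x y * form_val f z w)"
    using n p(1) by (simp add: prime_dvd_mult_iff)
  have "[4 * (form_val f x y * form_val f z w) = ?s\<^sup>2] (mod p)"
    unfolding form_val_mult using assms(3) by (simp add: cong_iff_dvd_diff)
  then have "Legendre (4 * (form_val f x y * form_val f z w)) p = Legendre (?s\<^sup>2) p" and "\<not> p dvd ?s\<^sup>2"
    using nd by (auto intro: Legendre_cong_mod simp: cong_dvd_iff)
  moreover from this(2) have "\<not> p dvd ?s"
    by (metis dvd_mult power2_eq_square)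
  ultimately have "Legendre (4 * (form_val f x y * form_val f z w)) p = 1"
    using Legendre_square [of p ?s, OF _ p(1)] by presburger
  moreover have "Legendre (2\<^sup>2) p = 1"
    by (rule Legendre_square [OF odd_prime_not_dvd_2 [OF p] p(1)])
  then have "Legendre 4 p = 1" by simp
  ultimately have "Legendre (form_val f x y) p * Legendre (form_val f z w) p = 1"
    by (simp add: Legendre_mult [OF p])
  then show ?thesis
    using Legendre_values [of "form_val f x y" p] Legendre_values [of "form_val f z w" p] by auto
qed

lemma form_genus_iff:
  assumes "prime p" "odd p" "p dvd form_disc f" "\<not> p dvd form_val f x y"
  shows "form_genus p f \<longleftrightarrow> Legendre (form_val f x y) p = 1"
proof
  assume "form_genus p f"
  then obtain z w where zw: "Legendre (form_val f z w) p = 1" by (auto simp: form_genus_def)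
  then have "\<not> p dvd form_val f z w" using Legendre_eq_0_iff [of "form_val f z w" p] by simp
  from Legendre_form_val [OF assms this] zw show "Legendre (form_val f x y) p = 1" by simp
qed (auto simp: form_genus_def)

lemma form_equiv_genus:
  assumes "form_equiv f g"
  shows "form_genus p f \<longleftrightarrow> form_genus p g"
proof -
  have "form_genus p f" if "form_equiv f g" "form_genus p g" for f g
  proof -
    obtain a b c d where "g = form_act a b c d f" using \<open>form_equiv f g\<close> by (auto simp: form_equiv_def)
    with \<open>form_genus p g\<close> show ?thesis by (auto simp: form_genus_def form_val_act)
  qed
  then show ?thesis using assms form_equiv_sym by blast
qed

text \<open>If \<open>l\<close> does not divide \<open>C\<close>, a translation moves
  \<open>v\<close> to the root \<open>\<rho>\<close> modulo \<open>l\<close>, and the discriminant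
  then forces \<open>l\<close> to divide the first coefficient. Otherwise one of the translations
  \<open>s = 1\<close>, \<open>s = - 1\<close> in the other variable makes the last coefficient
  prime to \<open>l\<close>, as \<open>l\<close> does not divide \<open>2 * v\<close>.\<close>

lemma form_equiv_root_exists:
  assumes l: "prime l" "odd l" "\<not> l dvd form_disc f" "l dvd \<rho>\<^sup>2 + form_disc f"
  shows "\<exists>A v C. form_equiv f (l * A, v, C) \<and> l dvd v - \<rho>"
proof -
  have l8: "coprime (8 :: int) l"
    using l(2) coprime_power_left_iff [of 2 3 l] by simp
  have main: "\<exists>A v C. form_equiv f (l * A, v, C) \<and> l dvd v - \<rho>" if f: "form_equiv f (A, v, C)" and C: "\<not> l dvd C" for A v C
  proof -
    have "coprime (8 * C) l"
      using l8 C prime_imp_coprime [OF l(1), of C] by (simp add: coprime_commute)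
    then obtain t where "[8 * C * t = \<rho> - v] (mod l)"
      using cong_solve_coprime_int [of "8 * C" l] by (metis cong_scalar_right mult.assoc mult_1)
    then have t: "l dvd (v + 8 * C * t) - \<rho>"
      by (simp add: cong_iff_dvd_diff algebra_simps)
    define A' v' where "A' = A + v * t + 4 * C * t\<^sup>2" and "v' = v + 8 * C * t"
    have g: "form_equiv f (A', v', C)"
    proof (rule form_equiv_trans [OF f])
      show "form_equiv (A, v, C) (A', v', C)"
        unfolding form_equiv_def
        by (rule exI [of _ 1], rule exI [of _ 0], rule exI [of _ t], rule exI [of _ 1])
           (simp add: A'_def v'_def)
    qed
    have "16 * A' * C = form_disc f + v'\<^sup>2"
      using form_equiv_disc [OF g] by simp
    moreover have "l dvd form_disc f + v'\<^sup>2"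
    proof -
      have "form_disc f + v'\<^sup>2 = (\<rho>\<^sup>2 + form_disc f) + (v' - \<rho>) * (v' + \<rho>)"
        by (simp add: power2_eq_square algebra_simps)
      then show ?thesis using t l(4) by (simp only: v'_def dvd_add dvd_mult2)
    qed
    ultimately have "l dvd 8 * (2 * (A' * C))" by (simp add: mult.assoc)
    then have "l dvd 2 * (A' * C)" using l8 by (metis coprime_commute coprime_dvd_mult_right_iff)
    moreover have "\<not> l dvd 2" by (rule odd_prime_not_dvd_2 [OF l(1,2)])
    ultimately have "l dvd A'" using C l(1) by (simp add: prime_dvd_mult_iff)
    then obtain A'' where "A' = l * A''" by (rule dvdE)
    with g t show ?thesis unfolding v'_def by blast
  qed
  obtain A v C where f: "f = (A, v, C)" by (cases f)
  show ?thesis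
  proof (cases "l dvd C")
    case False
    then show ?thesis using main [of A v C] form_equiv_refl by (simp add: f)
  next
    case True
    have nv: "\<not> l dvd v"
    proof
      assume "l dvd v"
      with True have "l dvd 16 * A * C - v\<^sup>2" by (simp add: power2_eq_square)
      with l(3) show False by (simp add: f)
    qed
    have 1: "form_equiv f (A, v + 8 * A * s, C + v * s + 4 * A * s\<^sup>2)" for s
      unfolding form_equiv_def f
      by (rule exI [of _ 1], rule exI [of _ s], rule exI [of _ 0], rule exI [of _ 1]) (simp add: algebra_simps)
    show ?thesis
    proof (cases "l dvd C + v * 1 + 4 * A * 1\<^sup>2")
      case False
      then show ?thesis by (rule main [OF 1])
    next
      case True': True
      have "\<not> l dvd C + v * (- 1) + 4 * A * (- 1)\<^sup>2"
      proof
        assume "l dvd C + v * (- 1) + 4 * A * (- 1)\<^sup>2"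
        with True' have "l dvd (C + v * 1 + 4 * A * 1\<^sup>2) - (C + v * (- 1) + 4 * A * (- 1)\<^sup>2)" by (rule dvd_diff)
        then have "l dvd 2 * v" by simp
        moreover have "\<not> l dvd 2" by (rule odd_prime_not_dvd_2 [OF l(1,2)])
        ultimately show False using nv l(1) by (simp add: prime_dvd_mult_iff)
      qed
      then show ?thesis by (rule main [OF 1])
    qed
  qed
qed

text \<open>
  Dividing the first coefficient by \<open>l\<close> and multiplying the last one by \<open>l\<close> is multiplication with a prime ideal
  above \<open>l\<close>.  It is well defined on classes if the middle coefficients are a fixed root modulo \<open>l\<close>.
\<close>

lemma form_equiv_scale:
  assumes l: "prime l" "odd l" "\<not> l dvd form_disc (l * A, v, C)"
    and v: "l dvd v - v'" and eq: "form_equiv (l * A, v, C) (l * A', v', C')"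
  shows "form_equiv (A, v, l * C) (A', v', l * C')"
proof -
  obtain a b c d where 1: "a * d - 4 * b * c = 1" and 2: "(l * A', v', C') = form_act a b c d (l * A, v, C)"
    using eq by (auto simp: form_equiv_def)
  have eqs: "l * A' = l * A * a\<^sup>2 + v * a * c + 4 * C * c\<^sup>2"
      "v' = 8 * (l * A) * a * b + v * (a * d + 4 * b * c) + 8 * C * c * d"
      "C' = 4 * (l * A) * b\<^sup>2 + v * b * d + C * d\<^sup>2"
    using 2 by simp_all
  have nv: "\<not> l dvd v"
  proof
    assume "l dvd v"
    then have "l dvd form_disc (l * A, v, C)" by (simp add: power2_eq_square mult.assoc mult.left_commute [of 16])
    with l(3) show False by simp
  qed
  \<comment> \<open>If \<open>l\<close> does not divide \<open>c\<close>, the first coefficients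
    force \<open>v'\<close> to be congruent to \<open>- v\<close> modulo \<open>l\<close>, against
    \<open>v'\<close> congruent to \<open>v\<close>. Once \<open>l\<close> divides \<open>c\<close>,
    the matrix can be conjugated by the diagonal matrix with entries \<open>l\<close> and 1.\<close>
  have "l dvd c"
  proof (rule ccontr)
    assume nc: "\<not> l dvd c"
    have "c * (v * a + 4 * C * c) = l * (A' - A * a\<^sup>2)"
      using eqs(1) by (simp add: power2_eq_square algebra_simps)
    then have "l dvd c * (v * a + 4 * C * c)" by simp
    then have z: "l dvd v * a + 4 * C * c" using nc l(1) by (simp add: prime_dvd_mult_iff)
    have "v' + v * (a * d - 4 * b * c) = l * (8 * A * a * b) + 2 * d * (v * a + 4 * C * c)"
      unfolding eqs(2) by (simp add: algebra_simps)
    then have "l dvd v' + v" using z unfolding 1 by simp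
    with v have "l dvd (v' + v) + (v - v')" by (rule dvd_add [rotated])
    then have "l dvd 2 * v" by simp
    moreover have "\<not> l dvd 2" by (rule odd_prime_not_dvd_2 [OF l(1,2)])
    ultimately show False using nv l(1) by (simp add: prime_dvd_mult_iff)
  qed
  then obtain c' where c: "c = l * c'" by (rule dvdE)
  have l0: "l \<noteq> 0" using l(1) by auto
  have "l * A' = l * (A * a\<^sup>2 + v * a * c' + 4 * (l * C) * c'\<^sup>2)"
    unfolding eqs(1) c by (simp add: power2_eq_square algebra_simps)
  then have "A' = A * a\<^sup>2 + v * a * c' + 4 * (l * C) * c'\<^sup>2" using l0 by simp
  moreover have "v' = 8 * A * a * (l * b) + v * (a * d + 4 * (l * b) * c') + 8 * (l * C) * c' * d"
    unfolding eqs(2) c by (simp add: algebra_simps)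
  moreover have "l * C' = 4 * A * (l * b)\<^sup>2 + v * (l * b) * d + (l * C) * d\<^sup>2"
    unfolding eqs(3) by (simp add: power2_eq_square algebra_simps)
  moreover have "a * d - 4 * (l * b) * c' = 1" using 1 by (simp add: c algebra_simps)
  ultimately show ?thesis
    unfolding form_equiv_def by (intro exI [of _ a] exI [of _ "l * b"] exI [of _ c'] exI [of _ d]) simp
qed

text \<open>Needed to apply \<open>form_equiv_scale\<close> when the factor \<open>l\<close> is in
  the last coefficient, that is, to divide by the prime ideal again.\<close>

lemma form_equiv_swap: "form_equiv (A, v, C) (A', v', C') \<Longrightarrow> form_equiv (C, v, A) (C', v', A')"
proof -
  assume "form_equiv (A, v, C) (A', v', C')"
  then obtain a b c d where 1: "a * d - 4 * b * c = 1" and 2: "(A', v', C') = form_act a b c d (A, v, C)"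
    by (auto simp: form_equiv_def)
  then have "(C', v', A') = form_act d c b a (C, v, A)" by (simp add: algebra_simps)
  moreover have "d * a - 4 * c * b = 1" using 1 by (simp add: algebra_simps)
  ultimately show ?thesis unfolding form_equiv_def by blast
qed

section \<open>The two genera\<close>

definition red_forms :: "int \<Rightarrow> (int \<times> int \<times> int) set" where
  "red_forms N = {f. form_reduced f \<and> form_disc f = N}"

text \<open>Over the integers the strict bounds give
  \<open>v\<^sup>2 \<le> (4 * A - 1) * (4 * C - 1)\<close>, so
  \<open>4 * A + 4 * C - 1 \<le> N\<close>.\<close>

lemma finite_red_forms: "finite (red_forms N)"
proof (rule finite_subset)
  show "red_forms N \<subseteq> {- 4 * N..4 * N} \<times> {- 4 * N..4 * N} \<times> {- 4 * N..4 * N}"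
  proof
    fix f assume "f \<in> red_forms N"
    then obtain A v C where f: "f = (A, v, C)" and 1: "\<bar>v\<bar> \<le> 4 * A - 1" "\<bar>v\<bar> \<le> 4 * C - 1"
        and N: "16 * A * C - v\<^sup>2 = N"
      by (cases f) (auto simp: red_forms_def)
    have "\<bar>v\<bar> * \<bar>v\<bar> \<le> (4 * A - 1) * (4 * C - 1)"
      using 1 by (intro mult_mono) auto
    then have "4 * A + 4 * C - 1 \<le> N"
      unfolding N [symmetric] by (simp add: power2_eq_square algebra_simps)
    then show "f \<in> {- 4 * N..4 * N} \<times> {- 4 * N..4 * N} \<times> {- 4 * N..4 * N}"
      using 1 by (auto simp: f)
  qed
qed simp

lemma even_card_involution:
  assumes "finite S" "\<And>x. x \<in> S \<Longrightarrow> \<sigma> x \<in> S" "\<And>x. x \<in> S \<Longrightarrow> \<sigma> (\<sigma> x) = x" "\<And>x. x \<in> S \<Longrightarrow> \<sigma> x \<noteq> x"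
  shows "even (card S)"
  using assms
proof (induction "card S" arbitrary: S rule: less_induct)
  case less
  show ?case
  proof (cases "S = {}")
    case False
    then obtain x where x: "x \<in> S" by auto
    define T where "T = S - {x, \<sigma> x}"
    have "\<sigma> x \<noteq> x" "\<sigma> x \<in> S" using x less.prems(2,4) by blast+
    then have xs: "{x, \<sigma> x} \<subseteq> S" "card {x, \<sigma> x} = 2"
      using x by auto
    have fin: "finite T" "finite S" using less.prems(1) by (auto simp: T_def)
    have "card S = card T + 2"
      unfolding T_def using xs card_Diff_subset [of "{x, \<sigma> x}" S] card_mono [OF fin(2) xs(1)] by simp
    moreover have "even (card T)"
    proof (rule less.hyps)
      show "card T < card S" using \<open>card S = card T + 2\<close> by simp
      show "\<sigma> y \<in> T" if "y \<in> T" for y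
        using that x less.prems(2,3) unfolding T_def by (metis DiffE DiffI insert_iff singletonD)
    qed (use less.prems fin T_def in auto)
    ultimately show ?thesis by simp
  qed simp
qed

text \<open>Multiplication with a prime ideal above \<open>l\<close> is injective on classes and
  exchanges the genera because \<open>l\<close> is a nonresidue of \<open>p\<close>. So each genus
  injects into the other.\<close>

lemma card_genus_eq:
  assumes N: "N > 0" "odd N" and p: "prime p" "odd p" "p dvd N" "\<not> p\<^sup>2 dvd N"
    and l: "prime l" "odd l" "\<not> l dvd N" "l dvd \<rho>\<^sup>2 + N" "Legendre l p = - 1"
  shows "card {f \<in> red_forms N. form_genus p f} = card {f \<in> red_forms N. \<not> form_genus p f}"
proof -
  \<comment> \<open>The multiplication is kept as a relation over all admissible representatives of
    the class; the map \<open>\<phi>\<close> is chosen from it at the end.\<close>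
  define Rel where "Rel f g \<longleftrightarrow> (\<exists>A v C. form_equiv f (l * A, v, C) \<and> l dvd v - \<rho> \<and> form_equiv (A, v, l * C) g)" for f g
  have flip: "form_genus p (A, v, l * C) \<longleftrightarrow> \<not> form_genus p (l * A, v, C)" if d: "form_disc (l * A, v, C) = N" for A v C
  proof -
    have d': "form_disc (A, v, l * C) = N" using d by (simp add: mult_ac)
    have flip1: "Legendre (l * B) p = 1 \<longleftrightarrow> Legendre B p \<noteq> 1" "\<not> p dvd l * B" if "\<not> p dvd B" for B
    proof -
      have "Legendre B p \<noteq> 0" using that by (simp add: Legendre_eq_0_iff)
      moreover have "Legendre (l * B) p = - Legendre B p"
        using l(5) by (simp add: Legendre_mult [OF p(1,2)])
      ultimately show "Legendre (l * B) p = 1 \<longleftrightarrow> Legendre B p \<noteq> 1" "\<not> p dvd l * B"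
        using Legendre_values [of B p] Legendre_eq_0_iff [of "l * B" p] by auto
    qed
    show ?thesis
    proof (cases "p dvd A")
      case False
      have "form_genus p (l * A, v, C) \<longleftrightarrow> Legendre (l * A) p = 1"
        using form_genus_iff [OF p(1,2), of "(l * A, v, C)" 1 0] d p(3) flip1 [OF False] by simp
      moreover have "form_genus p (A, v, l * C) \<longleftrightarrow> Legendre A p = 1"
        using form_genus_iff [OF p(1,2), of "(A, v, l * C)" 1 0] d' p(3) False by simp
      ultimately show ?thesis using flip1 [OF False] by simp
    next
      \<comment> \<open>Then \<open>p\<close> divides \<open>v\<close> but not \<open>C\<close>,
        since \<open>p\<^sup>2\<close> does not divide \<open>N\<close>. The genus is therefore read
        off at \<open>(0, 1)\<close> instead of \<open>(1, 0)\<close>.\<close>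
      case True
      have vN: "v\<^sup>2 = 16 * l * A * C - N" using d by simp
      then have "p dvd v\<^sup>2" using True p(3) by simp
      then have pv: "p dvd v" using p(1) prime_dvd_power by blast
      have "\<not> p dvd C"
      proof
        assume "p dvd C"
        then have "p * p dvd A * C" "p * p dvd v * v" using True pv by (auto intro: mult_dvd_mono)
        then have "p\<^sup>2 dvd 16 * l * (A * C) - v * v" unfolding power2_eq_square by (rule dvd_diff [OF dvd_mult])
        also have "16 * l * (A * C) - v * v = N" using d by (simp add: power2_eq_square algebra_simps)
        finally show False using p(4) by simp
      qed
      then have C: "\<not> p dvd 4 * C"
        using odd_prime_not_dvd_2 [OF p(1,2)] p(1) prime_dvd_mult_iff [of p 2 2] by (auto simp: prime_dvd_mult_iff)
      have "form_genus p (l * A, v, C) \<longleftrightarrow> Legendre (4 * C) p = 1"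
        using form_genus_iff [OF p(1,2), of "(l * A, v, C)" 0 1] d p(3) C by simp
      moreover have "form_genus p (A, v, l * C) \<longleftrightarrow> Legendre (l * (4 * C)) p = 1"
        using form_genus_iff [OF p(1,2), of "(A, v, l * C)" 0 1] d' p(3) flip1 [OF C] by (simp add: mult.left_commute [of 4])
      ultimately show ?thesis using flip1 [OF C] by simp
    qed
  qed
  have ex: "\<exists>g\<in>red_forms N. Rel f g \<and> (form_genus p g \<longleftrightarrow> \<not> form_genus p f)" if f: "f \<in> red_forms N" for f
  proof -
    have fN: "form_reduced f" "form_disc f = N" using f by (auto simp: red_forms_def)
    obtain A v C where 1: "form_equiv f (l * A, v, C)" "l dvd v - \<rho>"
      using form_equiv_root_exists [OF l(1,2), of f \<rho>] l(3,4) fN by auto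
    have d: "form_disc (l * A, v, C) = N" using form_equiv_disc [OF 1(1)] fN by simp
    have "form_pos (l * A, v, C)"
      using form_equiv_pos [OF 1(1)] form_reduced_pos [OF fN(1)] fN N by simp
    then have pos: "form_pos (A, v, l * C)"
      using prime_gt_0_int [OF l(1)] by (simp add: zero_less_mult_iff)
    have d': "form_disc (A, v, l * C) = N" using d by (simp add: mult_ac)
    obtain g where g: "form_equiv (A, v, l * C) g" "form_reduced g"
      using form_equiv_reduced_exists [OF pos] N unfolding d' by blast
    have "form_disc g = N" using form_equiv_disc [OF g(1)] d' by simp
    moreover have "form_genus p g \<longleftrightarrow> \<not> form_genus p f"
      using form_equiv_genus [OF 1(1)] form_equiv_genus [OF g(1)] flip [OF d] by simp
    ultimately show ?thesis using 1 g unfolding Rel_def red_forms_def by blast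
  qed
  have inj: "f1 = f2" if asm: "f1 \<in> red_forms N" "f2 \<in> red_forms N" "Rel f1 g" "Rel f2 g" for f1 f2 g
  proof -
    obtain A1 v1 C1 where 1: "form_equiv f1 (l * A1, v1, C1)" "l dvd v1 - \<rho>" "form_equiv (A1, v1, l * C1) g"
      using asm(3) by (auto simp: Rel_def)
    obtain A2 v2 C2 where 2: "form_equiv f2 (l * A2, v2, C2)" "l dvd v2 - \<rho>" "form_equiv (A2, v2, l * C2) g"
      using asm(4) by (auto simp: Rel_def)
    have fN: "form_reduced f1" "form_disc f1 = N" "form_reduced f2" using asm(1,2) by (auto simp: red_forms_def)
    \<comment> \<open>After the swap the factor \<open>l\<close> is in front again, so
      \<open>form_equiv_scale\<close> undoes the multiplication.\<close>
    have "form_equiv (l * C1, v1, A1) (l * C2, v2, A2)"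
      by (rule form_equiv_swap, rule form_equiv_trans [OF 1(3) form_equiv_sym [OF 2(3)]])
    moreover have "form_disc (l * C1, v1, A1) = N"
      using form_equiv_disc [OF 1(1)] fN by (simp add: mult_ac)
    moreover have "l dvd v1 - v2"
      using dvd_diff [OF 1(2) 2(2)] by simp
    ultimately have "form_equiv (C1, v1, l * A1) (C2, v2, l * A2)"
      using form_equiv_scale [OF l(1,2), of C1 v1 A1 v2 C2 A2] l(3) by simp
    then have "form_equiv (l * A1, v1, C1) (l * A2, v2, C2)" by (rule form_equiv_swap)
    then have "form_equiv f1 f2" using 1(1) form_equiv_sym [OF 2(1)] form_equiv_trans by blast
    then show ?thesis using form_equiv_reduced_unique fN N by blast
  qed
  obtain \<phi> where \<phi>: "\<And>f. f \<in> red_forms N \<Longrightarrow> \<phi> f \<in> red_forms N \<and> Rel f (\<phi> f) \<and> (form_genus p (\<phi> f) \<longleftrightarrow> \<not> form_genus p f)"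
    using bchoice [of "red_forms N" "\<lambda>f g. g \<in> red_forms N \<and> Rel f g \<and> (form_genus p g \<longleftrightarrow> \<not> form_genus p f)"] ex by blast
  have \<phi>_inj: "inj_on \<phi> (red_forms N)"
    by (rule inj_onI) (metis \<phi> inj)
  show ?thesis
  proof (rule order_antisym)
    show "card {f \<in> red_forms N. form_genus p f} \<le> card {f \<in> red_forms N. \<not> form_genus p f}"
      by (rule card_inj_on_le [of \<phi>])
         (use \<phi> finite_red_forms in \<open>auto intro: inj_on_subset [OF \<phi>_inj]\<close>)
    show "card {f \<in> red_forms N. \<not> form_genus p f} \<le> card {f \<in> red_forms N. form_genus p f}"
      by (rule card_inj_on_le [of \<phi>])
         (use \<phi> finite_red_forms in \<open>auto intro: inj_on_subset [OF \<phi>_inj]\<close>)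
  qed
qed

section \<open>Positive middle coefficients and the parity of one genus\<close>

lemma red_set_subset: "red_set N \<subseteq> red_forms N"
  by (auto simp: red_set_def red_forms_def)

lemma finite_red_set: "finite (red_set N)"
  by (rule finite_subset [OF red_set_subset finite_red_forms])

lemma form_genus_uminus: "form_genus p (A, - v, C) \<longleftrightarrow> form_genus p (A, v, C)"
proof -
  have "form_val (A, - v, C) x y = form_val (A, v, C) x (- y)" for x y by simp
  then show ?thesis unfolding form_genus_def by (metis minus_minus)
qed

text \<open>The sign change of \<open>v\<close> preserves the genus and has no fixed point,
  \<open>v\<close> being odd.\<close>

lemma card_red_forms_genus:
  assumes "odd N"
  shows "card {f \<in> red_forms N. form_genus p f = s} = 2 * card {f \<in> red_set N. form_genus p f = s}"
proof -
  let ?n = "\<lambda>(A, v, C). (A, - v, C) :: int \<times> int \<times> int"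
  let ?S = "{f \<in> red_set N. form_genus p f = s}"
  have "{f \<in> red_forms N. form_genus p f = s} = ?S \<union> ?n ` ?S"
  proof (intro subset_antisym subsetI)
    fix f assume f: "f \<in> {f \<in> red_forms N. form_genus p f = s}"
    obtain A v C where fe: "f = (A, v, C)" by (cases f)
    have "form_disc (A, v, C) = N" using f by (simp add: fe red_forms_def)
    then have "odd v" using assms odd_middle by blast
    then have "v > 0 \<or> v < 0" by (cases "v = 0") auto
    then show "f \<in> ?S \<union> ?n ` ?S"
    proof
      assume "v > 0"
      then have "f \<in> ?S" using f by (auto simp: fe red_forms_def red_set_def)
      then show ?thesis by blast
    next
      assume "v < 0"
      then have "(A, - v, C) \<in> ?S" using f by (auto simp: fe red_forms_def red_set_def form_genus_uminus)
      moreover have "f = ?n (A, - v, C)" by (simp add: fe)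
      ultimately show ?thesis by blast
    qed
  next
    fix f assume "f \<in> ?S \<union> ?n ` ?S"
    then show "f \<in> {f \<in> red_forms N. form_genus p f = s}"
      by (auto simp: red_forms_def red_set_def form_genus_uminus)
  qed
  moreover have "?S \<inter> ?n ` ?S = {}" by (auto simp: red_set_def)
  moreover have "inj_on ?n ?S" by (auto simp: inj_on_def)
  moreover have "finite ?S" using finite_red_set by simp
  ultimately show ?thesis by (simp add: card_Un_disjoint card_image)
qed

lemma prod_7_mod_8_imp_sum:
  fixes c e :: int
  assumes "(c * e) mod 8 = 7"
  shows "8 dvd c + e" "odd c" "odd e" "c \<noteq> e"
proof -
  have eq: "((c mod 8) * (e mod 8)) mod 8 = 7"
    using assms by (simp add: mod_mult_eq)
  have "c mod 8 \<in> {0, 1, 2, 3, 4, 5, 6, 7}" "e mod 8 \<in> {0, 1, 2, 3, 4, 5, 6, 7}"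
    by auto
  then have "((c mod 8) + (e mod 8)) mod 8 = 0 \<and> c mod 8 \<noteq> e mod 8"
    using eq by auto
  then show "8 dvd c + e" "c \<noteq> e" by (auto simp: mod_add_eq dvd_eq_mod_eq_0)
  have "odd x" if "x mod 8 = 7" for x :: int
    using that by presburger
  then have "odd (c * e)" using assms by blast
  then show "odd c" "odd e" by auto
qed

text \<open>Two involutions in succession: the swap of \<open>A\<close> and \<open>C\<close>, then
  \<open>c \<mapsto> r div c\<close> on the divisors that index the fixed points of the swap. The
  second keeps the genus because \<open>r\<close> is a residue of \<open>p\<close>, and is free of
  fixed points because \<open>r\<close> is not a square.\<close>

lemma even_card_principal_genus:
  assumes N: "N = p * r" "N mod 8 = 7" and r: "r > 0" "Legendre r p = 1" "\<And>s. r \<noteq> s\<^sup>2"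
    and p: "prime p" "odd p" "\<not> p dvd r"
  shows "even (card {f \<in> red_set N. form_genus p f})"
proof -
  have p0: "p > 0" using prime_gt_0_int [OF p(1)] .
  txt \<open>
    The swap of \<open>A\<close> and \<open>C\<close> leaves the forms with \<open>A = C\<close>, for which \<open>N = (4A - v)(4A + v)\<close>; let \<open>c\<close> be the
    factor that is not divisible by \<open>p\<close>.
  \<close>
  define \<Phi> where "\<Phi> c = (let e = N div c in ((c + e) div 8, \<bar>e - c\<bar> div 2, (c + e) div 8))" for c
  define D where "D = {c. 0 < c \<and> c dvd r \<and> form_genus p (\<Phi> c)}"
  have \<Phi>: "\<exists>A v. \<Phi> c = (A, v, A) \<and> 8 * A = c + p * (r div c) \<and> 2 * v = \<bar>p * (r div c) - c\<bar> \<and> (A, v, A) \<in> red_set N"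
    if c: "0 < c" "c dvd r" for c
  proof -
    define e where "e = p * (r div c)"
    have ce: "c * e = N" using c by (simp add: e_def N)
    have e: "N div c = e" using c by (simp add: ce [symmetric])
    have s: "8 dvd c + e" "odd c" "odd e" "c \<noteq> e"
      using prod_7_mod_8_imp_sum [of c e] N(2) by (simp_all add: ce)
    obtain A where A: "c + e = 8 * A" using s(1) by (rule dvdE)
    have "even \<bar>e - c\<bar>" using s by simp
    then obtain v where v: "\<bar>e - c\<bar> = 2 * v" by (rule dvdE)
    have "e > 0" using c r p0 by (simp add: e_def pos_imp_zdiv_pos_iff zdvd_imp_le)
    then have "v > 0" "v < 4 * A" using A v s(4) c(1) by auto
    moreover have "4 * (16 * A * A) = 4 * (N + v\<^sup>2)"
    proof -
      have "4 * (16 * A * A) = (c + e)\<^sup>2" unfolding A by (simp add: power2_eq_square)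
      also have "\<dots> = 4 * (c * e) + \<bar>e - c\<bar>\<^sup>2" by (simp add: power2_eq_square algebra_simps)
      finally show ?thesis unfolding v ce by (simp add: power2_eq_square)
    qed
    ultimately have "(A, v, A) \<in> red_set N" by (simp add: red_set_def)
    moreover have "\<Phi> c = (A, v, A)" unfolding \<Phi>_def Let_def e A v by simp
    ultimately show ?thesis using A v by (auto simp: e_def)
  qed
  \<comment> \<open>Modulo \<open>p\<close> the number \<open>8 * A\<close> is \<open>c\<close>, so
    the genus depends only on the residue symbol of \<open>c\<close>.\<close>
  have psi: "form_genus p (\<Phi> c) \<longleftrightarrow> Legendre 8 p * Legendre c p = 1" if c: "0 < c" "c dvd r" for c
  proof -
    obtain A v where A: "\<Phi> c = (A, v, A)" "8 * A = c + p * (r div c)" "(A, v, A) \<in> red_set N"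
      using \<Phi> [OF c] by blast
    have nc: "\<not> p dvd c" using c(2) p(3) dvd_trans by blast
    have "[8 * A = c] (mod p)" unfolding A(2) by (simp add: cong_iff_dvd_diff)
    then have L: "Legendre 8 p * Legendre A p = Legendre c p"
      using Legendre_cong_mod Legendre_mult [OF p(1,2)] by metis
    have "Legendre c p \<noteq> 0" using nc by (simp add: Legendre_eq_0_iff)
    then have nA: "Legendre A p \<noteq> 0" "Legendre 8 p \<noteq> 0" using L by auto
    have "form_disc (A, v, A) = N" using A(3) by (simp add: red_set_def)
    then have "form_genus p (A, v, A) \<longleftrightarrow> Legendre A p = 1"
      using form_genus_iff [OF p(1,2), of "(A, v, A)" 1 0] nA(1) by (simp add: N(1) Legendre_eq_0_iff)
    then show ?thesis
      unfolding A(1) L [symmetric] using nA Legendre_values [of A p] Legendre_values [of 8 p] by auto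
  qed
  have image: "{f \<in> red_set N. form_genus p f \<and> fst f = snd (snd f)} = \<Phi> ` D"
  proof (intro subset_antisym subsetI)
    fix f assume "f \<in> \<Phi> ` D"
    then obtain c where "f = \<Phi> c" "0 < c" "c dvd r" "form_genus p (\<Phi> c)" by (auto simp: D_def)
    then show "f \<in> {f \<in> red_set N. form_genus p f \<and> fst f = snd (snd f)}"
      using \<Phi> [of c] by auto
  next
    fix f assume "f \<in> {f \<in> red_set N. form_genus p f \<and> fst f = snd (snd f)}"
    then obtain A v where f: "f = (A, v, A)" "form_genus p f" "f \<in> red_set N" by (cases f) auto
    then have v: "0 < v" "v < 4 * A" "16 * A * A = N + v\<^sup>2" by (auto simp: red_set_def)
    have N': "(4 * A - v) * (4 * A + v) = N" using v(3) by (simp add: power2_eq_square algebra_simps)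
    have "p dvd (4 * A - v) * (4 * A + v)" unfolding N' N by simp
    then have "\<exists>c e. c > 0 \<and> e > 0 \<and> c * e = N \<and> p dvd e \<and> c + e = 8 * A \<and> \<bar>e - c\<bar> = 2 * v"
      unfolding prime_dvd_mult_iff [OF p(1)]
    proof
      assume "p dvd 4 * A - v"
      then show ?thesis using N' v by (intro exI [of _ "4 * A + v"] exI [of _ "4 * A - v"]) (auto simp: mult.commute)
    next
      assume "p dvd 4 * A + v"
      then show ?thesis using N' v by (intro exI [of _ "4 * A - v"] exI [of _ "4 * A + v"]) auto
    qed
    then obtain c e where c: "c > 0" "e > 0" "c * e = N" "p dvd e" "c + e = 8 * A" "\<bar>e - c\<bar> = 2 * v"
      by blast
    then obtain e' where e': "e = p * e'" by (auto elim: dvdE)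
    have "p * (c * e') = p * r" using c(3) by (simp add: e' N mult_ac)
    then have "r = c * e'" using p0 by simp
    then have "c dvd r" by simp
    moreover have "N div c = e" using c(1,3) by auto
    then have "\<Phi> c = f" unfolding \<Phi>_def Let_def using c(5,6) by (simp add: f)
    ultimately show "f \<in> \<Phi> ` D" using c(1) f(2) unfolding D_def by blast
  qed
  have inj: "inj_on \<Phi> D"
  proof (rule inj_onI)
    fix c c' assume D: "c \<in> D" "c' \<in> D" and eq: "\<Phi> c = \<Phi> c'"
    have "c + p * (r div c) = c' + p * (r div c')" "\<bar>p * (r div c) - c\<bar> = \<bar>p * (r div c') - c'\<bar>"
      using \<Phi> [of c] \<Phi> [of c'] D eq by (auto simp: D_def)
    \<comment> \<open>Sum and absolute difference determine the unordered pair of factors of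
      \<open>N\<close>; divisibility by \<open>p\<close> tells the two apart.\<close>
    then have "c = c' \<or> c = p * (r div c')" by (auto simp: abs_if split: if_splits)
    moreover have "c \<noteq> p * (r div c')"
    proof
      assume "c = p * (r div c')"
      then have "p dvd c" by simp
      then show False using D p(3) dvd_trans by (auto simp: D_def)
    qed
    ultimately show "c = c'" by simp
  qed
  have evenD: "even (card D)"
  proof (rule even_card_involution [where \<sigma> = "\<lambda>c. r div c"])
    have "D \<subseteq> {0..r}" using r(1) by (auto simp: D_def zdvd_imp_le)
    then show "finite D" by (rule finite_subset) simp
    fix c assume "c \<in> D"
    then have c: "0 < c" "c dvd r" "form_genus p (\<Phi> c)" by (auto simp: D_def)
    then obtain d where d: "r = c * d" by (auto elim: dvdE)
    have d0: "d > 0" using d r(1) c(1) by (simp add: zero_less_mult_iff)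
    have rc: "r div c = d" using c(1) by (simp add: d)
    have "Legendre c p * Legendre d p = 1"
      using r(2) by (simp add: d Legendre_mult [OF p(1,2)])
    then have "Legendre c p = Legendre d p"
      using Legendre_values [of c p] Legendre_values [of d p] by auto
    then show "r div c \<in> D"
      using c d0 psi [of c] psi [of d] unfolding rc by (simp add: D_def d)
    show "r div (r div c) = c" unfolding rc using d0 by (simp add: d)
    show "r div c \<noteq> c" unfolding rc using r(3) [of c] by (auto simp: d power2_eq_square)
  qed
  have even2: "even (card {f \<in> red_set N. form_genus p f \<and> fst f \<noteq> snd (snd f)})"
  proof (rule even_card_involution [where \<sigma> = "\<lambda>(A, v, C). (C, v, A)"])
    show "finite {f \<in> red_set N. form_genus p f \<and> fst f \<noteq> snd (snd f)}"
      using finite_red_set [of N] by simp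
    fix f assume f: "f \<in> {f \<in> red_set N. form_genus p f \<and> fst f \<noteq> snd (snd f)}"
    obtain A v C where fe: "f = (A, v, C)" by (cases f)
    have rs: "(A, v, C) \<in> red_set N" "(C, v, A) \<in> red_set N" "A \<noteq> C"
      using f by (auto simp: fe red_set_def mult_ac)
    have "form_genus p (C, v, A)"
    proof -
      have "form_genus p (A, v, C)" using f by (simp add: fe)
      then obtain x y where xy: "Legendre (form_val (A, v, C) x y) p = 1" by (auto simp: form_genus_def)
      have "Legendre (2\<^sup>2) p = 1"
        by (rule Legendre_square [OF odd_prime_not_dvd_2 [OF p(1,2)] p(1)])
      then have "Legendre (2\<^sup>2 * form_val (A, v, C) x y) p = 1"
        using xy by (simp only: Legendre_mult [OF p(1,2)])
      \<comment> \<open>The swapped form represents 4 times each value of the original one, and 4 is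
        a square, so the swap preserves the genus.\<close>
      also have "2\<^sup>2 * form_val (A, v, C) x y = form_val (C, v, A) (4 * y) x"
        by (simp add: power2_eq_square algebra_simps)
      finally show ?thesis unfolding form_genus_def by blast
    qed
    then show "(case f of (A, v, C) \<Rightarrow> (C, v, A)) \<in> {f \<in> red_set N. form_genus p f \<and> fst f \<noteq> snd (snd f)}"
      using rs by (simp add: fe)
    show "(case case f of (A, v, C) \<Rightarrow> (C, v, A) of (A, v, C) \<Rightarrow> (C, v, A)) = f" by (simp add: fe)
    show "(case f of (A, v, C) \<Rightarrow> (C, v, A)) \<noteq> f" using rs by (simp add: fe)
  qed
  have "{f \<in> red_set N. form_genus p f} = {f \<in> red_set N. form_genus p f \<and> fst f = snd (snd f)} \<union>
      {f \<in> red_set N. form_genus p f \<and> fst f \<noteq> snd (snd f)}" by auto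
  then have "card {f \<in> red_set N. form_genus p f} = card (\<Phi> ` D) +
      card {f \<in> red_set N. form_genus p f \<and> fst f \<noteq> snd (snd f)}"
    unfolding image [symmetric] using finite_red_set [of N]
    by (simp only:) (rule card_Un_disjoint, auto)
  then show ?thesis using even2 evenD card_image [OF inj] by simp
qed

text \<open>The genera have equal size in \<open>red_forms\<close>, hence also in its half
  \<open>red_set\<close>, and one of them is even there.\<close>

lemma four_dvd_card_red_set:
  assumes N: "N = p * r" "N mod 8 = 7" and r: "r > 0" "Legendre r p = 1" "\<And>s. r \<noteq> s\<^sup>2"
    and p: "prime p" "odd p" "\<not> p dvd r"
    and l: "prime l" "odd l" "\<not> l dvd N" "l dvd \<rho>\<^sup>2 + N" "Legendre l p = - 1"
  shows "4 dvd card (red_set N)"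
proof -
  have p0: "p > 0" using prime_gt_0_int [OF p(1)] .
  have "N > 0" using r(1) p0 by (simp add: N(1))
  moreover have "odd N" using N(2) by presburger
  ultimately have N0: "N > 0" "odd N" by blast+
  have "\<not> p\<^sup>2 dvd N" using p(3) p0 by (simp add: N(1) power2_eq_square)
  then have "card {f \<in> red_forms N. form_genus p f} = card {f \<in> red_forms N. \<not> form_genus p f}"
    using card_genus_eq [OF N0 p(1,2) _ _ l] N(1) by simp
  then have eq: "card {f \<in> red_set N. form_genus p f} = card {f \<in> red_set N. \<not> form_genus p f}"
    using card_red_forms_genus [OF N0(2), of p True] card_red_forms_genus [OF N0(2), of p False] by simp
  have "red_set N = {f \<in> red_set N. form_genus p f} \<union> {f \<in> red_set N. \<not> form_genus p f}" by auto
  then have "card (red_set N) = card ({f \<in> red_set N. form_genus p f} \<union> {f \<in> red_set N. \<not> form_genus p f})" by simp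
  also have "\<dots> = card {f \<in> red_set N. form_genus p f} + card {f \<in> red_set N. \<not> form_genus p f}"
    by (rule card_Un_disjoint) (use finite_red_set [of N] in auto)
  also have "\<dots> = 2 * card {f \<in> red_set N. form_genus p f}" using eq by simp
  finally show ?thesis
    using even_card_principal_genus [OF N r p] by (auto elim!: evenE)
qed

section \<open>Real characters and the hyperbola method\<close>

definition real_char :: "nat \<Rightarrow> (nat \<Rightarrow> int) \<Rightarrow> bool" where
  "real_char M \<chi> \<longleftrightarrow> (\<forall>x y. [x = y] (mod M) \<longrightarrow> \<chi> x = \<chi> y) \<and> (\<forall>x y. \<chi> (x * y) = \<chi> x * \<chi> y) \<and>
     (\<forall>x. \<bar>\<chi> x\<bar> \<le> 1) \<and> (\<forall>x. \<not> coprime x M \<longrightarrow> \<chi> x = 0) \<and> \<chi> 1 = 1"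

text \<open>Multiplication by \<open>a\<close> permutes the residues and negates the sum over a
  period, which therefore vanishes. Only an incomplete period is left.\<close>

lemma real_char_sum_bound:
  assumes \<chi>: "real_char M \<chi>" and M: "M > 1" and a: "\<chi> a = - 1"
  shows "\<bar>\<Sum>x\<in>{1..n}. \<chi> x\<bar> \<le> int M"
proof -
  have per: "\<chi> x = \<chi> y" if "[x = y] (mod M)" for x y using \<chi> that by (simp add: real_char_def)
  have mult: "\<chi> (x * y) = \<chi> x * \<chi> y" for x y using \<chi> by (simp add: real_char_def)
  have cop: "coprime a M" using \<chi> a unfolding real_char_def by fastforce
  have le1: "\<bar>\<chi> x\<bar> \<le> 1" for x using \<chi> by (simp add: real_char_def)
  have "\<chi> 0 = 0" using \<chi> M unfolding real_char_def by fastforce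
  define S where "S = (\<Sum>x<M. \<chi> x)"
  have inj: "inj_on (\<lambda>x. a * x mod M) {..<M}"
  proof (rule inj_onI)
    fix x y assume xy: "x \<in> {..<M}" "y \<in> {..<M}" and "a * x mod M = a * y mod M"
    then have "[a * x = a * y] (mod M)" by (simp add: cong_def)
    then have "[x = y] (mod M)" using cong_mult_lcancel_nat cop by blast
    then show "x = y" using xy by (simp add: cong_def)
  qed
  have "(\<lambda>x. a * x mod M) ` {..<M} = {..<M}"
    by (rule endo_inj_surj [OF _ _ inj]) (use M in auto)
  then have "S = (\<Sum>x<M. \<chi> (a * x mod M))"
    unfolding S_def by (metis (no_types, lifting) inj sum.reindex_cong)
  also have "\<dots> = (\<Sum>x<M. \<chi> a * \<chi> x)"
    by (rule sum.cong [OF refl]) (simp add: mult [symmetric] per)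
  also have "\<dots> = - S" by (simp add: a S_def sum_negf)
  finally have S0: "S = 0" by simp
  have red: "(\<Sum>x<n. \<chi> x) = (\<Sum>x<n mod M. \<chi> x)" for n
  proof (induction n rule: less_induct)
    case (less n)
    show ?case
    proof (cases "n < M")
      case False
      then obtain k where k: "n = M + k" by (metis le_add_diff_inverse not_less)
      have "(\<Sum>x<n. \<chi> x) = (\<Sum>x<M. \<chi> x) + (\<Sum>x=M..<M + k. \<chi> x)"
        unfolding k lessThan_atLeast0 by (rule sum.atLeastLessThan_concat [symmetric]) auto
      also have "(\<Sum>x=M..<M + k. \<chi> x) = (\<Sum>x<k. \<chi> (x + M))"
        using sum.shift_bounds_nat_ivl [of \<chi> 0 M k] by (simp add: lessThan_atLeast0 add.commute)
      also have "\<dots> = (\<Sum>x<k. \<chi> x)"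
        by (rule sum.cong [OF refl], rule per) (simp add: cong_def)
      also have "\<dots> = (\<Sum>x<k mod M. \<chi> x)"
        by (rule less) (use k M in simp)
      finally show ?thesis using S0 by (simp add: S_def k)
    qed simp
  qed
  have "(\<Sum>x\<in>{1..n}. \<chi> x) = (\<Sum>x<Suc n. \<chi> x)"
  proof -
    have "{..<Suc n} = insert 0 {1..n}" by auto
    then show ?thesis using \<open>\<chi> 0 = 0\<close> by simp
  qed
  also have "\<bar>\<dots>\<bar> \<le> (\<Sum>x<Suc n mod M. \<bar>\<chi> x\<bar>)"
    unfolding red [of "Suc n"] by (rule sum_abs)
  also have "\<dots> \<le> (\<Sum>x<Suc n mod M. 1)" by (rule sum_mono) (rule le1)
  also have "\<dots> \<le> int M" using M by (simp add: less_imp_le)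
  finally show ?thesis .
qed

text \<open>Dirichlet's hyperbola method: the pairs with \<open>d * e \<le> Z\<^sup>2\<close> are
  split according to \<open>d \<le> Z\<close> or \<open>d > Z\<close>, where the latter forces
  \<open>e \<le> Z\<close>. For each value of the short variable the inner sum is at most
  \<open>B\<close> in the first part and, as a difference of two sums, \<open>2 * B\<close> in the
  second.\<close>

lemma hyperbola_bound:
  fixes \<chi> \<psi> :: "nat \<Rightarrow> int"
  assumes S: "\<And>n. \<bar>\<Sum>x\<in>{1..n}. \<chi> x\<bar> \<le> B" "\<And>n. \<bar>\<Sum>x\<in>{1..n}. \<psi> x\<bar> \<le> B"
    and le1: "\<And>x. \<bar>\<chi> x\<bar> \<le> 1" "\<And>x. \<bar>\<psi> x\<bar> \<le> 1"
  shows "\<bar>\<Sum>n\<in>{1..Z\<^sup>2}. \<Sum>d | d dvd n. \<chi> d * \<psi> (n div d)\<bar> \<le> 3 * B * int Z"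
proof -
  define f where "f = (\<lambda>(d, e). \<chi> d * \<psi> e)"
  have fin: "finite {d. d dvd n}" if "n \<in> {1..Z\<^sup>2}" for n using that by simp
  have "(\<Sum>n\<in>{1..Z\<^sup>2}. \<Sum>d | d dvd n. \<chi> d * \<psi> (n div d)) =
      (\<Sum>(n, d)\<in>Sigma {1..Z\<^sup>2} (\<lambda>n. {d. d dvd n}). \<chi> d * \<psi> (n div d))"
    by (rule sum.Sigma) (use fin in auto)
  also have "\<dots> = (\<Sum>x\<in>{(d, e). 1 \<le> d \<and> 1 \<le> e \<and> d * e \<le> Z\<^sup>2}. f x)"
    by (rule sum.reindex_bij_witness [of _ "\<lambda>(d, e). (d * e, d)" "\<lambda>(n, d). (d, n div d)"])
       (auto simp: f_def dvd_imp_le elim!: dvdE)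
  also have "{(d, e). 1 \<le> d \<and> 1 \<le> e \<and> d * e \<le> Z\<^sup>2} =
      Sigma {1..Z} (\<lambda>d. {1..Z\<^sup>2 div d}) \<union> prod.swap ` Sigma {1..Z} (\<lambda>e. {Z<..Z\<^sup>2 div e})"
  proof (intro subset_antisym subsetI)
    fix x assume "x \<in> {(d, e). 1 \<le> d \<and> 1 \<le> e \<and> d * e \<le> Z\<^sup>2}"
    then obtain d e where x: "x = (d, e)" and de: "1 \<le> d" "1 \<le> e" "d * e \<le> Z\<^sup>2" by auto
    show "x \<in> Sigma {1..Z} (\<lambda>d. {1..Z\<^sup>2 div d}) \<union> prod.swap ` Sigma {1..Z} (\<lambda>e. {Z<..Z\<^sup>2 div e})"
    proof (cases "d \<le> Z")
      case True
      then show ?thesis using de by (auto simp: x less_eq_div_iff_mult_less_eq mult.commute)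
    next
      case False
      have "e \<le> Z"
      proof (rule ccontr)
        assume "\<not> e \<le> Z"
        then have "Z * Z < d * e" using False by (intro mult_strict_mono) auto
        then show False using de(3) by (simp add: power2_eq_square)
      qed
      then have "(e, d) \<in> Sigma {1..Z} (\<lambda>e. {Z<..Z\<^sup>2 div e})"
        using de False by (auto simp: less_eq_div_iff_mult_less_eq)
      then show ?thesis by (auto simp: x image_iff)
    qed
  next
    fix x assume "x \<in> Sigma {1..Z} (\<lambda>d. {1..Z\<^sup>2 div d}) \<union> prod.swap ` Sigma {1..Z} (\<lambda>e. {Z<..Z\<^sup>2 div e})"
    then show "x \<in> {(d, e). 1 \<le> d \<and> 1 \<le> e \<and> d * e \<le> Z\<^sup>2}"
      by (auto simp: less_eq_div_iff_mult_less_eq mult.commute)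
  qed
  also have "(\<Sum>x\<in>\<dots>. f x) = (\<Sum>x\<in>Sigma {1..Z} (\<lambda>d. {1..Z\<^sup>2 div d}). f x) +
      (\<Sum>x\<in>prod.swap ` Sigma {1..Z} (\<lambda>e. {Z<..Z\<^sup>2 div e}). f x)"
    by (rule sum.union_disjoint) auto
  also have "(\<Sum>x\<in>Sigma {1..Z} (\<lambda>d. {1..Z\<^sup>2 div d}). f x) = (\<Sum>d\<in>{1..Z}. \<chi> d * (\<Sum>e\<in>{1..Z\<^sup>2 div d}. \<psi> e))"
    unfolding f_def by (simp add: sum.Sigma [symmetric] sum_distrib_left)
  also have "(\<Sum>x\<in>prod.swap ` Sigma {1..Z} (\<lambda>e. {Z<..Z\<^sup>2 div e}). f x) =
      (\<Sum>x\<in>Sigma {1..Z} (\<lambda>e. {Z<..Z\<^sup>2 div e}). f (prod.swap x))"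
    by (subst sum.reindex) (auto simp: inj_on_def)
  also have "\<dots> = (\<Sum>e\<in>{1..Z}. \<psi> e * (\<Sum>d\<in>{Z<..Z\<^sup>2 div e}. \<chi> d))"
  proof -
    have "(\<Sum>x\<in>Sigma {1..Z} (\<lambda>e. {Z<..Z\<^sup>2 div e}). f (prod.swap x)) =
        (\<Sum>(e, d)\<in>Sigma {1..Z} (\<lambda>e. {Z<..Z\<^sup>2 div e}). \<psi> e * \<chi> d)"
      by (rule sum.cong) (auto simp: f_def mult.commute)
    then show ?thesis by (simp add: sum.Sigma [symmetric] sum_distrib_left)
  qed
  finally have eq: "(\<Sum>n\<in>{1..Z\<^sup>2}. \<Sum>d | d dvd n. \<chi> d * \<psi> (n div d)) =
      (\<Sum>d\<in>{1..Z}. \<chi> d * (\<Sum>e\<in>{1..Z\<^sup>2 div d}. \<psi> e)) + (\<Sum>e\<in>{1..Z}. \<psi> e * (\<Sum>d\<in>{Z<..Z\<^sup>2 div e}. \<chi> d))" .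
  have b1: "\<bar>\<Sum>d\<in>{1..Z}. \<chi> d * (\<Sum>e\<in>{1..Z\<^sup>2 div d}. \<psi> e)\<bar> \<le> (\<Sum>d\<in>{1..Z}. B)"
  proof (rule order_trans [OF sum_abs], rule sum_mono)
    fix d
    have "\<bar>\<chi> d\<bar> * \<bar>\<Sum>e\<in>{1..Z\<^sup>2 div d}. \<psi> e\<bar> \<le> 1 * B"
      by (rule mult_mono) (use S(2) le1(1) in auto)
    then show "\<bar>\<chi> d * (\<Sum>e\<in>{1..Z\<^sup>2 div d}. \<psi> e)\<bar> \<le> B" by (simp add: abs_mult)
  qed
  have b2: "\<bar>\<Sum>e\<in>{1..Z}. \<psi> e * (\<Sum>d\<in>{Z<..Z\<^sup>2 div e}. \<chi> d)\<bar> \<le> (\<Sum>d\<in>{1..Z}. 2 * B)"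
  proof (rule order_trans [OF sum_abs], rule sum_mono)
    fix e assume e: "e \<in> {1..Z}"
    then have "Z * e \<le> Z\<^sup>2" by (simp add: power2_eq_square)
    then have "Z \<le> Z\<^sup>2 div e" using e by (simp add: less_eq_div_iff_mult_less_eq)
    then have "{1..Z\<^sup>2 div e} = {1..Z} \<union> {Z<..Z\<^sup>2 div e}" by auto
    then have "(\<Sum>d\<in>{1..Z\<^sup>2 div e}. \<chi> d) = (\<Sum>d\<in>{1..Z}. \<chi> d) + (\<Sum>d\<in>{Z<..Z\<^sup>2 div e}. \<chi> d)"
      by (simp only:) (rule sum.union_disjoint, auto)
    then have "\<bar>\<Sum>d\<in>{Z<..Z\<^sup>2 div e}. \<chi> d\<bar> \<le> 2 * B"
      using S(1) [of "Z\<^sup>2 div e"] S(1) [of Z] by linarith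
    then have "\<bar>\<psi> e\<bar> * \<bar>\<Sum>d\<in>{Z<..Z\<^sup>2 div e}. \<chi> d\<bar> \<le> 1 * (2 * B)"
      by (intro mult_mono) (use le1(2) in auto)
    then show "\<bar>\<psi> e * (\<Sum>d\<in>{Z<..Z\<^sup>2 div e}. \<chi> d)\<bar> \<le> 2 * B" by (simp add: abs_mult)
  qed
  have "(\<Sum>d\<in>{1..Z}. B) + (\<Sum>d\<in>{1..Z}. 2 * B) = 3 * B * int Z" by simp
  then show ?thesis using b1 b2 unfolding eq by linarith
qed

text \<open>The convolution is multiplicative, so it suffices to look at the exact power
  \<open>q ^ k\<close> in \<open>n\<close>. Its local factor is 0, \<open>k + 1\<close>, or an
  alternating sum equal to 0 or 1; two values \<open>- 1\<close>, which would give a negative factor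
  for odd \<open>k\<close>, are excluded by \<open>pr\<close>.\<close>

lemma convolution_nonneg:
  fixes \<chi> \<psi> :: "nat \<Rightarrow> int"
  assumes mult: "\<And>x y. \<chi> (x * y) = \<chi> x * \<chi> y" "\<And>x y. \<psi> (x * y) = \<psi> x * \<psi> y"
    and one: "\<chi> 1 = 1" "\<psi> 1 = 1"
    and pr: "\<And>q. prime q \<Longrightarrow> (\<chi> q = 0 \<and> \<psi> q = 0) \<or> (\<chi> q = 1 \<and> \<psi> q = 1) \<or> (\<chi> q = 1 \<and> \<psi> q = - 1) \<or> (\<chi> q = - 1 \<and> \<psi> q = 1)"
    and "n > 0"
  shows "(\<Sum>d | d dvd n. \<chi> d * \<psi> (n div d)) \<ge> 0"
  using \<open>n > 0\<close>
proof (induction n rule: less_induct)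
  case (less n)
  show ?case
  proof (cases "n = 1")
    case True
    then show ?thesis using one by simp
  next
    case False
    then obtain q where q: "prime q" "q dvd n" using prime_factor_nat by blast
    define k where "k = multiplicity q n"
    have q1: "q > 1" using prime_gt_1_nat [OF q(1)] .
    obtain m where m: "n = q ^ k * m" "\<not> q dvd m"
      by (rule multiplicity_decompose' [of n q]) (use less.prems q1 in \<open>auto simp: k_def\<close>)
    have k0: "k > 0" using q less.prems by (simp add: k_def prime_multiplicity_gt_zero_iff)
    have m0: "m > 0" using less.prems m(1) by (cases m) auto
    have pow: "\<chi> (q ^ i) = \<chi> q ^ i" "\<psi> (q ^ i) = \<psi> q ^ i" for i
      by (induction i) (simp_all add: mult one [unfolded One_nat_def])
    have "m < n" using mult_strict_right_mono [OF one_less_power [OF q1 k0] m0] m(1) by simp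
    then have IH: "(\<Sum>d | d dvd m. \<chi> d * \<psi> (m div d)) \<ge> 0" using less.IH m0 by blast
    have "(\<Sum>d | d dvd n. \<chi> d * \<psi> (n div d)) = (\<Sum>(i, d)\<in>{..k} \<times> {d. d dvd m}. (\<chi> q ^ i * \<psi> q ^ (k - i)) * (\<chi> d * \<psi> (m div d)))"
    proof (rule sym, rule sum.reindex_cong [of "\<lambda>(i, d). q ^ i * d", symmetric])
      have cop: "coprime (q ^ i) d" if "d dvd m" for i d
        using that m(2) q(1) by (meson coprime_power_left_iff dvd_trans prime_imp_coprime)
      show "inj_on (\<lambda>(i, d). q ^ i * d) ({..k} \<times> {d. d dvd m})"
      proof (rule inj_onI, clarify)
        fix i d i' d' assume a: "d dvd m" "d' dvd m" "q ^ i * d = q ^ i' * d'"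
        have "q ^ i dvd q ^ i' * d'" "q ^ i' dvd q ^ i * d" by (metis a(3) dvd_triv_left)+
        then have "q ^ i dvd q ^ i'" "q ^ i' dvd q ^ i"
          using cop a(1,2) by (meson coprime_dvd_mult_left_iff)+
        then have "q ^ i = q ^ i'" by (rule dvd_antisym)
        then have "i = i'" using q1 by (simp add: power_inject_exp)
        then show "i = i' \<and> d = d'" using a(3) q1 by simp
      qed
      show "{d. d dvd n} = (\<lambda>(i, d). q ^ i * d) ` ({..k} \<times> {d. d dvd m})"
      proof (intro subset_antisym subsetI)
        fix d assume "d \<in> {d. d dvd n}"
        then obtain x y where xy: "d = x * y" "x dvd q ^ k" "y dvd m"
          unfolding m(1) by (auto elim: dvd_productE)
        then obtain i where "i \<le> k" "x = q ^ i" using q(1) by (auto simp: divides_primepow_nat)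
        with xy show "d \<in> (\<lambda>(i, d). q ^ i * d) ` ({..k} \<times> {d. d dvd m})" by auto
      qed (auto simp: m(1) intro: mult_dvd_mono le_imp_power_dvd)
      fix x assume "x \<in> {..k} \<times> {d. d dvd m}"
      then obtain i d where x: "x = (i, d)" "i \<le> k" "d dvd m" by auto
      obtain e where e: "m = d * e" using x(3) by (rule dvdE)
      have d0: "d > 0" "e > 0" using m0 e by auto
      have "q ^ k = q ^ i * q ^ (k - i)" using x(2) by (simp add: power_add [symmetric])
      then have "n = (q ^ i * d) * (q ^ (k - i) * e)" unfolding m(1) e by simp
      then have "n div (q ^ i * d) = q ^ (k - i) * e"
        using d0 q1 by (metis nonzero_mult_div_cancel_left mult_is_0 not_gr_zero power_eq_0_iff not_one_less_zero)
      moreover have "m div d = e" using d0 e by simp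
      ultimately show "\<chi> ((\<lambda>(i, d). q ^ i * d) x) * \<psi> (n div (\<lambda>(i, d). q ^ i * d) x) =
          (case x of (i, d) \<Rightarrow> \<chi> q ^ i * \<psi> q ^ (k - i) * (\<chi> d * \<psi> (m div d)))"
        by (simp add: x(1) mult pow)
    qed
    also have "\<dots> = (\<Sum>i\<le>k. \<chi> q ^ i * \<psi> q ^ (k - i)) * (\<Sum>d | d dvd m. \<chi> d * \<psi> (m div d))"
      by (simp add: sum_product sum.cartesian_product)
    also have "\<dots> \<ge> 0"
    proof (rule mult_nonneg_nonneg [OF _ IH])
      have alt: "(\<Sum>i\<le>k. (- 1 :: int) ^ i) = (if even k then 1 else 0)" for k
        by (induction k) auto
      from pr [OF q(1)] show "(\<Sum>i\<le>k. \<chi> q ^ i * \<psi> q ^ (k - i)) \<ge> 0"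
      proof (elim disjE conjE)
        assume "\<chi> q = 1" "\<psi> q = - 1"
        then have "(\<Sum>i\<le>k. \<chi> q ^ i * \<psi> q ^ (k - i)) = (\<Sum>i\<le>k. (- 1) ^ (k - i))" by simp
        also have "\<dots> = (\<Sum>i\<le>k. (- 1) ^ i)"
          by (rule sum.reindex_bij_witness [of _ "\<lambda>i. k - i" "\<lambda>i. k - i"]) auto
        finally show ?thesis by (simp add: alt)
      next
        assume "\<chi> q = 0" "\<psi> q = 0"
        then show ?thesis by (intro sum_nonneg) (simp add: power_0_left)
      qed (simp_all add: alt)
    qed
    finally show ?thesis .
  qed
qed

section \<open>Jacobi characters\<close>

text \<open>For odd positive \<open>r\<close> the Jacobi symbol of \<open>x\<close> over
  \<open>r\<close>, with the modulus as first argument.\<close>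

definition jacobi :: "int \<Rightarrow> int \<Rightarrow> int" where
  "jacobi r x = (\<Prod>q\<in>#prime_factorization r. Legendre x q)"

lemma jacobi_mult:
  assumes "odd r"
  shows "jacobi r (x * y) = jacobi r x * jacobi r y"
proof -
  have "Legendre (x * y) q = Legendre x q * Legendre y q" if "q \<in># prime_factorization r" for q
  proof (rule Legendre_mult)
    show "prime q" using that by auto
    have "q dvd r" using that by auto
    then show "odd q" using assms dvd_trans by blast
  qed
  then have "jacobi r (x * y) = (\<Prod>q\<in>#prime_factorization r. Legendre x q * Legendre y q)"
    unfolding jacobi_def by (intro arg_cong [of _ _ prod_mset] image_mset_cong) simp
  then show ?thesis by (simp add: jacobi_def prod_mset.distrib)
qed

lemma jacobi_cong:
  assumes "[x = y] (mod r)"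
  shows "jacobi r x = jacobi r y"
  unfolding jacobi_def
proof (intro arg_cong [of _ _ prod_mset] image_mset_cong Legendre_cong_mod)
  fix q assume "q \<in># prime_factorization r"
  then show "[x = y] (mod q)" using assms by (meson cong_dvd_modulus in_prime_factors_imp_dvd)
qed

lemma abs_jacobi_le: "\<bar>jacobi r x\<bar> \<le> 1"
proof -
  have "\<bar>\<Prod>q\<in>#A. Legendre x q\<bar> \<le> 1" for A
  proof (induction A)
    case (add q A)
    have "\<bar>Legendre x q\<bar> \<le> 1" using Legendre_values [of x q] by auto
    then show ?case using add mult_mono [of "\<bar>Legendre x q\<bar>" 1 "\<bar>\<Prod>q\<in>#A. Legendre x q\<bar>" 1] by (simp add: abs_mult)
  qed simp
  then show ?thesis by (simp add: jacobi_def)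
qed

lemma Legendre_1: "prime (q :: int) \<Longrightarrow> Legendre 1 q = 1"
  using Legendre_square [of q 1] by (metis not_prime_unit one_power2)

lemma jacobi_cong_1:
  assumes "[x = 1] (mod r)"
  shows "jacobi r x = 1"
proof -
  have "jacobi r x = jacobi r 1" by (rule jacobi_cong [OF assms])
  also have "\<dots> = (\<Prod>q\<in>#prime_factorization r. 1)"
    unfolding jacobi_def by (intro arg_cong [of _ _ prod_mset] image_mset_cong Legendre_1) auto
  finally show ?thesis by simp
qed

lemma Legendre_minus_1:
  assumes l: "prime (l :: int)" "odd l"
  shows "Legendre (- 1) l = (if l mod 4 = 3 then - 1 else 1)"
proof -
  have "l > 2" using l prime_ge_2_int [of l] by (cases "l = 2") auto
  define P where "P = nat l"
  have P: "prime P" "2 < P" "int P = l"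
    using l \<open>l > 2\<close> by (auto simp: P_def prime_nat_iff_prime)
  have e: "[Legendre (- 1) l = (- 1) ^ ((P - 1) div 2)] (mod l)"
    using euler_criterion [OF P(1,2), of "- 1"] by (simp add: P(3))
  have "even ((P - 1) div 2) \<longleftrightarrow> P mod 4 \<noteq> 3"
  proof -
    have "odd P" using l(2) P(3) by auto
    then show ?thesis by presburger
  qed
  moreover have "P mod 4 = 3 \<longleftrightarrow> l mod 4 = 3" using P(3) by presburger
  ultimately have "(- 1 :: int) ^ ((P - 1) div 2) = (if l mod 4 = 3 then - 1 else 1)"
    by (simp add: minus_one_power_iff)
  then have "l dvd Legendre (- 1) l - (if l mod 4 = 3 then - 1 else 1)"
    using e by (simp add: cong_iff_dvd_diff)
  moreover have "\<bar>Legendre (- 1) l - (if l mod 4 = 3 then - 1 else 1)\<bar> \<le> 2"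
    using Legendre_values [of "- 1" l] by auto
  ultimately show ?thesis
    using \<open>l > 2\<close> zdvd_not_zless [of "\<bar>Legendre (- 1) l - (if l mod 4 = 3 then - 1 else 1)\<bar>" l] by force
qed

lemma mod_4_eq_3_mult_iff:
  fixes x y :: int
  assumes "odd x" "odd y"
  shows "x * y mod 4 = 3 \<longleftrightarrow> (x mod 4 = 3) \<noteq> (y mod 4 = 3)"
proof -
  have "x mod 4 = 1 \<or> x mod 4 = 3" "y mod 4 = 1 \<or> y mod 4 = 3" using assms by presburger+
  moreover have "x * y mod 4 = (x mod 4) * (y mod 4) mod 4" by (simp add: mod_mult_eq)
  ultimately show ?thesis by auto
qed

text \<open>Reciprocity for products, one prime factor at a time. The signs combine by
  \<open>mod_4_eq_3_mult_iff\<close>, for which oddness of the product is carried through the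
  induction.\<close>

lemma reciprocity_prod_mset:
  assumes l: "prime l" "odd l" and A: "\<And>q. q \<in># A \<Longrightarrow> prime q \<and> odd q \<and> q \<noteq> l"
  shows "Legendre (prod_mset A) l * (\<Prod>q\<in>#A. Legendre l q) =
    (if prod_mset A mod 4 = 3 \<and> l mod 4 = 3 then - 1 else 1) \<and> odd (prod_mset A)"
  using A
proof (induction A)
  case empty
  show ?case using Legendre_1 [OF l(1)] by simp
next
  case (add q A)
  have q: "prime q" "odd q" "q \<noteq> l" using add.prems [of q] by auto
  have IH: "Legendre (prod_mset A) l * (\<Prod>q\<in>#A. Legendre l q) =
      (if prod_mset A mod 4 = 3 \<and> l mod 4 = 3 then - 1 else 1)" "odd (prod_mset A)"
    using add.IH add.prems by auto
  have gt: "q > 2" "l > 2" using q l prime_ge_2_int [of q] prime_ge_2_int [of l] by (cases "q = 2"; cases "l = 2"; auto)+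
  have "Legendre q l * Legendre l q = (- 1) ^ nat ((q - 1) div 2 * ((l - 1) div 2))"
    using Quadratic_Reciprocity_int [of q l] q l gt by (simp add: prime_nat_iff_prime)
  also have "even (nat ((q - 1) div 2 * ((l - 1) div 2))) \<longleftrightarrow> \<not> (q mod 4 = 3 \<and> l mod 4 = 3)"
  proof -
    have "even ((q - 1) div 2) \<longleftrightarrow> q mod 4 \<noteq> 3" "even ((l - 1) div 2) \<longleftrightarrow> l mod 4 \<noteq> 3"
      using q(2) l(2) by presburger+
    moreover have "(q - 1) div 2 * ((l - 1) div 2) \<ge> 0" using gt by simp
    ultimately show ?thesis by (simp add: even_nat_iff)
  qed
  then have "(- 1) ^ nat ((q - 1) div 2 * ((l - 1) div 2)) = (if q mod 4 = 3 \<and> l mod 4 = 3 then - 1 else (1 :: int))"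
    by (simp add: minus_one_power_iff)
  finally have QR: "Legendre q l * Legendre l q = (if q mod 4 = 3 \<and> l mod 4 = 3 then - 1 else 1)" .
  have "Legendre (prod_mset (add_mset q A)) l * (\<Prod>q\<in>#add_mset q A. Legendre l q) =
      (Legendre q l * Legendre l q) * (Legendre (prod_mset A) l * (\<Prod>q\<in>#A. Legendre l q))"
    by (simp add: Legendre_mult [OF l])
  then show ?case
    unfolding QR IH(1) using mod_4_eq_3_mult_iff [OF q(2) IH(2)] q(2) IH(2) by auto
qed

text \<open>Squaring modulo \<open>p\<close> identifies 1 and \<open>p - 1\<close>, so it is not
  injective on the finite set of residues and hence not surjective.\<close>

lemma nonresidue_exists:
  assumes p: "prime (p :: int)" "odd p"
  shows "\<exists>u. Legendre u p = - 1"
proof -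
  have "p > 2" using p prime_ge_2_int [of p] by (cases "p = 2") auto
  let ?f = "\<lambda>x. x\<^sup>2 mod p"
  have "\<not> inj_on ?f {0..<p}"
  proof
    assume "inj_on ?f {0..<p}"
    moreover have "(p - 1)\<^sup>2 mod p = 1\<^sup>2 mod p"
    proof -
      have "(p - 1)\<^sup>2 = 1\<^sup>2 + p * (p - 2)" by (simp add: power2_eq_square algebra_simps)
      then show ?thesis by (metis mod_mult_self2)
    qed
    ultimately have "p - 1 = 1"
      by (rule inj_onD) (use \<open>p > 2\<close> in auto)
    then show False using \<open>p > 2\<close> by simp
  qed
  moreover have "?f ` {0..<p} \<subseteq> {0..<p}" using \<open>p > 2\<close> by auto
  ultimately have "?f ` {0..<p} \<noteq> {0..<p}"
    using finite_surj_inj [of "{0..<p}" ?f] by auto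
  with \<open>?f ` {0..<p} \<subseteq> {0..<p}\<close> obtain u where u: "u \<in> {0..<p}" "u \<notin> ?f ` {0..<p}" by blast
  have "\<not> QuadRes p u"
  proof
    assume "QuadRes p u"
    then obtain y where "[y\<^sup>2 = u] (mod p)" by (auto simp: QuadRes_def)
    then have "u = ?f (y mod p)" using u(1) by (simp add: cong_def power_mod)
    then show False using u(2) \<open>p > 2\<close> by auto
  qed
  moreover have "\<not> [u = 0] (mod p)"
  proof
    assume "[u = 0] (mod p)"
    then have "u = ?f 0" using u(1) by (simp add: cong_def)
    then have "u \<in> ?f ` {0..<p}" by (rule image_eqI) (use \<open>p > 2\<close> in simp)
    then show False using u(2) by blast
  qed
  ultimately show ?thesis by (auto simp: Legendre_def)
qed

section \<open>A split prime that is a nonresidue\<close>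

lemma real_char_if:
  assumes "\<And>x y. f (x * y) = f x * f y" "\<And>x. \<bar>f x\<bar> \<le> 1" "f 1 = 1"
    and "\<And>x y. [x = y] (mod int M) \<Longrightarrow> f x = f y"
  shows "real_char M (\<lambda>x. if coprime x M then f (int x) else 0)"
  unfolding real_char_def
proof (intro conjI allI impI)
  fix x y assume "[x = y] (mod M)"
  then have "coprime x M \<longleftrightarrow> coprime y M" by (metis cong_imp_coprime cong_sym)
  moreover have "f (int x) = f (int y)" using \<open>[x = y] (mod M)\<close> by (intro assms(4)) (simp add: cong_int_iff)
  ultimately show "(if coprime x M then f (int x) else 0) = (if coprime y M then f (int y) else 0)" by simp
qed (use assms in auto)

lemma nat_cong_exists:
  assumes "M > 0" "coprime m m'" "int M = m * m'"
  shows "\<exists>a. [int a = u] (mod m) \<and> [int a = w] (mod m')"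
proof -
  obtain x where x: "[x = u] (mod m)" "[x = w] (mod m')"
    using binary_chinese_remainder_int [OF assms(2)] by blast
  define a where "a = nat (x mod int M)"
  have "int a = x mod int M" using assms(1) by (simp add: a_def)
  then have "[int a = x] (mod int M)" by (simp add: cong_def)
  then have "[int a = x] (mod m)" "[int a = x] (mod m')"
    unfolding assms(3) by (auto intro: cong_modulus_mult simp: mult.commute [of m])
  then show ?thesis using x cong_trans by blast
qed

lemma odd_multiplicity_exists:
  fixes r :: int
  assumes "r > 0" "\<And>s. r \<noteq> s\<^sup>2"
  shows "\<exists>q. prime q \<and> odd (multiplicity q r)"
proof (rule ccontr)
  assume "\<not> ?thesis"
  then have "is_nth_power 2 (normalize r)"
    by (subst is_nth_power_conv_multiplicity) auto
  then show False using assms by (auto simp: is_nth_power_def)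
qed

lemma primes_values_one:
  fixes f :: "nat \<Rightarrow> int"
  assumes mult: "\<And>x y. f (x * y) = f x * f y" "f 1 = 1" and "d > 0" "\<And>q. prime q \<Longrightarrow> q dvd d \<Longrightarrow> f q = 1"
  shows "f d = 1"
  using assms(3,4)
proof (induction d rule: less_induct)
  case (less d)
  show ?case
  proof (cases "d = 1")
    case False
    then obtain q where q: "prime q" "q dvd d" using prime_factor_nat by blast
    then obtain e where e: "d = q * e" by (auto elim: dvdE)
    have "e < d" "e > 0" using less.prems(1) prime_gt_1_nat [OF q(1)] by (auto simp: e)
    then have "f e = 1" using less.IH less.prems(2) by (auto simp: e)
    then show ?thesis using less.prems(2) q by (simp add: e mult)
  qed (use mult(2) in simp)
qed

text \<open>Without such an \<open>l\<close>, every prime not dividing \<open>2 * p * r\<close> that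
  splits has \<open>\<chi>\<close> and \<open>\<psi>\<close> equal to 1, and the convolution is
  nonnegative. It is at least 1 on many explicit numbers, more than \<open>hyperbola_bound\<close>
  permits.\<close>

lemma split_prime_exists:
  assumes p: "prime p" "odd p" and r: "r > 0" "odd r" "\<not> p dvd r" "\<And>s. r \<noteq> s\<^sup>2" and N4: "p * r mod 4 = 3"
  shows "\<exists>l \<rho>. prime l \<and> odd l \<and> \<not> l dvd p * r \<and> l dvd \<rho>\<^sup>2 + p * r \<and> Legendre l p = - 1"
proof (rule ccontr)
  assume none: "\<not> ?thesis"
  define N where "N = p * r"
  have p0: "p > 0" using prime_gt_0_int [OF p(1)] .
  have N0: "N > 0" using p0 r(1) by (simp add: N_def)
  define n where "n = nat N"
  have n: "int n = N" "n > 0" using N0 by (auto simp: n_def)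
  \<comment> \<open>Modulo \<open>2 * N\<close> both characters vanish at 2 and at the primes
    dividing \<open>N\<close>, where no splitting condition is available.\<close>
  define M where "M = 2 * n"
  have M: "int M = 2 * N" "M > 1" using n by (auto simp: M_def)
  define \<chi> where "\<chi> = (\<lambda>x. if coprime x M then Legendre (int x) p else 0)"
  define \<psi> where "\<psi> = (\<lambda>x. if coprime x M then jacobi r (int x) else 0)"
  have pM: "p dvd int M" "r dvd int M" by (simp_all add: M N_def)
  have \<chi>: "real_char M \<chi>"
    unfolding \<chi>_def
  proof (rule real_char_if)
    show "\<bar>Legendre x p\<bar> \<le> 1" for x using Legendre_values [of x p] by auto
    show "Legendre x p = Legendre y p" if "[x = y] (mod int M)" for x y
      using that pM by (meson Legendre_cong_mod cong_dvd_modulus)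
  qed (use p Legendre_1 Legendre_mult in auto)
  have \<psi>: "real_char M \<psi>"
    unfolding \<psi>_def
  proof (rule real_char_if)
    show "jacobi r x = jacobi r y" if "[x = y] (mod int M)" for x y
      using that pM by (meson jacobi_cong cong_dvd_modulus)
  qed (use r jacobi_mult abs_jacobi_le jacobi_cong_1 in auto)
  have cop2: "coprime a M" if "coprime (int a) x" "coprime (int a) y" "int M = x * y" for a x y
  proof -
    have "coprime (int a) (int M)" unfolding that(3) coprime_mult_right_iff using that(1,2) ..
    then show ?thesis by (simp only: coprime_int_iff)
  qed
  have "\<exists>a. \<chi> a = - 1"
  proof -
    obtain u where u: "Legendre u p = - 1" using nonresidue_exists [OF p] by blast
    have "\<not> p dvd 2 * r"
      using odd_prime_not_dvd_2 [OF p] r(3) p(1) by (simp add: prime_dvd_mult_iff)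
    then have "coprime p (2 * r)" using prime_imp_coprime [OF p(1)] by blast
    then obtain a where a: "[int a = u] (mod p)" "[int a = 1] (mod 2 * r)"
      using nat_cong_exists [of M p "2 * r" u 1] M N_def by auto
    have L: "Legendre (int a) p = - 1" using Legendre_cong_mod [OF a(1)] u by simp
    then have "\<not> p dvd int a" using Legendre_eq_0_iff [of "int a" p] by auto
    then have "coprime p (int a)" by (rule prime_imp_coprime [OF p(1)])
    then have "coprime (int a) p" by (rule coprime_commute [THEN iffD1])
    moreover have "coprime (int a) (2 * r)"
      by (rule cong_imp_coprime [OF cong_sym [OF a(2)]]) simp
    ultimately have "coprime a M"
      by (rule cop2) (simp add: M N_def)
    then show ?thesis using L by (auto simp: \<chi>_def)
  qed
  then obtain a1 where a1: "\<chi> a1 = - 1" by blast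
  have "\<exists>a. \<psi> a = - 1"
  proof -
    \<comment> \<open>As \<open>r\<close> is not a square, some prime \<open>q\<close> divides it to
      an odd power. An \<open>a\<close> that is a nonresidue of \<open>q\<close> and 1 modulo the
      cofactor then has Jacobi symbol \<open>(- 1) ^ k = - 1\<close>.\<close>
    obtain q where q: "prime q" "odd (multiplicity q r)" using odd_multiplicity_exists [OF r(1,4)] by blast
    define k where "k = multiplicity q r"
    obtain s where s: "r = q ^ k * s" "\<not> q dvd s"
      by (rule multiplicity_decompose' [of r q]) (use r(1) q(1) in \<open>auto simp: k_def\<close>)
    have s0: "s \<noteq> 0" using r(1) s(1) by auto
    have k: "odd k" using q(2) by (simp add: k_def)
    have "q dvd q ^ k" by (rule dvd_power) (use odd_pos [OF k] in simp)
    then have "q dvd r" unfolding s(1) by (rule dvd_mult2)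
    then have "odd q" "q \<noteq> p" using r by (auto intro: dvd_trans)
    then obtain u where u: "Legendre u q = - 1" using nonresidue_exists q(1) by blast
    have "\<not> q dvd 2 * p * s"
      using odd_prime_not_dvd_2 [OF q(1) \<open>odd q\<close>] s(2) q(1) p(1) \<open>q \<noteq> p\<close>
      by (auto simp: prime_dvd_mult_iff dest: primes_dvd_imp_eq)
    then have "coprime q (2 * p * s)" using prime_imp_coprime [OF q(1)] by blast
    then have "coprime (q ^ k) (2 * p * s)" by simp
    moreover have Mk: "int M = q ^ k * (2 * p * s)" by (simp add: M N_def s(1))
    ultimately obtain a where a: "[int a = u] (mod q ^ k)" "[int a = 1] (mod 2 * p * s)"
      using nat_cong_exists [of M "q ^ k" "2 * p * s" u 1] M(2) by auto
    have "[int a = u] (mod q)"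
      using a(1) by (rule cong_dvd_modulus) (use k in \<open>cases k; auto\<close>)
    then have L: "Legendre (int a) q = - 1" using u by (simp add: Legendre_cong_mod)
    then have "\<not> q dvd int a" using Legendre_eq_0_iff [of "int a" q] by auto
    then have "coprime q (int a)" by (rule prime_imp_coprime [OF q(1)])
    then have "coprime (int a) q" by (rule coprime_commute [THEN iffD1])
    then have "coprime (int a) (q ^ k)" by simp
    moreover have "coprime (int a) (2 * p * s)"
      by (rule cong_imp_coprime [OF cong_sym [OF a(2)]]) simp
    ultimately have "coprime a M"
      using Mk by (rule cop2)
    moreover have "jacobi r (int a) = - 1"
    proof -
      have "prime_factorization r = replicate_mset k q + prime_factorization s"
        unfolding s(1) using s0 q(1) by (subst prime_factorization_mult) (auto simp: prime_factorization_prime_power)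
      then have "jacobi r (int a) = Legendre (int a) q ^ k * jacobi s (int a)"
        by (simp add: jacobi_def)
      also have "jacobi s (int a) = 1"
        by (rule jacobi_cong_1, rule cong_dvd_modulus [OF a(2)]) simp
      finally show ?thesis using L k by simp
    qed
    ultimately show ?thesis by (auto simp: \<psi>_def)
  qed
  then obtain a2 where a2: "\<psi> a2 = - 1" by blast
  have mult: "\<chi> (x * y) = \<chi> x * \<chi> y" "\<psi> (x * y) = \<psi> x * \<psi> y" for x y
    using \<chi> \<psi> unfolding real_char_def by blast+
  have one: "\<chi> 1 = 1" "\<psi> 1 = 1"
    using \<chi> \<psi> unfolding real_char_def by blast+
  have le1: "\<bar>\<chi> x\<bar> \<le> 1" "\<bar>\<psi> x\<bar> \<le> 1" for x
    using \<chi> \<psi> unfolding real_char_def by blast+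
  have upper: "\<bar>\<Sum>m\<in>{1..Z\<^sup>2}. \<Sum>d | d dvd m. \<chi> d * \<psi> (m div d)\<bar> \<le> 3 * int M * int Z" for Z
    by (rule hyperbola_bound)
       (use real_char_sum_bound [OF \<chi> M(2) a1] real_char_sum_bound [OF \<psi> M(2) a2] le1 in auto)
  \<comment> \<open>Since \<open>N\<close> is 3 modulo 4, the sign in the reciprocity law is the
    symbol of \<open>- 1\<close> and cancels, so \<open>\<chi> q * \<psi> q\<close> tells whether
    \<open>q\<close> splits.\<close>
  have chars: "Legendre (- N) (int q) = \<chi> q * \<psi> q \<and> \<chi> q \<noteq> 0 \<and> prime (int q) \<and> odd (int q) \<and> \<not> int q dvd N"
    if q: "prime q" "coprime q M" for q
  proof -
    define l where "l = int q"
    have "coprime l (int M)" using q(2) by (simp add: l_def)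
    then have "coprime l (2 * N)" by (simp only: M(1))
    then have lc: "coprime l 2" "coprime l N" by auto
    have l: "prime l" "odd l" using q(1) lc(1) by (auto simp: l_def)
    have lN: "\<not> l dvd N" using lc(2) l(1) by (meson coprime_common_divisor dvd_refl not_prime_unit)
    have "Legendre (prod_mset (add_mset p (prime_factorization r))) l *
        (\<Prod>q\<in>#add_mset p (prime_factorization r). Legendre l q) =
        (if prod_mset (add_mset p (prime_factorization r)) mod 4 = 3 \<and> l mod 4 = 3 then - 1 else 1)"
    proof (rule conjunct1 [OF reciprocity_prod_mset [OF l]])
      fix q' assume q': "q' \<in># add_mset p (prime_factorization r)"
      then have "prime q'" using p(1) by auto
      moreover have "q' = p \<or> q' dvd r" using q' by auto
      then have "q' dvd N" by (auto simp: N_def)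
      moreover have "odd q'" using q' p(2) r(2) by (auto intro: dvd_trans)
      ultimately show "prime q' \<and> odd q' \<and> q' \<noteq> l" using lN by auto
    qed
    then have rec: "Legendre N l * (Legendre l p * jacobi r l) = (if l mod 4 = 3 then - 1 else 1)"
      using N4 r(1) by (simp add: prod_mset_prime_factorization_int jacobi_def N_def)
    have "Legendre N l \<noteq> 0" using lN by (simp add: Legendre_eq_0_iff)
    then have sq: "(Legendre N l)\<^sup>2 = 1" using Legendre_values [of N l] by auto
    have "Legendre (- N) l = Legendre (- 1) l * Legendre N l"
      using Legendre_mult [OF l, of "- 1" N] by simp
    then have "Legendre (- N) l = (Legendre N l * (Legendre l p * jacobi r l)) * Legendre N l"
      unfolding rec Legendre_minus_1 [OF l] .
    also have "\<dots> = (Legendre N l)\<^sup>2 * (Legendre l p * jacobi r l)" by (simp add: power2_eq_square)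
    finally have 1: "Legendre (- N) l = Legendre l p * jacobi r l" by (simp only: sq mult_1)
    have "Legendre (- N) l \<noteq> 0" using lN by (simp add: Legendre_eq_0_iff)
    then have "Legendre l p \<noteq> 0" using 1 by auto
    then show ?thesis using 1 q l lN by (simp add: \<chi>_def \<psi>_def l_def)
  qed
  \<comment> \<open>Here the assumption enters: a split \<open>q\<close> cannot be a nonresidue of
    \<open>p\<close>, so \<open>\<chi> q\<close> is 1, and the product 1 gives
    \<open>\<psi> q\<close>.\<close>
  have split: "\<chi> q = 1 \<and> \<psi> q = 1" if q: "prime q" "coprime q M" and \<rho>: "int q dvd \<rho>\<^sup>2 + N" for q \<rho>
  proof -
    have c: "Legendre (- N) (int q) = \<chi> q * \<psi> q" "\<chi> q \<noteq> 0" "prime (int q)" "odd (int q)" "\<not> int q dvd N"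
      using chars [OF q] by auto
    have "Legendre (int q) p \<noteq> - 1" using none c \<rho> unfolding N_def by blast
    then have "\<chi> q = 1" using c(2) Legendre_values [of "int q" p] by (auto simp: \<chi>_def split: if_splits)
    moreover have "Legendre (- N) (int q) = 1"
    proof -
      have "QuadRes (int q) (- N)"
        unfolding QuadRes_def using \<rho> by (intro exI [of _ \<rho>]) (simp add: cong_iff_dvd_diff)
      then show ?thesis using c(5) by (simp add: Legendre_def cong_0_iff)
    qed
    ultimately show ?thesis using c(1) by simp
  qed
  have nonneg: "(\<Sum>d | d dvd m. \<chi> d * \<psi> (m div d)) \<ge> 0" if "m > 0" for m
  proof (rule convolution_nonneg [OF mult one _ that])
    fix q :: nat assume q: "prime q"
    show "(\<chi> q = 0 \<and> \<psi> q = 0) \<or> (\<chi> q = 1 \<and> \<psi> q = 1) \<or> (\<chi> q = 1 \<and> \<psi> q = - 1) \<or> (\<chi> q = - 1 \<and> \<psi> q = 1)"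
    proof (cases "coprime q M")
      case True
      have c: "Legendre (- N) (int q) = \<chi> q * \<psi> q" "\<chi> q \<noteq> 0" "\<not> int q dvd N"
        using chars [OF q True] by auto
      show ?thesis
      proof (cases "Legendre (- N) (int q) = 1")
        case True': True
        then have "QuadRes (int q) (- N)" by (auto simp: Legendre_def split: if_splits)
        then obtain \<rho> where "[\<rho>\<^sup>2 = - N] (mod int q)" by (auto simp: QuadRes_def)
        then have "int q dvd \<rho>\<^sup>2 + N" by (simp add: cong_iff_dvd_diff)
        from split [OF q True this] show ?thesis by simp
      next
        case False
        have "Legendre (- N) (int q) \<noteq> 0" using c(3) by (simp add: Legendre_eq_0_iff)
        then have "\<chi> q * \<psi> q = - 1" using False c(1) Legendre_values [of "- N" "int q"] by auto
        moreover have "\<chi> q = 1 \<or> \<chi> q = - 1" using c(2) le1(1) [of q] by linarith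
        ultimately show ?thesis by auto
      qed
    qed (simp add: \<chi>_def \<psi>_def)
  qed
  txt \<open>
    The numbers \<open>(1 + 2nt)\<^sup>2 + n4\<^sup>j\<close> only have prime factors that split, so both characters are 1 on
    their divisors.  The lower bound on \<open>t\<close> makes them distinct, and \<open>J\<close>, \<open>L\<close> are chosen such that there are
    more than \<open>6nZ\<close> of them up to \<open>Z\<^sup>2\<close>.
  \<close>
  define J where "J = 12 * n\<^sup>2 + 1"
  define K where "K = n * 4 ^ J"
  define L where "L = 6 * n * (1 + K + 2 * n * K)"
  define Z where "Z = 1 + 2 * n * (K + L) + K"
  define F where "F = (\<lambda>(j, t). (1 + 2 * n * t)\<^sup>2 + n * 4 ^ j)"
  have jK: "n * 4 ^ j \<le> K" if "j \<le> J" for j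
    unfolding K_def using that by (intro mult_le_mono2 power_increasing) auto
  \<comment> \<open>For \<open>t \<ge> K\<close> the gap between consecutive squares exceeds every
    \<open>n * 4 ^ j\<close> with \<open>j \<le> J\<close>, so the values for different
    \<open>t\<close> do not interleave.\<close>
  have Flt: "F (j, t) < F (j', t')" if "j \<le> J" "K \<le> t" "t < t'" for j t j' t'
  proof -
    define x where "x = 1 + 2 * n * t"
    have "x + 1 \<le> 1 + 2 * n * t'"
    proof -
      have "2 * n * (t + 1) \<le> 2 * n * t'" using that(3) by (intro mult_le_mono2) simp
      then show ?thesis using n(2) unfolding x_def by (simp add: algebra_simps)
    qed
    then have "(x + 1)\<^sup>2 \<le> (1 + 2 * n * t')\<^sup>2" by (rule power_mono) simp
    moreover have "x > K"
    proof -
      have "1 * t \<le> (2 * n) * t" using n(2) by (intro mult_le_mono1) simp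
      then show ?thesis using that(2) unfolding x_def by linarith
    qed
    then have "x\<^sup>2 + n * 4 ^ j < (x + 1)\<^sup>2"
    proof -
      have "(x + 1)\<^sup>2 = x\<^sup>2 + 2 * x + 1" by (simp add: power2_eq_square)
      then show ?thesis using \<open>x > K\<close> jK [OF that(1)] by linarith
    qed
    ultimately have "x\<^sup>2 + n * 4 ^ j < (1 + 2 * n * t')\<^sup>2" by linarith
    then have "x\<^sup>2 + n * 4 ^ j < (1 + 2 * n * t')\<^sup>2 + n * 4 ^ j'" by linarith
    then show ?thesis unfolding F_def x_def prod.case .
  qed
  have injF: "inj_on F ({1..J} \<times> {K..K + L})"
  proof (rule inj_onI, clarify)
    fix j t j' t' assume a: "j \<in> {1..J}" "j' \<in> {1..J}" "t \<in> {K..K + L}" "t' \<in> {K..K + L}" "F (j, t) = F (j', t')"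
    have "t = t'"
      using Flt [of j t t' j'] Flt [of j' t' t j] a by (cases t t' rule: linorder_cases) auto
    then have "n * 4 ^ j = n * 4 ^ j'" using a(5) by (simp add: F_def)
    then have "j = j'" using n(2) by (simp add: power_inject_exp)
    with \<open>t = t'\<close> show "j = j' \<and> t = t'" by simp
  qed
  have FZ: "F x \<in> {1..Z\<^sup>2}" if x: "x \<in> {1..J} \<times> {K..K + L}" for x
  proof -
    obtain j t where jt: "x = (j, t)" "j \<le> J" "t \<le> K + L" using x by auto
    have "1 + 2 * n * t \<le> 1 + 2 * n * (K + L)" using jt(3) by simp
    then have "(1 + 2 * n * t)\<^sup>2 \<le> (1 + 2 * n * (K + L))\<^sup>2" by (rule power_mono) simp
    moreover have "(1 + 2 * n * (K + L))\<^sup>2 + K \<le> Z\<^sup>2"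
      unfolding Z_def by (simp add: power2_eq_square algebra_simps)
    ultimately have "F x \<le> Z\<^sup>2" unfolding jt(1) F_def prod.case using jK [OF jt(2)] by linarith
    moreover have "1 \<le> (1 + 2 * n * t)\<^sup>2" by (rule one_le_power) simp
    then have "1 \<le> F x" unfolding jt(1) F_def prod.case by linarith
    ultimately show ?thesis by simp
  qed
  have F1: "(\<Sum>d | d dvd F x. \<chi> d * \<psi> (F x div d)) \<ge> 1" if x: "x \<in> {1..J} \<times> {K..K + L}" for x
  proof -
    obtain j t where jt: "x = (j, t)" "1 \<le> j" using x by auto
    define y where "y = 1 + 2 * n * t"
    have Fx: "F x = y\<^sup>2 + n * 4 ^ j" by (simp add: F_def jt y_def)
    have F0: "F x > 0" using FZ [OF x] by simp
    \<comment> \<open>Since \<open>j \<ge> 1\<close>, the number \<open>F x\<close> is odd, and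
      \<open>y\<close> is 1 modulo \<open>n\<close>, so \<open>q\<close> is prime to
      \<open>M\<close>. Dividing by \<open>4 ^ j\<close>, with \<open>w\<close> the inverse of
      \<open>2 ^ j\<close>, shows that \<open>y * w\<close> is a root of \<open>- N\<close> modulo
      \<open>q\<close>.\<close>
    have q1: "\<chi> q = 1 \<and> \<psi> q = 1" if q: "prime q" "q dvd F x" for q
    proof -
      have "odd (F x)" using jt(2) by (cases j) (auto simp: Fx y_def)
      then have "odd q" using q(2) dvd_trans by blast
      have "\<not> q dvd n"
      proof
        assume "q dvd n"
        then have "q dvd y\<^sup>2" using q(2) unfolding Fx by (metis dvd_add_left_iff dvd_mult2)
        then have "q dvd y" using q(1) prime_dvd_power by blast
        moreover have "q dvd 2 * n * t" using \<open>q dvd n\<close> by simp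
        ultimately have "q dvd 1" unfolding y_def by (metis dvd_add_left_iff)
        then show False using q(1) by simp
      qed
      moreover have "\<not> q dvd 2"
      proof
        assume "q dvd 2"
        then have "q = 2" using q(1) two_is_prime_nat primes_dvd_imp_eq by blast
        then show False using \<open>odd q\<close> by simp
      qed
      ultimately have "\<not> q dvd M" using q(1) by (simp add: M_def prime_dvd_mult_iff)
      then have cop: "coprime q M" using prime_imp_coprime [OF q(1)] by blast
      have "coprime (2 ^ j) q" using \<open>odd q\<close> by simp
      then have "coprime (2 ^ j) (int q)" by (metis coprime_int_iff of_nat_numeral of_nat_power)
      then obtain w where w: "[2 ^ j * w = 1] (mod int q)" using cong_solve_coprime_int by blast
      then have "int q dvd 2 ^ j * w - 1" by (simp add: cong_iff_dvd_diff)
      then have "int q dvd (2 ^ j * w - 1) * - ((2 ^ j * w + 1) * N)" by (rule dvd_mult2)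
      moreover have "int q dvd int (F x) * w\<^sup>2" using q(2) by simp
      ultimately have "int q dvd int (F x) * w\<^sup>2 + (2 ^ j * w - 1) * - ((2 ^ j * w + 1) * N)"
        by (rule dvd_add [rotated])
      also have "int (F x) * w\<^sup>2 + (2 ^ j * w - 1) * - ((2 ^ j * w + 1) * N) = (int y * w)\<^sup>2 + N"
      proof -
        have "(4 :: int) ^ j = 2 ^ j * 2 ^ j" by (simp add: power_mult_distrib [symmetric])
        then show ?thesis unfolding Fx by (simp add: n(1) power2_eq_square algebra_simps)
      qed
      finally have "int q dvd (int y * w)\<^sup>2 + N" .
      then show ?thesis by (rule split [OF q(1) cop])
    qed
    have val: "\<chi> d = 1" "\<psi> d = 1" if "d dvd F x" for d
    proof -
      have "d > 0" using that F0 by (auto intro: Nat.gr0I)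
      show "\<chi> d = 1"
        by (rule primes_values_one [OF mult(1) one(1) \<open>d > 0\<close>]) (use q1 that dvd_trans in blast)
      show "\<psi> d = 1"
        by (rule primes_values_one [OF mult(2) one(2) \<open>d > 0\<close>]) (use q1 that dvd_trans in blast)
    qed
    have "(\<Sum>d | d dvd F x. \<chi> d * \<psi> (F x div d)) = (\<Sum>d | d dvd F x. 1)"
    proof (rule sum.cong [OF refl])
      fix d assume "d \<in> {d. d dvd F x}"
      then have "d dvd F x" "F x div d dvd F x" by (auto simp: dvd_div_eq_mult elim!: dvdE)
      then show "\<chi> d * \<psi> (F x div d) = 1" by (simp add: val)
    qed
    also have "\<dots> = int (card {d. d dvd F x})" by simp
    also have "card {d. d dvd F x} > 0"
      using F0 by (subst card_gt_0_iff) auto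
    then have "int (card {d. d dvd F x}) \<ge> 1" by simp
    finally show ?thesis .
  qed
  have "int (card (F ` ({1..J} \<times> {K..K + L}))) \<le> (\<Sum>m\<in>F ` ({1..J} \<times> {K..K + L}). \<Sum>d | d dvd m. \<chi> d * \<psi> (m div d))"
    using sum_mono [of "F ` ({1..J} \<times> {K..K + L})" "\<lambda>_. 1" "\<lambda>m. \<Sum>d | d dvd m. \<chi> d * \<psi> (m div d)"] F1 by auto
  also have "\<dots> \<le> (\<Sum>m\<in>{1..Z\<^sup>2}. \<Sum>d | d dvd m. \<chi> d * \<psi> (m div d))"
    by (rule sum_mono2) (use FZ nonneg in auto)
  also have "\<dots> \<le> 3 * int M * int Z" using upper [of Z] by linarith
  finally have "int (J * (L + 1)) \<le> int (3 * M * Z)"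
    using card_image [OF injF] by (simp add: card_cartesian_product)
  then have "J * (L + 1) \<le> 3 * M * Z" by (simp only: of_nat_le_iff)
  \<comment> \<open>\<open>J\<close> and \<open>L\<close> are tuned so that the number of values
    exceeds the upper bound by exactly \<open>J\<close>.\<close>
  moreover have "3 * M * Z = L + 12 * n\<^sup>2 * L"
    unfolding M_def Z_def L_def by (simp add: power2_eq_square algebra_simps)
  moreover have "J * (L + 1) = L + 12 * n\<^sup>2 * L + J" by (simp add: J_def algebra_simps)
  ultimately show False by (simp add: J_def)
qed

section \<open>The congruence\<close>

theorem theorem3p3:
  fixes p \<delta> k n :: int
  assumes "prime p" and "odd p" and "\<not> [p = 7] (mod 8)"
    and "[8 * \<delta> = 1] (mod p ^ 2)"
    and "Legendre k p = 1"
  shows "[N_A (p ^ 2 * n + (p * k + 1) * \<delta>) = 0] (mod 4)"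
proof -
  define m where "m = p ^ 2 * n + (p * k + 1) * \<delta>"
  have p0: "p > 0" using prime_gt_0_int [OF assms(1)] .
  \<comment> \<open>\<open>N = 8 * m - 1\<close> is positive only for \<open>m > 0\<close>.
    Otherwise the coefficient is 0: by convention for negative \<open>m\<close>, and by the factor
    \<open>q\<close> of the series for \<open>m = 0\<close>.\<close>
  consider "m < 0" | "m = 0" | "m > 0" by linarith
  then have "[N_A m = 0] (mod 4)"
  proof cases
    case 1
    then show ?thesis by (simp add: N_A_def)
  next
    case 2
    then show ?thesis by (simp add: N_A_def mock_A_eq_fine)
  next
    case 3
    define N where "N = 8 * m - 1"
    obtain t where t: "8 * \<delta> = 1 + p\<^sup>2 * t"
      using assms(4) by (metis cong_iff_lin cong_sym)
    \<comment> \<open>Inserting \<open>8 * \<delta> = 1 + p\<^sup>2 * t\<close> into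
      \<open>8 * m - 1\<close> cancels the constant term; dividing by \<open>p\<close> leaves this
      \<open>r\<close>, congruent to \<open>k\<close> modulo \<open>p\<close>.\<close>
    define r where "r = k + p * (8 * n + (p * k + 1) * t)"
    have "N = 8 * (p\<^sup>2 * n) + (p * k + 1) * (8 * \<delta>) - 1"
      by (simp add: N_def m_def algebra_simps)
    then have N: "N = p * r"
      unfolding t by (simp add: r_def power2_eq_square algebra_simps)
    have N8: "N mod 8 = 7" unfolding N_def by presburger
    then have N4: "p * r mod 4 = 3" unfolding N [symmetric] by presburger
    have "N > 0" using 3 by (simp add: N_def)
    then have r0: "r > 0" using p0 by (simp add: N zero_less_mult_iff)
    have "odd N" by (simp add: N_def)
    then have r_odd: "odd r" by (simp add: N)
    have "[r = k] (mod p)" by (simp add: r_def cong_iff_dvd_diff)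
    then have L: "Legendre r p = 1" using Legendre_cong_mod assms(5) by simp
    then have r_p: "\<not> p dvd r" using Legendre_eq_0_iff [of r p] by simp
    \<comment> \<open>An odd square is 1 modulo 8, so \<open>p\<close> would be congruent to
      \<open>N\<close>, that is, to 7.\<close>
    have r_square: "r \<noteq> s\<^sup>2" for s
    proof
      assume s: "r = s\<^sup>2"
      then have "odd s" using r_odd by simp
      then have "s mod 8 = 1 \<or> s mod 8 = 3 \<or> s mod 8 = 5 \<or> s mod 8 = 7" by presburger
      then have "(s mod 8)\<^sup>2 mod 8 = 1" by auto
      then have "[r = 1] (mod 8)" by (simp add: s cong_def power_mod)
      then have "[p * r = p * 1] (mod 8)" by (rule cong_scalar_left)
      then have "[p = 7] (mod 8)" using N8 by (simp add: N cong_def)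
      with assms(3) show False by simp
    qed
    obtain l \<rho> where "prime l" "odd l" "\<not> l dvd N" "l dvd \<rho>\<^sup>2 + N" "Legendre l p = - 1"
      using split_prime_exists [OF assms(1,2) r0 r_odd r_p r_square N4] unfolding N by blast
    then have "4 dvd card (red_set N)"
      by (rule four_dvd_card_red_set [OF N N8 r0 L r_square assms(1,2) r_p])
    then have "4 dvd - ((- 1) ^ nat m) * int (card (red_set N))"
      by (intro dvd_mult) presburger
    then show ?thesis
      using N_A_cong_card_red_set [of "nat m"] 3
      by (simp add: N_A_def N_def cong_0_iff cong_dvd_iff)
  qed
  then show ?thesis by (simp only: m_def)
qed

end
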